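(* Let $(X_1,T_1)$ and $(X_2,T_2)$ be minimal Cantor systems. If $(X_1,T_1)$ and $(X_2,T_2)$ are orbit equivalent, then $(X_1,T_1)$ and $(X_2,T_2)$ are speedup equivalent.
   Context: A Cantor space is a nonempty compact, metrizable, perfect, zero-dimensional space. A minimal Cantor system $(X,T)$ is a Cantor space $X$ with a homeomorphism $T:X\to X$ all of whose orbits $\{T^n(x):n\in\mathbb{Z}\}$ are dense. $\mathbb{Z}^+$ denotes the positive integers. $(Y,S)$ is a speedup of $(X,T)$ if there is a function $p:X\to\mathbb{Z}^+$ such that $(Y,S)$ is topologically conjugate to $(X,T')$, where $T'(x)=T^{p(x)}(x)$ for all $x\in X$. Two minimal Cantor systems are speedup equivalent if each is a speedup of the other. Two minimal Cantor systems $(X,T)$ and $(Y,S)$ are orbit equivalent if $(Y,S)$ is topologically conjugate to some $T':X\to X$ such that $T$ and $T'$ have the same orbits. *)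

theory Defs
  imports "HOL-Analysis.Analysis"
begin

text \<open>
  Spaces are carried by values of type \<open>'a topology\<close>; a self-map \<open>T\<close> of \<open>X\<close> is a function on the
  whole type of which only the values on \<open>topspace X\<close> matter.
\<close>

text \<open>
  Zero-dimensionality is the library's small inductive dimension bound \<open>X dim_le 0\<close> (a base of
  clopen sets, by \<open>dimension_le_0_neighbourhood_base_of_clopen\<close>).
\<close>

definition cantor_space :: "'a topology \<Rightarrow> bool" where
  "cantor_space X \<longleftrightarrow>
     topspace X \<noteq> {} \<and> compact_space X \<and> metrizable_space X \<and>
     X derived_set_of topspace X = topspace X \<and> X dim_le 0"

text \<open>Intended for \<open>T\<close> a bijection of \<open>topspace X\<close>; negative powers iterate the inverse on \<open>topspace X\<close>.\<close>

definition int_iterate :: "'a topology \<Rightarrow> ('a \<Rightarrow> 'a) \<Rightarrow> int \<Rightarrow> 'a \<Rightarrow> 'a" where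
  "int_iterate X T n =
     (if 0 \<le> n then T ^^ nat n else inv_into (topspace X) T ^^ nat (- n))"

definition orbit_of :: "'a topology \<Rightarrow> ('a \<Rightarrow> 'a) \<Rightarrow> 'a \<Rightarrow> 'a set" where
  "orbit_of X T x = {int_iterate X T n x | n. True}"

definition minimal_cantor_system :: "'a topology \<Rightarrow> ('a \<Rightarrow> 'a) \<Rightarrow> bool" where
  "minimal_cantor_system X T \<longleftrightarrow>
     cantor_space X \<and> homeomorphic_map X X T \<and>
     (\<forall>x\<in>topspace X. X closure_of orbit_of X T x = topspace X)"

definition topologically_conjugate ::
    "'b topology \<Rightarrow> ('b \<Rightarrow> 'b) \<Rightarrow> 'a topology \<Rightarrow> ('a \<Rightarrow> 'a) \<Rightarrow> bool" where
  "topologically_conjugate Y S X T \<longleftrightarrow>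
     (\<exists>h. homeomorphic_map Y X h \<and> (\<forall>y\<in>topspace Y. h (S y) = T (h y)))"

text \<open>
  \<open>speedup_of Y S X T\<close> reads: \<open>(Y, S)\<close> is a speedup of \<open>(X, T)\<close>. No regularity of \<open>p\<close> is assumed;
  that \<open>\<lambda>x. (T ^^ p x) x\<close> is a homeomorphism of \<open>X\<close> follows from the conjugacy when \<open>S\<close> is one of \<open>Y\<close>.
\<close>

definition speedup_of ::
    "'b topology \<Rightarrow> ('b \<Rightarrow> 'b) \<Rightarrow> 'a topology \<Rightarrow> ('a \<Rightarrow> 'a) \<Rightarrow> bool" where
  "speedup_of Y S X T \<longleftrightarrow>
     (\<exists>p :: 'a \<Rightarrow> nat. (\<forall>x\<in>topspace X. 0 < p x) \<and>
        topologically_conjugate Y S X (\<lambda>x. (T ^^ p x) x))"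

definition speedup_equivalent ::
    "'a topology \<Rightarrow> ('a \<Rightarrow> 'a) \<Rightarrow> 'b topology \<Rightarrow> ('b \<Rightarrow> 'b) \<Rightarrow> bool" where
  "speedup_equivalent X T Y S \<longleftrightarrow> speedup_of Y S X T \<and> speedup_of X T Y S"

text \<open>As above, \<open>T'\<close> is a homeomorphism of \<open>X\<close> by conjugacy to \<open>S\<close>, so its two-sided orbits make sense.\<close>

definition orbit_equivalent ::
    "'a topology \<Rightarrow> ('a \<Rightarrow> 'a) \<Rightarrow> 'b topology \<Rightarrow> ('b \<Rightarrow> 'b) \<Rightarrow> bool" where
  "orbit_equivalent X T Y S \<longleftrightarrow>
     (\<exists>T'. T' \<in> topspace X \<rightarrow> topspace X \<and> topologically_conjugate Y S X T' \<and>
        (\<forall>x\<in>topspace X. orbit_of X T' x = orbit_of X T x))"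

end

theory Submission
  imports Defs
begin

text \<open>
  Let \<open>T\<close> and \<open>S\<close> be minimal homeomorphisms of the same space with the same orbits. Every
  \<open>T\<close>-invariant mean on the clopen sets is then \<open>S\<close>-invariant, and by a back-and-forth argument of
  Glasner and Weiss two clopen sets with the same means are related by a homeomorphism of the form
  \<open>x \<mapsto> T\<^bsup>p(x)\<^esup> x\<close> with \<open>p > 0\<close>. Starting from a homeomorphism \<open>h\<^sub>0\<close> that preserves all means, one
  constructs \<open>h\<^sub>n\<close> that conjugate \<open>S\<close> to positive powers of \<open>T\<close> off the preimage \<open>S\<^sup>-\<^sup>1 Y\<^sub>n\<close> of a
  clopen set \<open>Y\<^sub>n\<close>, where the \<open>Y\<^sub>n\<close> shrink to a point \<open>y\<close>. Here \<open>h\<^bsub>n+1\<^esub>\<close> maps each level of a fine tower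
  partition over \<open>Y\<^bsub>n+1\<^esub>\<close> to the same set as \<open>h\<^sub>n\<close>, so that \<open>h\<^sub>n\<close> converges to a homeomorphism, and all
  \<open>h\<^sub>n\<close> agree at \<open>y\<close> and \<open>S\<^sup>-\<^sup>1 y\<close>, which takes care of the remaining point \<open>S\<^sup>-\<^sup>1 y\<close>.
\<close>

subsection \<open>Clopen algebras of Cantor spaces\<close>

text \<open>Orbit equivalence writes S x as an integral power of T at x, but the exponent may have
  either sign and need not depend continuously on x, so no conjugacy can be read off from it. What
  it does give is invariance of means, and means alone decide when one clopen set embeds into
  another by positive powers of T. The obstacle is the limit: a relation h(S x) = T^p (h x) may be
  lost when p depends on the stage. Hence every correction made after stage n commutes with S off
  the preimage of Y_n, so that there all later stages intertwine S with one fixed homeomorphism,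
  whose exponents are already known. The single orbit step left over has no such protection; its
  exponent must be positive from the start, which is why h_0 cannot always be the identity. Having
  the same orbits is a symmetric relation, so a construction of one speedup, used twice, yields
  both.\<close>

text \<open>The topology is encoded by the algebra \<open>Cl\<close> of clopen sets. Homeomorphisms of \<open>X\<close> are extended
  to bijections of the whole type, so that inverses and their iterates are global functions.\<close>

locale cantor_algebra = algebra X Cl for X :: "'a set" and Cl :: "'a set set" +
  fixes E :: "nat \<Rightarrow> 'a set"
  assumes E_in: "E i \<in> Cl"
    and E_separates: "x \<in> X \<Longrightarrow> y \<in> X \<Longrightarrow> x \<noteq> y \<Longrightarrow> \<exists>i. x \<in> E i \<longleftrightarrow> y \<notin> E i"
    and cover: "\<U> \<subseteq> Cl \<Longrightarrow> X \<subseteq> \<Union>\<U> \<Longrightarrow> \<exists>\<V>\<subseteq>\<U>. finite \<V> \<and> X \<subseteq> \<Union>\<V>"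
    and infinite_X: "infinite X"
begin

(* As introduction rules these make the classical reasoner diverge on goals about Cl. *)
declare finite_INT [rule del] finite_Union [rule del] finite_UN [rule del]

lemma Cl_subset: "A \<in> Cl \<Longrightarrow> A \<subseteq> X"
  using sets_into_space by blast

lemma cover_index:
  assumes "\<And>i. i \<in> I \<Longrightarrow> U i \<in> Cl" "X \<subseteq> (\<Union>i\<in>I. U i)"
  shows "\<exists>J\<subseteq>I. finite J \<and> X \<subseteq> (\<Union>i\<in>J. U i)"
proof -
  obtain \<V> where "\<V> \<subseteq> U ` I" "finite \<V>" "X \<subseteq> \<Union>\<V>"
    using cover[of "U ` I"] assms by auto
  then show ?thesis
    by (metis finite_subset_image)
qed

lemma cover_nat:
  assumes "\<And>i::nat. U i \<in> Cl" "X \<subseteq> (\<Union>i. U i)"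
  shows "\<exists>n. X \<subseteq> (\<Union>i\<in>{..n}. U i)"
proof -
  obtain J where "finite J" "X \<subseteq> (\<Union>i\<in>J. U i)"
    using cover_index[of UNIV U] assms by auto
  moreover from this obtain n where "J \<subseteq> {..n}"
    using finite_nat_iff_bounded_le by auto
  ultimately show ?thesis by (meson UN_mono order_refl order_trans)
qed

lemma INT_in: "finite I \<Longrightarrow> (\<And>i. i \<in> I \<Longrightarrow> A i \<in> Cl) \<Longrightarrow> X \<inter> (\<Inter>i\<in>I. A i) \<in> Cl"
proof (induction I rule: finite_induct)
  case (insert i I)
  then have "A i \<inter> (X \<inter> (\<Inter>i\<in>I. A i)) \<in> Cl" using Int[of "A i" "X \<inter> (\<Inter>i\<in>I. A i)"] by simp
  then show ?case by (simp add: Int_left_commute)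
qed simp

lemma Collect_iff_in: "A \<in> Cl \<Longrightarrow> {y\<in>X. y \<in> A \<longleftrightarrow> P} \<in> Cl"
proof (cases P)
  case True
  assume "A \<in> Cl"
  moreover from this have "{y\<in>X. y \<in> A \<longleftrightarrow> P} = A" using True Cl_subset by auto
  ultimately show ?thesis by simp
next
  case False
  assume "A \<in> Cl"
  moreover have "{y\<in>X. y \<in> A \<longleftrightarrow> P} = X - A" using False by auto
  ultimately show ?thesis using compl_sets by simp
qed

section \<open>Cylinders and separation by clopen sets\<close>

definition cyl :: "nat \<Rightarrow> 'a \<Rightarrow> 'a set" where
  "cyl n x = {y\<in>X. \<forall>i<n. y \<in> E i \<longleftrightarrow> x \<in> E i}"

lemma cyl_in: "cyl n x \<in> Cl"
proof -
  have "cyl n x = X \<inter> (\<Inter>i\<in>{..<n}. {y\<in>X. y \<in> E i \<longleftrightarrow> x \<in> E i})"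
    by (auto simp: cyl_def)
  then show ?thesis using INT_in[of "{..<n}"] Collect_iff_in E_in by auto
qed

lemma cyl_self: "x \<in> X \<Longrightarrow> x \<in> cyl n x"
  by (auto simp: cyl_def)

text \<open>Compactness turns the separating sequence into a base: the clopen sets
  \<open>A \<union> (X - cyl n x)\<close> increase with \<open>n\<close> and cover \<open>X\<close>,
  since every other point differs from \<open>x\<close> in some coordinate.\<close>

lemma cyl_base:
  assumes "A \<in> Cl" "x \<in> A"
  shows "\<exists>n. cyl n x \<subseteq> A"
proof -
  have x: "x \<in> X" using assms Cl_subset by auto
  let ?U = "\<lambda>n. A \<union> (X - cyl n x)"
  have "X \<subseteq> (\<Union>n. ?U n)"
  proof
    fix y assume y: "y \<in> X"
    show "y \<in> (\<Union>n. ?U n)"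
    proof (cases "y = x")
      case False
      then obtain i where "y \<in> E i \<longleftrightarrow> x \<notin> E i" using E_separates x y by blast
      then have "y \<notin> cyl (Suc i) x" by (auto simp: cyl_def)
      then show ?thesis using y by blast
    qed (use assms in auto)
  qed
  then obtain n where "X \<subseteq> (\<Union>i\<in>{..n}. ?U i)"
    using cover_nat[of ?U] Un[OF assms(1) compl_sets[OF cyl_in]] by auto
  moreover have "cyl n x \<subseteq> cyl i x" if "i \<le> n" for i
    using that by (simp add: cyl_def) force
  moreover have "cyl n x \<subseteq> X" by (auto simp: cyl_def)
  ultimately have "cyl n x \<subseteq> A" by blast
  then show ?thesis by blast
qed

lemma separate_point:
  assumes "x \<in> X" "y \<in> X" "x \<noteq> y"
  shows "\<exists>U\<in>Cl. x \<in> U \<and> y \<notin> U"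
proof -
  obtain i where i: "x \<in> E i \<longleftrightarrow> y \<notin> E i" using E_separates assms by blast
  show ?thesis
  proof (cases "x \<in> E i")
    case True then show ?thesis using i E_in by blast
  next
    case False then show ?thesis using i E_in assms by (intro bexI[of _ "X - E i"]) auto
  qed
qed

lemma separate_finite:
  assumes "x \<in> X" "finite F" "x \<notin> F"
  shows "\<exists>U\<in>Cl. x \<in> U \<and> U \<inter> F = {}"
proof -
  have "\<forall>y\<in>F. \<exists>U\<in>Cl. x \<in> U \<and> y \<notin> U"
  proof
    fix y assume "y \<in> F"
    show "\<exists>U\<in>Cl. x \<in> U \<and> y \<notin> U"
    proof (cases "y \<in> X")
      case True
      with assms \<open>y \<in> F\<close> show ?thesis by (intro separate_point) auto
    next
      case False
      with assms show ?thesis by (intro bexI[of _ X]) auto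
    qed
  qed
  then obtain U where U: "\<And>y. y \<in> F \<Longrightarrow> U y \<in> Cl \<and> x \<in> U y \<and> y \<notin> U y" by metis
  show ?thesis
    by (rule bexI[OF _ INT_in[of F U]]) (use U assms in auto)
qed

subsection \<open>Homeomorphisms and minimality\<close>

text \<open>The equivalence ranges over all sets \<open>U\<close> of the type. Applied to
  \<open>X\<close> and its preimage it forces \<open>f\<close> to preserve \<open>X\<close>, so
  values outside \<open>X\<close> never interfere.\<close>

definition homeo :: "('a \<Rightarrow> 'a) \<Rightarrow> bool" where
  "homeo f \<longleftrightarrow> bij f \<and> (\<forall>U. f ` U \<in> Cl \<longleftrightarrow> U \<in> Cl)"

lemma homeo_bij: "homeo f \<Longrightarrow> bij f"
  and homeo_inj: "homeo f \<Longrightarrow> inj f"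
  and homeo_surj: "homeo f \<Longrightarrow> surj f"
  and homeo_image_iff: "homeo f \<Longrightarrow> f ` U \<in> Cl \<longleftrightarrow> U \<in> Cl"
  by (auto simp: homeo_def bij_def)

lemma homeo_image: "homeo f \<Longrightarrow> U \<in> Cl \<Longrightarrow> f ` U \<in> Cl"
  by (simp add: homeo_def)

lemma homeo_vimage: "homeo f \<Longrightarrow> U \<in> Cl \<Longrightarrow> f -` U \<in> Cl"
  by (metis bij_is_surj homeo_def surj_image_vimage_eq)

lemma homeo_mem: "homeo f \<Longrightarrow> f x \<in> X \<longleftrightarrow> x \<in> X"
proof -
  assume f: "homeo f"
  have "f ` X \<subseteq> X" "f -` X \<subseteq> X"
    using homeo_image[OF f top] homeo_vimage[OF f top] Cl_subset by auto
  then show ?thesis by auto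
qed

lemma homeo_X: "homeo f \<Longrightarrow> f ` X = X"
  using homeo_mem[of f] homeo_surj[of f] by (auto simp: image_iff) (metis surjD)

lemma homeo_inv: "homeo f \<Longrightarrow> homeo (inv f)"
  unfolding homeo_def by (metis bij_betw_imp_surj_on bij_imp_bij_inv image_f_inv_f)

lemma homeo_comp: "homeo f \<Longrightarrow> homeo g \<Longrightarrow> homeo (f \<circ> g)"
  unfolding homeo_def by (metis bij_comp image_comp)

lemma homeo_id: "homeo id"
  by (simp add: homeo_def)

lemma homeo_funpow: "homeo f \<Longrightarrow> homeo (f ^^ n)"
  by (induction n) (auto intro: homeo_comp homeo_id)

lemma homeo_inv_inv: "homeo f \<Longrightarrow> inv (inv f) = f"
  by (simp add: homeo_bij inv_inv_eq)

lemma inv_funpow_funpow: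
  assumes "homeo f" "n \<le> k"
  shows "(inv f ^^ n) ((f ^^ k) x) = (f ^^ (k - n)) x"
proof -
  have "(f ^^ k) x = (f ^^ n) ((f ^^ (k - n)) x)"
    using assms(2) by (metis comp_apply funpow_add le_add_diff_inverse)
  then show ?thesis
    using inv_fn_o_fn_is_id[OF homeo_bij[OF assms(1)], of n] by (metis comp_apply)
qed

lemma inv_funpow_cancel: "homeo f \<Longrightarrow> (inv f ^^ n) ((f ^^ n) x) = x"
  using inv_funpow_funpow[of f n n] by simp

lemma funpow_inv_cancel: "homeo f \<Longrightarrow> (f ^^ n) ((inv f ^^ n) x) = x"
  using inv_funpow_cancel[OF homeo_inv] homeo_inv_inv by metis

lemma inv_app: "homeo f \<Longrightarrow> inv f (f x) = x"
  and app_inv: "homeo f \<Longrightarrow> f (inv f x) = x"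
  by (auto simp: homeo_def bij_def surj_f_inv_f)

lemma funpow_inv_app: "homeo f \<Longrightarrow> (inv f ^^ Suc n) (f x) = (inv f ^^ n) x"
  by (simp add: funpow_swap1 inv_app)

section \<open>Minimality, return times and aperiodicity\<close>

definition minimal :: "('a \<Rightarrow> 'a) \<Rightarrow> bool" where
  "minimal T \<longleftrightarrow> homeo T \<and>
     (\<forall>A\<in>Cl. A \<noteq> {} \<longrightarrow> (\<forall>x\<in>X. \<exists>n. (T ^^ n) x \<in> A \<or> (inv T ^^ n) x \<in> A))"

lemma minimal_homeo: "minimal T \<Longrightarrow> homeo T"
  by (simp add: minimal_def)

lemma minimal_inv: "minimal T \<Longrightarrow> minimal (inv T)"
  unfolding minimal_def using homeo_inv homeo_inv_inv by metis

text \<open>Compactness bounds by \<open>K\<close> the time of some forward or backward visit to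
  \<open>A\<close>. Seen from \<open>(T ^^ (K+1)) x\<close>, each such visit is a forward visit of
  \<open>x\<close> at a time between 1 and \<open>2*K+1\<close>.\<close>

lemma minimal_hit:
  assumes T: "minimal T" and A: "A \<in> Cl" "A \<noteq> {}"
  shows "\<exists>N. \<forall>x\<in>X. \<exists>k. 0 < k \<and> k \<le> N \<and> (T ^^ k) x \<in> A"
proof -
  note h = minimal_homeo[OF T]
  let ?U = "\<lambda>n. (T ^^ n) -` A \<union> (inv T ^^ n) -` A"
  have "X \<subseteq> (\<Union>n. ?U n)"
    using T A unfolding minimal_def by auto
  moreover have "?U n \<in> Cl" for n
    using homeo_vimage homeo_funpow homeo_inv h A by (intro Un) auto
  ultimately obtain K where K: "X \<subseteq> (\<Union>i\<in>{..K}. ?U i)"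
    using cover_nat[of ?U] by blast
  have "\<exists>k. 0 < k \<and> k \<le> 2*K+1 \<and> (T ^^ k) x \<in> A" if x: "x \<in> X" for x
  proof -
    have "(T ^^ (K+1)) x \<in> X"
      using homeo_mem[OF homeo_funpow[OF h]] x by blast
    then obtain n where n: "n \<le> K"
      "(T ^^ n) ((T ^^ (K+1)) x) \<in> A \<or> (inv T ^^ n) ((T ^^ (K+1)) x) \<in> A"
      using K by auto
    from n(2) show ?thesis
    proof
      assume "(T ^^ n) ((T ^^ (K+1)) x) \<in> A"
      then have "(T ^^ (n + (K+1))) x \<in> A" by (simp only: funpow_add comp_apply)
      then show ?thesis using n(1) by (intro exI[of _ "n + (K+1)"]) auto
    next
      assume "(inv T ^^ n) ((T ^^ (K+1)) x) \<in> A"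
      then have "(T ^^ (K+1-n)) x \<in> A" using inv_funpow_funpow[OF h, of n "K+1" x] n(1) by auto
      then show ?thesis using n(1) by (intro exI[of _ "K+1-n"]) auto
    qed
  qed
  then show ?thesis by blast
qed

text \<open>A periodic orbit is finite, so in the infinite space \<open>X\<close> some nonempty
  clopen set would miss it, against minimality.\<close>

lemma aperiodic:
  assumes T: "minimal T" and x: "x \<in> X" and n: "n > 0"
  shows "(T ^^ n) x \<noteq> x"
proof
  assume p: "(T ^^ n) x = x"
  let ?O = "(\<lambda>k. (T ^^ k) x) ` {..<n}"
  obtain y where y: "y \<in> X" "y \<notin> ?O"
    using infinite_X by (metis finite_imageI finite_lessThan finite_subset subsetI)
  obtain U where U: "U \<in> Cl" "y \<in> U" "U \<inter> ?O = {}"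
    using separate_finite[of y ?O] y by auto
  obtain k where "(T ^^ k) x \<in> U"
    using minimal_hit[OF T U(1)] U(2) x by blast
  moreover have "(T ^^ k) x = (T ^^ (k mod n)) x"
    using funpow_mod_eq[OF p, of k] by simp
  ultimately show False using U(3) n by auto
qed

lemma funpow_inject:
  assumes T: "minimal T" and x: "x \<in> X" and eq: "(T ^^ i) x = (T ^^ j) x"
  shows "i = j"
proof -
  have *: False if ij: "i < j" and eq: "(T ^^ i) x = (T ^^ j) x" for i j
  proof -
    have "(T ^^ (j - i)) x = x"
      using inv_funpow_funpow[OF minimal_homeo[OF T], of i j x] ij eq
        inv_funpow_cancel[OF minimal_homeo[OF T], of i x] by simp
    then show False using aperiodic[OF T x, of "j - i"] ij by simp
  qed
  show ?thesis using *[of i j] *[of j i] eq by (metis linorder_neqE_nat)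
qed

subsection \<open>Invariant means\<close>

text \<open>Finitely additive invariant probabilities on \<open>Cl\<close>. By compactness they
  correspond to the invariant Borel probability measures, but all arguments stay inside the algebra.
  Outside \<open>Cl\<close> the values are arbitrary.\<close>

definition means :: "('a \<Rightarrow> 'a) \<Rightarrow> ('a set \<Rightarrow> real) set" where
  "means T = {m. m X = 1 \<and> (\<forall>A\<in>Cl. 0 \<le> m A) \<and>
     (\<forall>A\<in>Cl. \<forall>B\<in>Cl. A \<inter> B = {} \<longrightarrow> m (A \<union> B) = m A + m B) \<and> (\<forall>A\<in>Cl. m (T ` A) = m A)}"

lemma means_X: "m \<in> means T \<Longrightarrow> m X = 1"
  and means_nonneg: "m \<in> means T \<Longrightarrow> A \<in> Cl \<Longrightarrow> 0 \<le> m A"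
  and means_Un: "m \<in> means T \<Longrightarrow> A \<in> Cl \<Longrightarrow> B \<in> Cl \<Longrightarrow> A \<inter> B = {} \<Longrightarrow> m (A \<union> B) = m A + m B"
  and means_T: "m \<in> means T \<Longrightarrow> A \<in> Cl \<Longrightarrow> m (T ` A) = m A"
  by (auto simp: means_def)

lemma means_empty: "m \<in> means T \<Longrightarrow> m {} = 0"
  using means_Un[of m T "{}" "{}"] by auto

lemma means_Diff:
  assumes "m \<in> means T" "A \<in> Cl" "B \<in> Cl" "B \<subseteq> A"
  shows "m (A - B) = m A - m B"
  using means_Un[of m T "A - B" B] assms by (simp add: Un_absorb1 Un_Diff_cancel2 Diff)
    (metis Diff Diff_disjoint Int_commute Un_Diff_cancel2 Un_absorb2 add_diff_cancel)

lemma means_mono: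
  assumes "m \<in> means T" "A \<in> Cl" "B \<in> Cl" "B \<subseteq> A"
  shows "m B \<le> m A"
  using means_Diff[OF assms] means_nonneg[of m T "A - B"] assms by auto

lemma means_Un_le:
  assumes "m \<in> means T" "A \<in> Cl" "B \<in> Cl"
  shows "m (A \<union> B) \<le> m A + m B"
proof -
  have "m (A \<union> B) = m A + m (B - A)"
    using means_Un[of m T A "B - A"] assms by (auto simp: Diff)
  then show ?thesis using means_mono[of m T B "B - A"] assms by (auto simp: Diff)
qed

lemma means_UN_le:
  assumes "m \<in> means T" "finite I" "\<And>i. i \<in> I \<Longrightarrow> A i \<in> Cl"
  shows "m (\<Union>i\<in>I. A i) \<le> (\<Sum>i\<in>I. m (A i))"
  using assms(2,3)
proof (induction I rule: finite_induct)
  case empty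
  then show ?case using means_empty[OF assms(1)] by simp
next
  case (insert i I)
  have "m (\<Union>j\<in>insert i I. A j) \<le> m (A i) + m (\<Union>j\<in>I. A j)"
    using means_Un_le[OF assms(1), of "A i" "\<Union>j\<in>I. A j"] finite_UN[of I A] insert by auto
  with insert show ?case by auto
qed

lemma means_UN:
  assumes "m \<in> means T" "finite I" "\<And>i. i \<in> I \<Longrightarrow> A i \<in> Cl" "disjoint_family_on A I"
  shows "m (\<Union>i\<in>I. A i) = (\<Sum>i\<in>I. m (A i))"
  using assms(2-4)
proof (induction I rule: finite_induct)
  case empty
  then show ?case using means_empty[OF assms(1)] by simp
next
  case (insert i I)
  have "A i \<inter> (\<Union>j\<in>I. A j) = {}"
    using insert.prems(2) insert.hyps by (fastforce simp: disjoint_family_on_def)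
  then have "m (\<Union>j\<in>insert i I. A j) = m (A i) + m (\<Union>j\<in>I. A j)"
    using means_Un[OF assms(1), of "A i" "\<Union>j\<in>I. A j"] finite_UN[of I A] insert by auto
  with insert show ?case by (auto simp: disjoint_family_on_def)
qed

lemma means_funpow: "m \<in> means T \<Longrightarrow> homeo T \<Longrightarrow> A \<in> Cl \<Longrightarrow> m ((T ^^ n) ` A) = m A"
proof (induction n)
  case (Suc n)
  have "(T ^^ Suc n) ` A = T ` ((T ^^ n) ` A)" by (simp add: image_comp)
  then show ?case
    using Suc means_T[of m T "(T ^^ n) ` A"] homeo_image[OF homeo_funpow, of T A n] by simp
qed simp

lemma means_vimage_funpow: "m \<in> means T \<Longrightarrow> homeo T \<Longrightarrow> A \<in> Cl \<Longrightarrow> m ((T ^^ n) -` A) = m A"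
  using means_funpow[of m T "(T ^^ n) -` A" n] homeo_vimage[OF homeo_funpow, of T A n]
    homeo_surj[OF homeo_funpow, of T n] by (simp add: surj_image_vimage_eq)

lemma means_inv:
  assumes "homeo T" shows "means (inv T) = means T"
proof -
  have *: "means T \<subseteq> means (inv T)" if "homeo T" for T
  proof
    fix m assume m: "m \<in> means T"
    have "m (inv T ` A) = m A" if "A \<in> Cl" for A
      using means_T[OF m, of "inv T ` A"] homeo_image[OF homeo_inv[OF \<open>homeo T\<close>] that]
        homeo_surj[OF \<open>homeo T\<close>] by (simp add: image_f_inv_f)
    with m show "m \<in> means (inv T)" by (simp add: means_def)
  qed
  show ?thesis
    using *[OF assms] *[OF homeo_inv[OF assms]] homeo_inv_inv[OF assms] by auto
qed

text \<open>Bounded return times cover \<open>X\<close> by \<open>N\<close> preimages of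
  \<open>A\<close>, each of mass \<open>m A\<close>. It matters that \<open>N\<close> is the same
  for all means.\<close>

lemma means_lower_bound:
  assumes T: "minimal T" and A: "A \<in> Cl" "A \<noteq> {}"
  shows "\<exists>N::nat. \<forall>m\<in>means T. 1 \<le> real N * m A"
proof -
  note h = minimal_homeo[OF T]
  obtain N where N: "\<forall>x\<in>X. \<exists>k. 0 < k \<and> k \<le> N \<and> (T ^^ k) x \<in> A"
    using minimal_hit[OF T A] by blast
  have "1 \<le> real N * m A" if m: "m \<in> means T" for m
  proof -
    have in_Cl: "(T ^^ k) -` A \<in> Cl" for k using homeo_vimage[OF homeo_funpow[OF h] A(1)] .
    have "X \<subseteq> (\<Union>k\<in>{1..N}. (T ^^ k) -` A)" using N by fastforce
    then have "m X \<le> m (\<Union>k\<in>{1..N}. (T ^^ k) -` A)"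
      using means_mono[OF m finite_UN[OF _ in_Cl] top, of "{1..N}" "\<lambda>k. k"] by simp
    also have "\<dots> \<le> (\<Sum>k\<in>{1..N}. m ((T ^^ k) -` A))"
      by (rule means_UN_le[OF m]) (auto simp: in_Cl)
    also have "\<dots> = real N * m A" using means_vimage_funpow[OF m h A(1)] by simp
    finally show ?thesis using means_X[OF m] by simp
  qed
  then show ?thesis by blast
qed

lemma means_pos:
  assumes "minimal T" "A \<in> Cl" "A \<noteq> {}" "m \<in> means T"
  shows "0 < m A"
  using means_lower_bound[OF assms(1-3)] assms(4) means_nonneg[OF assms(4,2)]
  by (metis less_eq_real_def linorder_not_less mult_zero_right zero_less_one)

lemma small_neighbourhood:
  assumes T: "minimal T" and x: "x \<in> B" and B: "B \<in> Cl"
  shows "\<exists>U\<in>Cl. x \<in> U \<and> U \<subseteq> B \<and> (\<forall>m\<in>means T. real N * m U \<le> 1)"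
proof -
  note h = minimal_homeo[OF T]
  have xX: "x \<in> X" using x B Cl_subset by auto
  have "\<exists>W\<in>Cl. x \<in> W \<and> W \<inter> (T ^^ k) ` W = {}" if k: "k > 0" for k
  proof -
    obtain V where V: "V \<in> Cl" "x \<in> V" "(T ^^ k) x \<notin> V"
      using separate_point[of x "(T ^^ k) x"] xX homeo_mem[OF homeo_funpow[OF h]]
        aperiodic[OF T xX k] by metis
    show ?thesis
      by (rule bexI[of _ "V - (T ^^ k) -` V"])
         (use V homeo_vimage[OF homeo_funpow[OF h] V(1)] in auto)
  qed
  then obtain W where W: "\<And>k. k > 0 \<Longrightarrow> W k \<in> Cl \<and> x \<in> W k \<and> W k \<inter> (T ^^ k) ` W k = {}"
    by metis
  let ?U = "B \<inter> (X \<inter> (\<Inter>k\<in>{1..N}. W k))"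
  have U: "?U \<in> Cl" using INT_in[of "{1..N}" W] W B by auto
  have "real N * m ?U \<le> 1" if m: "m \<in> means T" for m
  proof -
    have *: "(T ^^ i) ` ?U \<inter> (T ^^ j) ` ?U = {}" if "i < j" "j < N" for i j
    proof -
      have "j - i \<in> {1..N}" using that by auto
      then have "?U \<subseteq> W (j-i)" by blast
      then have "(T ^^ i) ` ?U \<inter> (T ^^ j) ` ?U \<subseteq> (T ^^ i) ` (W (j-i)) \<inter> (T ^^ j) ` (W (j-i))"
        by (intro Int_mono image_mono)
      also have "(T ^^ j) ` (W (j-i)) = (T ^^ i) ` ((T ^^ (j-i)) ` W (j-i))"
        using that by (simp add: image_comp flip: funpow_add)
      also have "(T ^^ i) ` (W (j-i)) \<inter> \<dots> = (T ^^ i) ` (W (j-i) \<inter> (T ^^ (j-i)) ` W (j-i))"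
        using homeo_inj[OF homeo_funpow[OF h]] by (simp add: image_Int)
      finally show ?thesis using W[of "j-i"] that by auto
    qed
    then have "disjoint_family_on (\<lambda>i. (T ^^ i) ` ?U) {..<N}"
      unfolding disjoint_family_on_def by (metis Int_commute lessThan_iff linorder_neqE_nat)
    moreover have in_Cl: "(\<Union>i\<in>{..<N}. (T ^^ i) ` ?U) \<in> Cl"
      by (rule finite_UN) (simp_all only: finite_lessThan homeo_image[OF homeo_funpow[OF h] U])
    ultimately have "m (\<Union>i\<in>{..<N}. (T ^^ i) ` ?U) = (\<Sum>i\<in>{..<N}. m ((T ^^ i) ` ?U))"
      by (intro means_UN[OF m] homeo_image[OF homeo_funpow[OF h] U]) simp
    also have "\<dots> = real N * m ?U" using means_funpow[OF m h U] by simp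
    finally show ?thesis
      using means_mono[OF m top in_Cl Cl_subset[OF in_Cl]] means_X[OF m] by simp
  qed
  then show ?thesis using U W x xX by (intro bexI[of _ ?U]) auto
qed

lemma smaller_neighbourhood:
  assumes T: "minimal T" and A: "A \<in> Cl" "A \<noteq> {}" and B: "x \<in> B" "B \<in> Cl"
  shows "\<exists>U\<in>Cl. x \<in> U \<and> U \<subseteq> B \<and> (\<forall>m\<in>means T. m U < m A)"
proof -
  obtain N :: nat where N: "\<forall>m\<in>means T. 1 \<le> real N * m A"
    using means_lower_bound[OF T A] by blast
  \<comment> \<open>Taking \<open>Suc N\<close> instead of \<open>N\<close> makes the final
    inequality strict, because \<open>m U\<close> is positive by minimality.\<close>
  obtain U where U: "U \<in> Cl" "x \<in> U" "U \<subseteq> B" "\<forall>m\<in>means T. real (Suc N) * m U \<le> 1"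
    using small_neighbourhood[OF T B] by blast
  have "m U < m A" if m: "m \<in> means T" for m
  proof (rule ccontr)
    assume "\<not> m U < m A"
    then have "real N * m A \<le> real N * m U" by (intro mult_left_mono) auto
    moreover have "real (Suc N) * m U \<le> 1" using U(4) m by blast
    moreover have "0 < m U" using means_pos[OF T U(1) _ m] U(2) by blast
    moreover have "1 \<le> real N * m A" using N m by blast
    ultimately show False by (simp add: algebra_simps)
  qed
  then show ?thesis using U by blast
qed

text \<open>The Krylov-Bogoliubov argument: \<open>fr n\<close> records visit frequencies along an
  orbit segment of length \<open>n + 1\<close>, a shift by \<open>T\<close> changes them by at most
  \<open>1 / (n + 1)\<close>, and Tychonoff supplies a cluster point. Inequalities that hold for
  every segment survive, and this is the form in which the mean is used.\<close>

lemma cluster_mean: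
  assumes T: "homeo T" and x: "\<And>n. x n \<in> X"
  defines "fr \<equiv> \<lambda>n A. (\<Sum>j<Suc n. of_bool ((T ^^ j) (x n) \<in> A)) / real (Suc n)"
  shows "\<exists>m\<in>means T. \<forall>A\<in>Cl. \<forall>B\<in>Cl. (\<forall>n. fr n B \<le> fr n A) \<longrightarrow> m B \<le> m A"
proof -
  define F where "F = filtermap fr sequentially"
  define K :: "('a set \<Rightarrow> real) set" where "K = (\<Pi>\<^sub>E i\<in>UNIV. {0..1})"
  have "compactin (product_topology (\<lambda>_. euclidean) UNIV) K"
    unfolding K_def by (rule compactin_PiE[THEN iffD2]) auto
  then have "compact K"
    by (simp add: euclidean_product_topology compactin_euclidean_iff)
  moreover have "F \<noteq> bot"
    by (simp add: F_def filtermap_bot_iff)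
  moreover have "eventually (\<lambda>f. f \<in> K) F"
  proof -
    have "0 \<le> fr n A \<and> fr n A \<le> 1" for n A
    proof -
      have "(\<Sum>j<Suc n. of_bool ((T ^^ j) (x n) \<in> A) :: real) \<le> (\<Sum>j<Suc n. 1)"
        by (rule sum_mono) auto
      moreover have "0 \<le> (\<Sum>j<Suc n. of_bool ((T ^^ j) (x n) \<in> A) :: real)"
        by (rule sum_nonneg) auto
      ultimately show ?thesis by (simp add: fr_def divide_simps del: sum.lessThan_Suc)
    qed
    then show ?thesis by (auto simp: F_def eventually_filtermap K_def PiE_def extensional_def)
  qed
  ultimately obtain m where m: "inf (nhds m) F \<noteq> bot"
    unfolding compact_filter by blast
  \<comment> \<open>Along \<open>G\<close> the frequencies converge to \<open>m\<close> at every
    set, and whatever holds for all large \<open>n\<close> holds eventually; this plays the part of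
    a convergent subsequence.\<close>
  define G where "G = inf (nhds m) F"
  have G: "G \<noteq> bot" "G \<le> F" using m by (auto simp: G_def)
  have ev: "eventually P G" if "\<And>n. P (fr n)" for P
    using filter_leD[OF G(2), of P] that by (simp add: F_def eventually_filtermap)
  have ev_seq: "eventually P G" if "eventually (\<lambda>n. P (fr n)) sequentially" for P
    using filter_leD[OF G(2), of P] that by (simp add: F_def eventually_filtermap)
  have lim: "((\<lambda>f. f A) \<longlongrightarrow> m A) G" for A
  proof (rule continuous_on_tendsto_compose[where s = UNIV and f = "\<lambda>f. f A" and g = "\<lambda>f. f"])
    show "continuous_on UNIV (\<lambda>f::'a set \<Rightarrow> real. f A)"
      by (rule continuous_on_product_coordinates)
    show "((\<lambda>f. f) \<longlongrightarrow> m) G"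
      by (simp add: filterlim_def G_def filtermap_ident)
  qed auto
  have le: "m B \<le> m A" if "\<And>n. fr n B \<le> fr n A" for A B
    using tendsto_le[OF G(1) lim lim ev, of B A] that by simp
  have unit: "m X = 1"
  proof -
    have "fr n X = 1" for n
      using homeo_mem[OF homeo_funpow[OF T]] x by (simp add: fr_def del: sum.lessThan_Suc)
    then have "((\<lambda>f. f X) \<longlongrightarrow> 1) G"
      by (intro tendsto_eventually ev)
    then show ?thesis using tendsto_unique[OF G(1) lim] by blast
  qed
  have nonneg: "0 \<le> m A" for A
  proof (rule tendsto_le[OF G(1) lim tendsto_const])
    show "eventually (\<lambda>f. 0 \<le> f A) G"
      by (rule ev) (auto simp: fr_def intro!: divide_nonneg_nonneg sum_nonneg simp del: sum.lessThan_Suc)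
  qed
  have additive: "m (A \<union> B) = m A + m B" if "A \<inter> B = {}" for A B
  proof -
    have *: "of_bool (z \<in> A \<union> B) = (of_bool (z \<in> A) + of_bool (z \<in> B) :: real)" for z
      using that by auto
    have "fr n (A \<union> B) = fr n A + fr n B" for n
      by (simp only: fr_def * sum.distrib add_divide_distrib)
    then have "((\<lambda>f. f (A \<union> B) - (f A + f B)) \<longlongrightarrow> 0) G"
      by (intro tendsto_eventually ev) auto
    moreover have "((\<lambda>f. f (A \<union> B) - (f A + f B)) \<longlongrightarrow> m (A \<union> B) - (m A + m B)) G"
      by (intro tendsto_intros lim)
    ultimately show ?thesis using tendsto_unique[OF G(1)] by fastforce
  qed
  have invariant: "m (T ` A) = m A" for A
  proof -
    have shift: "(T ^^ Suc j) z \<in> T ` A \<longleftrightarrow> (T ^^ j) z \<in> A" for j z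
      using homeo_inj[OF T] by (auto simp: inj_image_mem_iff)
    have diff: "fr n (T ` A) - fr n A = (of_bool (x n \<in> T ` A) - of_bool ((T ^^ n) (x n) \<in> A)) / real (Suc n)" for n
    proof -
      have image: "(\<Sum>j<Suc n. of_bool ((T ^^ j) (x n) \<in> T ` A)) =
          of_bool (x n \<in> T ` A) + (\<Sum>j<n. of_bool ((T ^^ j) (x n) \<in> A) :: real)"
        by (subst sum.lessThan_Suc_shift) (simp only: shift, simp)
      show ?thesis
        unfolding fr_def image by (simp only: sum.lessThan_Suc diff_divide_distrib[symmetric]) simp
    qed
    have bound: "\<bar>fr n (T ` A) - fr n A\<bar> \<le> 1 / real (Suc n)" for n
      unfolding diff by (auto simp: of_bool_def)
    have "\<bar>m (T ` A) - m A\<bar> \<le> e" if e: "e > 0" for e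
    proof (rule tendsto_le[OF G(1) tendsto_const])
      show "((\<lambda>f. \<bar>f (T ` A) - f A\<bar>) \<longlongrightarrow> \<bar>m (T ` A) - m A\<bar>) G"
        by (intro tendsto_intros lim)
      have "eventually (\<lambda>n. 1 / real (Suc n) < e) sequentially"
        using LIMSEQ_inverse_real_of_nat[THEN order_tendstoD(2), OF e]
        by (simp add: inverse_eq_divide)
      then show "eventually (\<lambda>f. \<bar>f (T ` A) - f A\<bar> \<le> e) G"
        by (intro ev_seq) (auto elim!: eventually_mono intro: order_trans[OF bound])
    qed
    then have "\<bar>m (T ` A) - m A\<bar> \<le> 0" by (metis field_le_epsilon add_0)
    then show ?thesis by simp
  qed
  have "m \<in> means T" using unit nonneg additive invariant by (simp add: means_def)
  then show ?thesis using le by blast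
qed

subsection \<open>Comparison of clopen sets\<close>

text \<open>\<open>T\<close> enters only through its means. Unlike being given by positive powers of
  \<open>T\<close>, this property is stable under inverses and under conjugation by mean-preserving
  homeomorphisms, as the tower constructions require.\<close>

definition iso_on :: "('a \<Rightarrow> 'a) \<Rightarrow> 'a set \<Rightarrow> 'a set \<Rightarrow> ('a \<Rightarrow> 'a) \<Rightarrow> bool" where
  "iso_on T A B f \<longleftrightarrow> A \<in> Cl \<and> B \<in> Cl \<and> bij_betw f A B \<and> (\<forall>U\<subseteq>A. f ` U \<in> Cl \<longleftrightarrow> U \<in> Cl) \<and>
     (\<forall>m\<in>means T. \<forall>U\<in>Cl. U \<subseteq> A \<longrightarrow> m (f ` U) = m U)"

lemma iso_onD:
  assumes "iso_on T A B f"
  shows "A \<in> Cl" "B \<in> Cl" "bij_betw f A B" "inj_on f A" "f ` A = B"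
    "\<And>U. U \<subseteq> A \<Longrightarrow> f ` U \<in> Cl \<longleftrightarrow> U \<in> Cl"
    "\<And>m U. m \<in> means T \<Longrightarrow> U \<in> Cl \<Longrightarrow> U \<subseteq> A \<Longrightarrow> m (f ` U) = m U"
  using assms by (auto simp: iso_on_def bij_betw_def)

lemma iso_on_id: "A \<in> Cl \<Longrightarrow> iso_on T A A (\<lambda>x. x)"
  by (auto simp: iso_on_def bij_betw_def)

lemma iso_on_cong:
  assumes "\<And>x. x \<in> A \<Longrightarrow> f x = g x"
  shows "iso_on T A B f \<longleftrightarrow> iso_on T A B g"
proof -
  have "f ` U = g ` U" if "U \<subseteq> A" for U
    by (rule image_cong) (use assms that in auto)
  then show ?thesis
    unfolding iso_on_def using bij_betw_cong[of A f g B] assms by simp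
qed

lemma iso_on_comp:
  assumes f: "iso_on T A B f" and g: "iso_on T B C g"
  shows "iso_on T A C (\<lambda>x. g (f x))"
proof -
  have im: "(\<lambda>x. g (f x)) ` U = g ` (f ` U)" for U by auto
  have sub: "U \<subseteq> A \<Longrightarrow> f ` U \<subseteq> B" for U using iso_onD(5)[OF f] by auto
  have "bij_betw (\<lambda>x. g (f x)) A C"
    using bij_betw_trans[OF iso_onD(3)[OF f] iso_onD(3)[OF g]] by (simp add: comp_def)
  moreover have "g ` f ` U \<in> Cl \<longleftrightarrow> U \<in> Cl" if "U \<subseteq> A" for U
    using iso_onD(6)[OF f that] iso_onD(6)[OF g sub[OF that]] by simp
  moreover have "m (g ` f ` U) = m U" if "m \<in> means T" "U \<in> Cl" "U \<subseteq> A" for m U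
    using iso_onD(7)[OF f that] iso_onD(7)[OF g that(1) _ sub[OF that(3)]]
      iso_onD(6)[OF f that(3)] that(2) by simp
  ultimately show ?thesis
    unfolding iso_on_def im using iso_onD(1)[OF f] iso_onD(2)[OF g] by simp
qed

lemma iso_on_inv:
  assumes f: "iso_on T A B f"
  shows "iso_on T B A (inv_into A f)"
proof -
  have cancel: "f ` (inv_into A f ` U) = U" and sub: "inv_into A f ` U \<subseteq> A" if "U \<subseteq> B" for U
    using that iso_onD(5)[OF f] by (auto simp: image_inv_into_cancel intro!: inv_into_into)
  have "inv_into A f ` U \<in> Cl \<longleftrightarrow> U \<in> Cl" if "U \<subseteq> B" for U
    using iso_onD(6)[OF f sub[OF that]] cancel[OF that] by simp
  moreover have "m (inv_into A f ` U) = m U" if "m \<in> means T" "U \<in> Cl" "U \<subseteq> B" for m U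
    using iso_onD(7)[OF f that(1) _ sub[OF that(3)]] calculation[OF that(3)] that(2) cancel[OF that(3)]
    by simp
  ultimately show ?thesis
    unfolding iso_on_def using iso_onD(1,2)[OF f] bij_betw_inv_into[OF iso_onD(3)[OF f]] by simp
qed

lemma iso_on_restrict:
  assumes f: "iso_on T A B f" and U: "U \<in> Cl" "U \<subseteq> A"
  shows "iso_on T U (f ` U) f"
proof -
  have "bij_betw f U (f ` U)" using iso_onD(3)[OF f] U(2) by (meson bij_betw_subset order_refl)
  moreover have "f ` U \<in> Cl" using iso_onD(6)[OF f U(2)] U(1) by simp
  ultimately show ?thesis
    unfolding iso_on_def using iso_onD(6,7)[OF f] U subset_trans[OF _ U(2)] by simp
qed

text \<open>Since \<open>f\<close> is a single function, disjoint targets force disjoint sources and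
  injectivity on the union; clopenness and means are then checked piece by piece.\<close>

lemma iso_on_UN:
  assumes K: "finite K" and iso: "\<And>k. k \<in> K \<Longrightarrow> iso_on T (A k) (B k) f"
    and disj: "disjoint_family_on B K"
  shows "iso_on T (\<Union>k\<in>K. A k) (\<Union>k\<in>K. B k) f"
proof -
  have bij: "bij_betw f (\<Union>k\<in>K. A k) (\<Union>k\<in>K. B k)"
    by (rule bij_betw_UNION_disjoint[OF disj]) (use iso iso_onD(3) in blast)
  have A: "A k \<in> Cl" and B: "B k \<in> Cl" if "k \<in> K" for k
    using iso_onD[OF iso[OF that]] by auto
  have pieces: "f ` U = (\<Union>k\<in>K. f ` (U \<inter> A k))" "U = (\<Union>k\<in>K. U \<inter> A k)"
    if "U \<subseteq> (\<Union>k\<in>K. A k)" for U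
  proof -
    show U: "U = (\<Union>k\<in>K. U \<inter> A k)" using that by auto
    show "f ` U = (\<Union>k\<in>K. f ` (U \<inter> A k))" using arg_cong[OF U, of "image f"] by (simp only: image_UN)
  qed
  have image_piece: "f ` (U \<inter> A k) = f ` U \<inter> B k" if "U \<subseteq> (\<Union>k\<in>K. A k)" "k \<in> K" for U k
  proof -
    have "f ` (U \<inter> A k) = f ` U \<inter> f ` A k"
      by (rule inj_on_image_Int[OF bij_betw_imp_inj_on[OF bij]]) (use that in auto)
    then show ?thesis using iso_onD(5)[OF iso[OF that(2)]] by simp
  qed
  have Cl_iff: "f ` U \<in> Cl \<longleftrightarrow> U \<in> Cl" if U: "U \<subseteq> (\<Union>k\<in>K. A k)" for U
  proof
    assume "U \<in> Cl"
    have "f ` (U \<inter> A k) \<in> Cl" if "k \<in> K" for k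
      using iso_onD(6)[OF iso[OF that], of "U \<inter> A k"] Int[OF \<open>U \<in> Cl\<close> A[OF that]] by simp
    then show "f ` U \<in> Cl" using pieces(1)[OF U] finite_UN[OF K] by metis
  next
    assume "f ` U \<in> Cl"
    have "U \<inter> A k \<in> Cl" if "k \<in> K" for k
      using iso_onD(6)[OF iso[OF that], of "U \<inter> A k"] image_piece[OF U that]
        Int[OF \<open>f ` U \<in> Cl\<close> B[OF that]] by simp
    then show "U \<in> Cl" using pieces(2)[OF U] finite_UN[OF K] by metis
  qed
  have "m (f ` U) = m U" if m: "m \<in> means T" and U: "U \<in> Cl" "U \<subseteq> (\<Union>k\<in>K. A k)" for m U
  proof -
    have disjA: "disjoint_family_on (\<lambda>k. U \<inter> A k) K"
      using disj iso_onD(5)[OF iso] unfolding disjoint_family_on_def by fast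
    have disjB: "disjoint_family_on (\<lambda>k. f ` (U \<inter> A k)) K"
      using disj iso_onD(5)[OF iso] unfolding disjoint_family_on_def by fast
    have UA: "U \<inter> A k \<in> Cl" if "k \<in> K" for k using Int[OF U(1) A[OF that]] .
    have "m (f ` U) = (\<Sum>k\<in>K. m (f ` (U \<inter> A k)))"
      unfolding pieces(1)[OF U(2)]
      by (rule means_UN[OF m K _ disjB]) (use iso_onD(6)[OF iso] UA in auto)
    also have "\<dots> = (\<Sum>k\<in>K. m (U \<inter> A k))"
      by (rule sum.cong) (use iso_onD(7)[OF iso m] UA in auto)
    also have "\<dots> = m (\<Union>k\<in>K. U \<inter> A k)"
      by (rule means_UN[OF m K _ disjA, symmetric]) (use UA in auto)
    finally show ?thesis using pieces(2)[OF U(2)] by simp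
  qed
  moreover have "(\<Union>k\<in>K. A k) \<in> Cl" "(\<Union>k\<in>K. B k) \<in> Cl"
    using finite_UN[OF K, of A] finite_UN[OF K, of B] A B by simp_all
  ultimately show ?thesis
    unfolding iso_on_def using bij Cl_iff by simp
qed

lemma iso_on_Un:
  assumes "iso_on T A B f" "iso_on T A' B' f" "B \<inter> B' = {}"
  shows "iso_on T (A \<union> A') (B \<union> B') f"
proof -
  have "iso_on T (\<Union>k\<in>(UNIV::bool set). if k then A else A') (\<Union>k\<in>UNIV. if k then B else B') f"
    by (rule iso_on_UN) (use assms in \<open>auto simp: disjoint_family_on_def\<close>)
  then show ?thesis by (simp add: UNIV_bool Un_commute)
qed

lemma iso_on_funpow:
  assumes "homeo T" "A \<in> Cl"
  shows "iso_on T A ((T ^^ n) ` A) (T ^^ n)"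
proof -
  have "inj_on (T ^^ n) A"
    using inj_on_subset[OF homeo_inj[OF homeo_funpow[OF assms(1)]]] by simp
  then show ?thesis
    using assms homeo_image_iff[OF homeo_funpow[OF assms(1)]] means_funpow
    unfolding iso_on_def by (simp add: inj_on_imp_bij_betw)
qed

section \<open>Isomorphisms given by positive powers\<close>

definition fwd_iso :: "('a \<Rightarrow> 'a) \<Rightarrow> 'a set \<Rightarrow> 'a set \<Rightarrow> ('a \<Rightarrow> 'a) \<Rightarrow> bool" where
  "fwd_iso T A B f \<longleftrightarrow> iso_on T A B f \<and> (\<forall>x\<in>A. \<exists>p>0. f x = (T ^^ p) x)"

text \<open>Positivity of exponents is not symmetric, yet a back-and-forth remains possible: the
  backward half embeds by positive powers of \<open>inv T\<close> and is then inverted.\<close>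

lemma fwd_iso_inv:
  assumes T: "homeo T" and f: "fwd_iso (inv T) A B f"
  shows "fwd_iso T B A (inv_into A f)"
proof -
  have iso: "iso_on T A B f"
    using f means_inv[OF T] by (simp add: fwd_iso_def iso_on_def)
  have "\<exists>p>0. inv_into A f y = (T ^^ p) y" if y: "y \<in> B" for y
  proof -
    let ?x = "inv_into A f y"
    have x: "?x \<in> A" "f ?x = y"
      using y iso_onD(5)[OF iso] by (auto simp: inv_into_into f_inv_into_f)
    then obtain p where "p > 0" "y = (inv T ^^ p) ?x"
      using f unfolding fwd_iso_def by metis
    then show ?thesis using funpow_inv_cancel[OF T] by metis
  qed
  then show ?thesis using iso_on_inv[OF iso] by (simp add: fwd_iso_def)
qed

text \<open>The embedding sends each visit to \<open>A\<close> to the visit to \<open>B\<close> that closes it, visits to \<open>A\<close>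
  being read as opening and visits to \<open>B\<close> as closing brackets along an orbit.\<close>

lemma comparison:
  assumes T: "minimal T" and A: "A \<in> Cl" and B: "B \<in> Cl"
    and less: "\<And>m. m \<in> means T \<Longrightarrow> m A < m B"
  shows "\<exists>f C. C \<subseteq> B \<and> fwd_iso T A C f"
proof -
  note h = minimal_homeo[OF T]
  \<comment> \<open>Visits to \<open>B\<close> at times 1 to \<open>k\<close> minus visits to
    \<open>A\<close> at times 0 to \<open>k - 1\<close>. The shift lets a point open its bracket at
    time 0 and close it at time 1 at the earliest, so exponents are positive.\<close>
  define s :: "nat \<Rightarrow> 'a \<Rightarrow> int" where
    "s k x = (\<Sum>j<k. of_bool ((T ^^ Suc j) x \<in> B) - of_bool ((T ^^ j) x \<in> A))" for k x
  have s_0: "s 0 x = 0" and s_Suc: "s (Suc k) x = s k x + of_bool ((T ^^ Suc k) x \<in> B) - of_bool ((T ^^ k) x \<in> A)" for k x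
    by (simp_all add: s_def)
  have s_add: "s (k + l) x = s k x + s l ((T ^^ k) x)" for k l x
  proof (induction l)
    case (Suc l)
    have "(T ^^ l) ((T ^^ k) x) = (T ^^ (k + l)) x" "(T ^^ Suc l) ((T ^^ k) x) = (T ^^ Suc (k + l)) x"
      by (simp_all only: add.commute[of k l] add_Suc[symmetric] funpow_add comp_apply)
    then show ?case using Suc by (simp only: add_Suc_right s_Suc)
  qed (simp add: s_0)
  \<comment> \<open>Without a uniform bound there are points \<open>x n\<close> whose balance stays
    negative up to time \<open>n + 1\<close>. Along these segments \<open>A\<close> is visited more
    often than \<open>B\<close>, and a cluster mean contradicts \<open>less\<close>.\<close>
  have "\<exists>N. \<forall>x\<in>X. \<exists>k>0. k \<le> N \<and> s k x \<ge> 0"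
  proof (rule ccontr)
    assume "\<not> ?thesis"
    then have "\<forall>n. \<exists>x\<in>X. \<forall>k>0. k \<le> Suc n \<longrightarrow> s k x < 0" by (meson linorder_not_le)
    then obtain x where x: "\<And>n. x n \<in> X" "\<And>n k. k > 0 \<Longrightarrow> k \<le> Suc n \<Longrightarrow> s k (x n) < 0"
      by metis
    obtain m where m: "m \<in> means T" and le: "\<And>A B. A \<in> Cl \<Longrightarrow> B \<in> Cl \<Longrightarrow>
        (\<And>n. (\<Sum>j<Suc n. of_bool ((T ^^ j) (x n) \<in> B)) / real (Suc n) \<le>
          (\<Sum>j<Suc n. of_bool ((T ^^ j) (x n) \<in> A)) / real (Suc n)) \<Longrightarrow> m B \<le> m A"
      using cluster_mean[of T x, OF h x(1)] by metis
    have "m ((T ^^ 1) -` B) \<le> m A"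
    proof (rule le[OF A homeo_vimage[OF homeo_funpow[OF h] B]])
      fix n
      have "s (Suc n) (x n) < 0" using x(2)[of "Suc n" n] by simp
      then have "(\<Sum>j<Suc n. of_bool ((T ^^ Suc j) (x n) \<in> B)) < (\<Sum>j<Suc n. of_bool ((T ^^ j) (x n) \<in> A) :: int)"
        by (simp only: s_def sum_subtractf)
      then have "real_of_int (\<Sum>j<Suc n. of_bool ((T ^^ Suc j) (x n) \<in> B)) \<le> real_of_int (\<Sum>j<Suc n. of_bool ((T ^^ j) (x n) \<in> A))"
        by linarith
      then have "(\<Sum>j<Suc n. of_bool ((T ^^ j) (x n) \<in> (T ^^ 1) -` B)) \<le> (\<Sum>j<Suc n. of_bool ((T ^^ j) (x n) \<in> A) :: real)"
        by (simp del: sum.lessThan_Suc)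
      then show "(\<Sum>j<Suc n. of_bool ((T ^^ j) (x n) \<in> (T ^^ 1) -` B)) / real (Suc n) \<le>
          (\<Sum>j<Suc n. of_bool ((T ^^ j) (x n) \<in> A)) / real (Suc n)"
        by (intro divide_right_mono) auto
    qed
    then have "m B \<le> m A" using means_vimage_funpow[OF m h B, of 1] by simp
    then show False using less[OF m] by simp
  qed
  then obtain N where N: "\<And>x. x \<in> X \<Longrightarrow> \<exists>k>0. k \<le> N \<and> s k x \<ge> 0" by blast
  define p where "p x = (LEAST k. k > 0 \<and> s k x \<ge> 0)" for x
  have p: "p x > 0" "s (p x) x \<ge> 0" "p x \<le> N" if x: "x \<in> X" for x
  proof -
    obtain k where k: "k > 0" "k \<le> N" "s k x \<ge> 0" using N[OF x] by blast
    have "p x > 0 \<and> s (p x) x \<ge> 0" unfolding p_def by (rule LeastI[of _ k]) (use k in auto)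
    moreover have "p x \<le> k" unfolding p_def by (rule Least_le) (use k in auto)
    ultimately show "p x > 0" "s (p x) x \<ge> 0" "p x \<le> N" using k by auto
  qed
  have before_p: "s k x < 0" if "0 < k" "k < p x" for k x
    using not_less_Least[of k "\<lambda>k. k > 0 \<and> s k x \<ge> 0"] that by (auto simp: p_def)
  have hit: "s (p x) x = 0" "(T ^^ p x) x \<in> B" if x: "x \<in> A" for x
  proof -
    have xX: "x \<in> X" using x A Cl_subset by auto
    obtain q where q: "p x = Suc q" using p(1)[OF xX] by (metis gr0_implies_Suc)
    \<comment> \<open>Just before \<open>p x\<close> the balance is negative, or it is 0 at time 0
      with a bracket opening there. So the last step can at most bring it back to exactly 0, and
      only through a visit to \<open>B\<close>.\<close>
    have "s q x \<le> of_bool ((T ^^ q) x \<in> A) - 1"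
    proof (cases "q = 0")
      case True then show ?thesis using x by (simp add: s_0)
    next
      case False
      then have "s q x < 0" using before_p[of q x] q by simp
      then show ?thesis by simp
    qed
    then have "s (p x) x = 0 \<and> (T ^^ p x) x \<in> B"
      using p(2)[OF xX] unfolding q s_Suc by (auto simp: of_bool_def split: if_splits)
    then show "s (p x) x = 0" "(T ^^ p x) x \<in> B" by auto
  qed
  define f where "f x = (T ^^ p x) x" for x
  have inj: "inj_on f A"
  proof -
    \<comment> \<open>Two openings cannot share a closing: \<open>y\<close> would lie on the orbit
      of \<open>x\<close> at time \<open>?d\<close>, where the balance of \<open>x\<close> is still
      negative, while additivity of \<open>s\<close> makes it 0.\<close>
    have False if x: "x \<in> A" and y: "y \<in> A" and eq: "f x = f y" and less: "p y < p x" for x y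
    proof -
      let ?d = "p x - p y"
      have "(T ^^ p y) ((T ^^ ?d) x) = (T ^^ p y) y"
        using eq less unfolding f_def
        by (metis comp_apply funpow_add le_add_diff_inverse less_imp_le_nat)
      then have y_eq: "(T ^^ ?d) x = y" using homeo_inj[OF homeo_funpow[OF h]] by (simp add: inj_eq)
      have "s (p x) x = s ?d x + s (p y) y"
        using s_add[of ?d "p y" x] less y_eq by simp
      moreover have "s ?d x < 0"
        using before_p[of ?d x] less p(1)[of y] subsetD[OF Cl_subset[OF A] y] by simp
      ultimately show False using hit(1)[OF x] hit(1)[OF y] by simp
    qed
    moreover have "x = y" if "f x = f y" "p x = p y" for x y
      using that homeo_inj[OF homeo_funpow[OF h]] by (simp add: f_def inj_eq)
    ultimately show ?thesis unfolding inj_on_def by (metis linorder_neqE_nat)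
  qed
  have orbit_in: "{x\<in>X. (T ^^ j) x \<in> C \<longleftrightarrow> P} \<in> Cl" if "C \<in> Cl" for j C P
    using Collect_iff_in[OF homeo_vimage[OF homeo_funpow[OF h] that]] by simp
  \<comment> \<open>The itinerary through \<open>A\<close> and \<open>B\<close> up to time
    \<open>N\<close> determines all balances up to \<open>N\<close> and hence \<open>p\<close>; so
    \<open>p\<close> has clopen level sets, and on each of them \<open>f\<close> is one power of
    \<open>T\<close>.\<close>
  define nb where "nb x = X \<inter> (\<Inter>j\<in>{..N}. {y\<in>X. (T ^^ j) y \<in> A \<longleftrightarrow> (T ^^ j) x \<in> A} \<inter> {y\<in>X. (T ^^ j) y \<in> B \<longleftrightarrow> (T ^^ j) x \<in> B})" for x
  have nb: "nb x \<in> Cl" for x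
    unfolding nb_def by (rule INT_in) (use orbit_in A B in auto)
  have p_nb: "p y = p x" if x: "x \<in> X" and y: "y \<in> nb x" for x y
  proof -
    have nbD: "(T ^^ j) y \<in> A \<longleftrightarrow> (T ^^ j) x \<in> A" "(T ^^ j) y \<in> B \<longleftrightarrow> (T ^^ j) x \<in> B" if "j \<le> N" for j
      using y that unfolding nb_def by simp_all
    have s_eq: "s k y = s k x" if "k \<le> N" for k
      unfolding s_def
    proof (rule sum.cong[OF refl])
      fix j assume "j \<in> {..<k}"
      then have "j \<le> N" "Suc j \<le> N" using that by auto
      then show "of_bool ((T ^^ Suc j) y \<in> B) - of_bool ((T ^^ j) y \<in> A) = of_bool ((T ^^ Suc j) x \<in> B) - (of_bool ((T ^^ j) x \<in> A) :: int)"
        by (simp only: nbD)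
    qed
    have yX: "y \<in> X" using y by (auto simp: nb_def)
    have "p y \<le> p x"
      unfolding p_def[of y] by (rule Least_le) (use p[OF x] s_eq in auto)
    moreover have "p x \<le> p y"
      unfolding p_def[of x] by (rule Least_le) (use p[OF yX] s_eq in auto)
    ultimately show ?thesis by simp
  qed
  have level: "{x\<in>A. p x = k} \<in> Cl" for k
  proof -
    have "X \<subseteq> (\<Union>x\<in>X. nb x)" by (auto simp: nb_def)
    then obtain J where J: "J \<subseteq> X" "finite J" "X \<subseteq> (\<Union>x\<in>J. nb x)"
      using cover_index[of X nb, OF nb] by metis
    have key: "p y = k \<longleftrightarrow> y \<in> (\<Union>x\<in>{x\<in>J. p x = k}. nb x)" if yX: "y \<in> X" for y
    proof
      assume "p y = k"
      moreover obtain x where x: "x \<in> J" "y \<in> nb x" using J(3) yX by blast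
      moreover have "p y = p x" using p_nb[OF subsetD[OF J(1) x(1)] x(2)] .
      ultimately show "y \<in> (\<Union>x\<in>{x\<in>J. p x = k}. nb x)" by auto
    next
      assume "y \<in> (\<Union>x\<in>{x\<in>J. p x = k}. nb x)"
      then obtain x where "x \<in> J" "p x = k" "y \<in> nb x" by auto
      then show "p y = k" using p_nb[of x y] J(1) by auto
    qed
    have "{x\<in>A. p x = k} = {y\<in>A. y \<in> (\<Union>x\<in>{x\<in>J. p x = k}. nb x)}"
      using conj_cong[OF refl key[OF subsetD[OF Cl_subset[OF A]]]] by (rule Collect_cong)
    also have "\<dots> = A \<inter> (\<Union>x\<in>{x\<in>J. p x = k}. nb x)" by (rule Int_def[symmetric, unfolded Collect_mem_eq])
    finally have "{x\<in>A. p x = k} = A \<inter> (\<Union>x\<in>{x\<in>J. p x = k}. nb x)" .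
    moreover have "(\<Union>x\<in>{x\<in>J. p x = k}. nb x) \<in> Cl"
      by (rule finite_UN) (use J nb in auto)
    ultimately show ?thesis using Int[OF A] by simp
  qed
  have "iso_on T (\<Union>k\<in>{..N}. {x\<in>A. p x = k}) (\<Union>k\<in>{..N}. f ` {x\<in>A. p x = k}) f"
  proof (rule iso_on_UN)
    show "iso_on T {x\<in>A. p x = k} (f ` {x\<in>A. p x = k}) f" for k
    proof -
      have eq: "f ` {x\<in>A. p x = k} = (T ^^ k) ` {x\<in>A. p x = k}" by (auto simp: f_def)
      show ?thesis unfolding eq
        using iso_on_funpow[OF h level, of k k] by (subst iso_on_cong[of _ f "T ^^ k"]) (auto simp: f_def)
    qed
    show "disjoint_family_on (\<lambda>k. f ` {x\<in>A. p x = k}) {..N}"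
      using inj unfolding disjoint_family_on_def inj_on_def by fastforce
  qed simp
  moreover have "(\<Union>k\<in>{..N}. {x\<in>A. p x = k}) = A" using p(3) Cl_subset[OF A] by auto
  moreover have "(\<Union>k\<in>{..N}. f ` {x\<in>A. p x = k}) = f ` A" using p(3) Cl_subset[OF A] by auto
  ultimately have "iso_on T A (f ` A) f" by simp
  moreover have "\<forall>x\<in>A. \<exists>p>0. f x = (T ^^ p) x" using p(1) Cl_subset[OF A] by (auto simp: f_def)
  moreover have "f ` A \<subseteq> B" using hit(2) by (auto simp: f_def)
  ultimately show ?thesis unfolding fwd_iso_def by blast
qed


text \<open>\<open>comparison\<close> needs strict inequalities, and shrinking neighbourhoods of
  \<open>a\<close> and \<open>b\<close> provide them. From \<open>m V < m U\<close> one embeds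
  \<open>A - U\<close> into \<open>B - V\<close>. The part \<open>D\<close> of \<open>B - V'\<close>
  not yet reached has mean \<open>m U - m V'\<close>, less than that of \<open>U - U'\<close> as
  \<open>m U' < m V'\<close>; so \<open>D\<close> embeds backwards there. The remainders
  \<open>U - C2\<close> and \<open>V'\<close> are again of equal mean and lie in the
  cylinders.\<close>

lemma back_and_forth_step:
  assumes T: "minimal T" and A: "A \<in> Cl" "a \<in> A" and B: "B \<in> Cl" "b \<in> B"
    and eq: "\<And>m. m \<in> means T \<Longrightarrow> m A = m B"
  shows "\<exists>A' B' f. A' \<in> Cl \<and> a \<in> A' \<and> A' \<subseteq> A \<inter> cyl n a \<and> B' \<in> Cl \<and> b \<in> B' \<and> B' \<subseteq> B \<inter> cyl n b \<and>
    fwd_iso T (A - A') (B - B') f"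
proof -
  note h = minimal_homeo[OF T]
  have aX: "a \<in> X" and bX: "b \<in> X" using A B Cl_subset by auto
  define U where "U = A \<inter> cyl n a"
  have U: "U \<in> Cl" "a \<in> U" "U \<subseteq> A"
    using Int[OF A(1) cyl_in] A(2) cyl_self[OF aX] by (auto simp: U_def)
  obtain V where V: "V \<in> Cl" "b \<in> V" "V \<subseteq> B" "\<forall>m\<in>means T. m V < m U"
    using smaller_neighbourhood[OF T U(1) _ B(2,1)] U(2) by (metis empty_iff)
  have "m (A - U) < m (B - V)" if m: "m \<in> means T" for m
    using means_Diff[OF m A(1) U(1,3)] means_Diff[OF m B(1) V(1,3)] eq[OF m] V(4) m by simp
  then obtain f1 C1 where C1: "C1 \<subseteq> B - V" and f1: "fwd_iso T (A - U) C1 f1"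
    using comparison[OF T Diff[OF A(1) U(1)] Diff[OF B(1) V(1)]] by metis
  note i1 = f1[unfolded fwd_iso_def, THEN conjunct1]
  define V' where "V' = V \<inter> cyl n b"
  have V': "V' \<in> Cl" "b \<in> V'" "V' \<subseteq> V"
    using Int[OF V(1) cyl_in] V(2) cyl_self[OF bX] by (auto simp: V'_def)
  define D where "D = B - C1 - V'"
  have D: "D \<in> Cl" unfolding D_def by (intro Diff B(1) V'(1) iso_onD(2)[OF i1])
  obtain U' where U': "U' \<in> Cl" "a \<in> U'" "U' \<subseteq> U" "\<forall>m\<in>means T. m U' < m V'"
    using smaller_neighbourhood[OF T V'(1) _ U(2,1)] V'(2) by (metis empty_iff)
  have "m D < m (U - U')" if "m \<in> means (inv T)" for m
  proof -
    have m: "m \<in> means T" using that means_inv[OF h] by simp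
    have "m D = m B - m C1 - m V'"
      unfolding D_def using V' V C1 by (subst means_Diff[OF m] means_Diff[OF m B(1)];
        (intro Diff B(1) iso_onD(2)[OF i1])?; auto)+
    moreover have "m C1 = m (A - U)"
      using iso_onD(7)[OF i1 m Diff[OF A(1) U(1)]] iso_onD(5)[OF i1] by simp
    ultimately show ?thesis
      using means_Diff[OF m A(1) U(1,3)] means_Diff[OF m U(1) U'(1,3)] eq[OF m] U'(4) m by simp
  qed
  then obtain f2 C2 where C2: "C2 \<subseteq> U - U'" and f2: "fwd_iso (inv T) D C2 f2"
    using comparison[OF minimal_inv[OF T] D Diff[OF U(1) U'(1)]] by metis
  define f3 where "f3 = inv_into D f2"
  have f3: "fwd_iso T C2 D f3" using fwd_iso_inv[OF h f2] by (simp add: f3_def)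
  note i3 = f3[unfolded fwd_iso_def, THEN conjunct1]
  define f where "f x = (if x \<in> C2 then f3 x else f1 x)" for x
  have f_f1: "f x = f1 x" if "x \<in> A - U" for x using that C2 by (auto simp: f_def)
  have f_f3: "f x = f3 x" if "x \<in> C2" for x using that by (simp add: f_def)
  have "iso_on T (A - U) C1 f" using i1 iso_on_cong[of "A - U" f f1] f_f1 by simp
  moreover have "iso_on T C2 D f" using i3 iso_on_cong[of C2 f f3] f_f3 by simp
  moreover have "C1 \<inter> D = {}" by (auto simp: D_def)
  ultimately have "iso_on T ((A - U) \<union> C2) (C1 \<union> D) f" by (rule iso_on_Un)
  moreover have "(A - U) \<union> C2 = A - (U - C2)" using C2 U by auto
  moreover have "C1 \<union> D = B - V'" using C1 V V' by (auto simp: D_def)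
  moreover have "\<forall>x\<in>(A - U) \<union> C2. \<exists>p>0. f x = (T ^^ p) x"
    using f1 f3 f_f1 f_f3 unfolding fwd_iso_def by (metis Un_iff)
  ultimately have "fwd_iso T (A - (U - C2)) (B - V') f" by (simp add: fwd_iso_def)
  moreover have "U - C2 \<in> Cl" using Diff[OF U(1) iso_onD(1)[OF i3]] .
  moreover have "a \<in> U - C2" "U - C2 \<subseteq> A \<inter> cyl n a" using U' C2 U by (auto simp: U_def)
  moreover have "V' \<subseteq> B \<inter> cyl n b" using V by (auto simp: V'_def)
  ultimately show ?thesis using V' by metis
qed

text \<open>The exponents of the isomorphism are unbounded in general, but only near one point \<open>a\<close>.\<close>

lemma fwd_iso_exists:
  assumes T: "minimal T" and A: "A \<in> Cl" "A \<noteq> {}" and B: "B \<in> Cl" "B \<noteq> {}"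
    and eq: "\<And>m. m \<in> means T \<Longrightarrow> m A = m B"
  shows "\<exists>f. fwd_iso T A B f"
proof -
  obtain a where a: "a \<in> A" using A by auto
  have aX: "a \<in> X" using a Cl_subset[OF A(1)] by auto
  \<comment> \<open>The remainders will shrink to \<open>a\<close> and \<open>b\<close>, so
    \<open>a\<close> must go to \<open>b\<close>. Taking \<open>b\<close> on the forward orbit of
    \<open>a\<close> makes this exponent positive too.\<close>
  obtain q where q: "q > 0" "(T ^^ q) a \<in> B" using minimal_hit[OF T B] aX by metis
  define b where "b = (T ^^ q) a"
  have b: "b \<in> B" using q by (simp add: b_def)
  have bX: "b \<in> X" using b Cl_subset[OF B(1)] by auto
  define P where "P n s \<longleftrightarrow> fst s \<in> Cl \<and> a \<in> fst s \<and> snd s \<in> Cl \<and> b \<in> snd s \<and>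
    (\<forall>m\<in>means T. m (fst s) = m (snd s)) \<and> (n = 0 \<longrightarrow> s = (A, B))" for n :: nat and s
  define Q where "Q n s t \<longleftrightarrow> fst t \<subseteq> fst s \<inter> cyl n a \<and> snd t \<subseteq> snd s \<inter> cyl n b \<and>
    (\<exists>f. fwd_iso T (fst s - fst t) (snd s - snd t) f)" for n s t
  have step: "\<exists>t. P (Suc n) t \<and> Q n s t" if s: "P n s" for n s
  proof -
    note s' = s[unfolded P_def]
    obtain A' B' f where *: "A' \<in> Cl" "a \<in> A'" "A' \<subseteq> fst s \<inter> cyl n a" "B' \<in> Cl" "b \<in> B'"
      "B' \<subseteq> snd s \<inter> cyl n b" "fwd_iso T (fst s - A') (snd s - B') f"
      using back_and_forth_step[OF T, of "fst s" a "snd s" b n] s' by metis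
    note i = *(7)[unfolded fwd_iso_def, THEN conjunct1]
    have "m A' = m B'" if m: "m \<in> means T" for m
    proof -
      have "m (snd s - B') = m (fst s - A')"
        using iso_onD(7)[OF i m iso_onD(1)[OF i] order_refl] iso_onD(5)[OF i] by simp
      moreover have "m (fst s) = m (snd s)" using s' m by blast
      moreover have "m (fst s - A') = m (fst s) - m A'" "m (snd s - B') = m (snd s) - m B'"
        by (intro means_Diff[OF m]; use s' * in simp)+
      ultimately show ?thesis by linarith
    qed
    then have "P (Suc n) (A', B')" using * by (simp add: P_def)
    moreover have "Q n s (A', B')" using * unfolding Q_def by auto
    ultimately show ?thesis by blast
  qed
  have "P 0 (A, B)" using A B a b eq by (simp add: P_def)
  then obtain s where s: "\<And>n. P n (s n)" "\<And>n. Q n (s n) (s (Suc n))"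
    using dependent_nat_choice[of P Q] step by metis
  define An Bn where "An n = fst (s n)" and "Bn n = snd (s n)" for n
  have An: "An n \<in> Cl" "a \<in> An n" "An (Suc n) \<subseteq> An n" "An (Suc n) \<subseteq> cyl n a"
    and Bn: "Bn n \<in> Cl" "b \<in> Bn n" "Bn (Suc n) \<subseteq> Bn n" "Bn (Suc n) \<subseteq> cyl n b" for n
    using s(1)[of n] s(2)[of n] by (auto simp: An_def Bn_def P_def Q_def)
  have AB0: "An 0 = A" "Bn 0 = B" using s(1)[of 0] by (auto simp: An_def Bn_def P_def)
  have "\<forall>n. \<exists>f. fwd_iso T (An n - An (Suc n)) (Bn n - Bn (Suc n)) f"
    using s(2) by (auto simp: Q_def An_def Bn_def)
  then obtain g where g: "\<And>n. fwd_iso T (An n - An (Suc n)) (Bn n - Bn (Suc n)) (g n)" by metis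
  have decA: "An k \<subseteq> An n" and decB: "Bn k \<subseteq> Bn n" if "n \<le> k" for n k
    using lift_Suc_antimono_le[of An n k] lift_Suc_antimono_le[of Bn n k] An(3) Bn(3) that by blast+
  \<comment> \<open>Since \<open>An 0 = A\<close>, the least such \<open>n\<close> is the layer
    \<open>An n - An (Suc n)\<close> containing \<open>x\<close>.\<close>
  define f where "f x = (if x = a then b else g (LEAST n. x \<notin> An (Suc n)) x)" for x
  have f_g: "f x = g n x" if x: "x \<in> An n - An (Suc n)" for n x
  proof -
    have "(LEAST n. x \<notin> An (Suc n)) = n"
    proof (rule Least_equality)
      fix k assume "x \<notin> An (Suc k)"
      then show "n \<le> k" using x decA[of "Suc k" n] by (meson DiffD1 not_less_eq_eq subsetD)
    qed (use x in auto)
    moreover have "x \<noteq> a" using x An(2) by auto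
    ultimately show ?thesis by (simp add: f_def)
  qed
  have iso: "fwd_iso T (A - An n) (B - Bn n) f" for n
  proof (induction n)
    case 0
    then show ?case by (simp add: AB0 fwd_iso_def iso_on_def means_empty bij_betw_def)
  next
    case (Suc n)
    have gn: "fwd_iso T (An n - An (Suc n)) (Bn n - Bn (Suc n)) f"
      using g[of n] iso_on_cong[of "An n - An (Suc n)" f "g n"] f_g[of _ n] by (simp add: fwd_iso_def)
    have "(A - An n) \<union> (An n - An (Suc n)) = A - An (Suc n)"
      "(B - Bn n) \<union> (Bn n - Bn (Suc n)) = B - Bn (Suc n)"
      using decA[of 0 n] decA[of 0 "Suc n"] decB[of 0 n] decB[of 0 "Suc n"] An(3)[of n] Bn(3)[of n] AB0
      by auto
    moreover have "iso_on T ((A - An n) \<union> (An n - An (Suc n))) ((B - Bn n) \<union> (Bn n - Bn (Suc n))) f"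
      by (rule iso_on_Un) (use Suc gn in \<open>auto simp: fwd_iso_def\<close>)
    moreover have "\<forall>x\<in>(A - An n) \<union> (An n - An (Suc n)). \<exists>p>0. f x = (T ^^ p) x"
      using Suc gn unfolding fwd_iso_def by (metis Un_iff)
    ultimately show ?case by (simp add: fwd_iso_def)
  qed
  have iso': "iso_on T (A - An n) (B - Bn n) f" for n using iso[of n] by (simp add: fwd_iso_def)
  have leave: "\<exists>n. x \<notin> An n" if x: "x \<in> X" "x \<noteq> a" for x
  proof -
    obtain i where "x \<in> E i \<longleftrightarrow> a \<notin> E i" using E_separates[OF x(1) aX x(2)] by blast
    then have "x \<notin> cyl (Suc i) a" by (auto simp: cyl_def)
    then show ?thesis using An(4) by blast
  qed
  have leaveB: "\<exists>n. x \<notin> Bn n" if x: "x \<in> X" "x \<noteq> b" for x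
  proof -
    obtain i where "x \<in> E i \<longleftrightarrow> b \<notin> E i" using E_separates[OF x(1) bX x(2)] by blast
    then have "x \<notin> cyl (Suc i) b" by (auto simp: cyl_def)
    then show ?thesis using Bn(4) by blast
  qed
  have fa: "f a = b" by (simp add: f_def)
  have AX: "A \<subseteq> X" and BX: "B \<subseteq> X" using Cl_subset A B by auto
  have f_mem: "f x \<in> B - Bn n" if "x \<in> A - An n" for x n using iso_onD(5)[OF iso'[of n]] that by blast
  have inj: "inj_on f A"
  proof -
    have ne_b: "f x \<noteq> b" if x: "x \<in> A" "x \<noteq> a" for x
    proof -
      obtain n where "x \<notin> An n" using leave[of x] x AX by auto
      then show ?thesis using f_mem[of x n] x Bn(2)[of n] by auto
    qed
    have "x = y" if x: "x \<in> A" "x \<noteq> a" and y: "y \<in> A" "y \<noteq> a" and eq: "f x = f y" for x y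
    proof -
      obtain n k where "x \<notin> An n" "y \<notin> An k" using leave[of x] leave[of y] x y AX by auto
      then have "x \<in> A - An (max n k)" "y \<in> A - An (max n k)"
        using decA[of n "max n k"] decA[of k "max n k"] x y by auto
      then show ?thesis using inj_onD[OF iso_onD(4)[OF iso'] eq] by blast
    qed
    then show ?thesis using ne_b fa unfolding inj_on_def by metis
  qed
  have im: "f ` A = B"
  proof
    show "f ` A \<subseteq> B"
    proof
      fix y assume "y \<in> f ` A"
      then obtain x where x: "x \<in> A" "y = f x" by blast
      show "y \<in> B"
      proof (cases "x = a")
        case False
        then obtain n where "x \<notin> An n" using leave[of x] x AX by auto
        then show ?thesis using f_mem[of x n] x by auto
      qed (use x fa b in auto)
    qed
    show "B \<subseteq> f ` A"
    proof
      fix y assume y: "y \<in> B"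
      show "y \<in> f ` A"
      proof (cases "y = b")
        case True then show ?thesis using fa a by auto
      next
        case False
        then obtain n where "y \<notin> Bn n" using leaveB[of y] y BX by auto
        then have "y \<in> f ` (A - An n)" using iso_onD(5)[OF iso'[of n]] y by simp
        then show ?thesis by auto
      qed
    qed
  qed
  have avoidA: "\<exists>n. U \<subseteq> A - An n" if U: "U \<in> Cl" "U \<subseteq> A" "a \<notin> U" for U
  proof -
    obtain n where "cyl n a \<subseteq> X - U" using cyl_base[OF compl_sets[OF U(1)], of a] aX U(3) by auto
    then show ?thesis using An(4)[of n] U(2) by blast
  qed
  have avoidB: "\<exists>n. U \<subseteq> B - Bn n" if U: "U \<in> Cl" "U \<subseteq> B" "b \<notin> U" for U
  proof -
    obtain n where "cyl n b \<subseteq> X - U" using cyl_base[OF compl_sets[OF U(1)], of b] bX U(3) by auto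
    then show ?thesis using Bn(4)[of n] U(2) by blast
  qed
  have Cl_avoid: "f ` U \<in> Cl \<and> (\<forall>m\<in>means T. m (f ` U) = m U)"
    if U: "U \<in> Cl" "U \<subseteq> A" "a \<notin> U" for U
  proof -
    obtain n where "U \<subseteq> A - An n" using avoidA[OF U] by blast
    then show ?thesis using iso_onD(6,7)[OF iso'[of n]] U(1) by simp
  qed
  have Cl_avoid': "U \<in> Cl" if U: "U \<subseteq> A" "f ` U \<in> Cl" "b \<notin> f ` U" for U
  proof -
    obtain n where n: "f ` U \<subseteq> B - Bn n" using avoidB[OF U(2) _ U(3)] im U(1) by blast
    have "U \<subseteq> A - An n"
    proof
      fix x assume x: "x \<in> U"
      then have "f x \<in> f ` (A - An n)" using n iso_onD(5)[OF iso'[of n]] by auto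
      then obtain x' where "x' \<in> A - An n" "f x = f x'" by auto
      then show "x \<in> A - An n" using inj x U(1) unfolding inj_on_def by (metis DiffD1 subsetD)
    qed
    then show ?thesis using iso_onD(6)[OF iso'[of n]] U(2) by simp
  qed
  have image_Diff: "f ` (A - U) = B - f ` U" if "U \<subseteq> A" for U
    using inj_on_image_set_diff[OF inj, of A U] that im by auto
  \<comment> \<open>A clopen set missing \<open>a\<close> lies in finitely many layers; one
    containing \<open>a\<close> is the complement in \<open>A\<close> of such a set. This settles
    continuity and means at \<open>a\<close> without any control of exponents there.\<close>
  have Cl_image: "f ` U \<in> Cl \<and> (\<forall>m\<in>means T. m (f ` U) = m U)" if U: "U \<in> Cl" "U \<subseteq> A" for U
  proof (cases "a \<in> U")
    case False then show ?thesis using Cl_avoid U by simp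
  next
    case True
    have AU: "A - U \<in> Cl" using Diff[OF A(1) U(1)] .
    have c: "B - f ` U \<in> Cl" "\<forall>m\<in>means T. m (B - f ` U) = m (A - U)"
      using Cl_avoid[OF AU] image_Diff[OF U(2)] True by auto
    have eqU: "f ` U = B - (B - f ` U)" using U(2) im by auto
    have fU: "f ` U \<in> Cl" using Diff[OF B(1) c(1)] eqU by simp
    have "m (f ` U) = m U" if m: "m \<in> means T" for m
      using means_Diff[OF m B(1) fU] image_mono[OF U(2), of f] im means_Diff[OF m A(1) U(1,2)]
        bspec[OF c(2) m] eq[OF m]
      by simp
    then show ?thesis using fU by simp
  qed
  have Cl_image': "U \<in> Cl" if U: "U \<subseteq> A" "f ` U \<in> Cl" for U
  proof (cases "b \<in> f ` U")
    case False then show ?thesis using Cl_avoid' U by simp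
  next
    case True
    have "A - U \<in> Cl"
      by (rule Cl_avoid') (use image_Diff[OF U(1)] Diff[OF B(1) U(2)] True in auto)
    then have "A - (A - U) \<in> Cl" by (rule Diff[OF A(1)])
    then show ?thesis using U(1) by (simp add: double_diff)
  qed
  have "\<forall>U\<subseteq>A. f ` U \<in> Cl \<longleftrightarrow> U \<in> Cl" "\<forall>m\<in>means T. \<forall>U\<in>Cl. U \<subseteq> A \<longrightarrow> m (f ` U) = m U"
    using Cl_image Cl_image' by metis+
  then have "iso_on T A B f"
    unfolding iso_on_def bij_betw_def using A B inj im by simp
  moreover have "\<exists>p>0. f x = (T ^^ p) x" if x: "x \<in> A" for x
  proof (cases "x = a")
    case True then show ?thesis using q fa b_def by auto
  next
    case False
    then obtain n where "x \<notin> An n" using leave[of x] x AX by auto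
    then show ?thesis using iso[of n] x by (simp add: fwd_iso_def)
  qed
  ultimately show ?thesis unfolding fwd_iso_def by metis
qed

subsection \<open>Means are invariant along orbits\<close>

definition closed_set :: "'a set \<Rightarrow> bool" where
  "closed_set C \<longleftrightarrow> C \<subseteq> X \<and> (\<forall>x\<in>X - C. \<exists>U\<in>Cl. x \<in> U \<and> U \<inter> C = {})"

lemma closed_set_empty: "closed_set {}"
  unfolding closed_set_def using top by (metis Int_empty_right DiffD1 empty_subsetI)

lemma closed_set_Un:
  assumes "closed_set C" "closed_set D"
  shows "closed_set (C \<union> D)"
  unfolding closed_set_def
proof (intro conjI ballI)
  fix x assume x: "x \<in> X - (C \<union> D)"
  then obtain U V where UV: "U \<in> Cl" "x \<in> U" "U \<inter> C = {}" "V \<in> Cl" "x \<in> V" "V \<inter> D = {}"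
    using assms unfolding closed_set_def by (metis Diff_iff Un_iff)
  show "\<exists>W\<in>Cl. x \<in> W \<and> W \<inter> (C \<union> D) = {}"
    by (rule bexI[OF _ Int[OF UV(1) UV(4)]]) (use UV in auto)
qed (use assms in \<open>auto simp: closed_set_def\<close>)

lemma closed_set_UN: "finite F \<Longrightarrow> (\<And>i. i \<in> F \<Longrightarrow> closed_set (C i)) \<Longrightarrow> closed_set (\<Union>i\<in>F. C i)"
  by (induction F rule: finite_induct) (auto simp: closed_set_empty closed_set_Un)

lemma closed_set_image:
  assumes S: "homeo S" and C: "closed_set C"
  shows "closed_set (S ` C)"
  unfolding closed_set_def
proof (intro conjI ballI)
  show "S ` C \<subseteq> X" using C homeo_mem[OF S] by (auto simp: closed_set_def)
  fix x assume x: "x \<in> X - S ` C"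
  have "inv S x \<in> X - C"
    using x homeo_mem[OF homeo_inv[OF S]] app_inv[OF S] by (metis Diff_iff image_eqI)
  then obtain U where U: "U \<in> Cl" "inv S x \<in> U" "U \<inter> C = {}" using C unfolding closed_set_def by metis
  have "x \<in> S ` U" using U(2) app_inv[OF S] by (metis image_eqI)
  moreover have "S ` U \<inter> S ` C = {}"
    using U(3) image_Int[OF homeo_inj[OF S], of U C] by simp
  ultimately show "\<exists>U\<in>Cl. x \<in> U \<and> U \<inter> S ` C = {}" using homeo_image[OF S U(1)] by metis
qed

lemma separate_closed_set:
  assumes "closed_set C" "closed_set D" "C \<inter> D = {}"
  shows "\<exists>U\<in>Cl. C \<subseteq> U \<and> U \<inter> D = {}"
proof -
  let ?\<U> = "{U\<in>Cl. U \<inter> C = {} \<or> U \<inter> D = {}}"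
  have "X \<subseteq> \<Union>?\<U>"
  proof
    fix x assume x: "x \<in> X"
    have "\<exists>U\<in>Cl. x \<in> U \<and> (U \<inter> C = {} \<or> U \<inter> D = {})"
    proof (cases "x \<in> C")
      case False then show ?thesis using assms(1) x unfolding closed_set_def by (metis Diff_iff)
    next
      case True
      then have "x \<in> X - D" using x assms(3) by auto
      then show ?thesis using assms(2) unfolding closed_set_def by metis
    qed
    then show "x \<in> \<Union>?\<U>" by auto
  qed
  then obtain \<V> where V: "\<V> \<subseteq> ?\<U>" "finite \<V>" "X \<subseteq> \<Union>\<V>"
    using cover[of ?\<U>] by auto
  let ?W = "\<Union>{V\<in>\<V>. V \<inter> C = {}}"
  have "?W \<in> Cl" by (rule finite_Union) (use V(1,2) in \<open>simp, blast\<close>)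
  then have "X - ?W \<in> Cl" by (rule compl_sets)
  moreover have "C \<subseteq> X - ?W" using assms(1) by (auto simp: closed_set_def)
  moreover have "(X - ?W) \<inter> D = {}"
  proof -
    have False if x: "x \<in> X" "x \<notin> ?W" "x \<in> D" for x
    proof -
      obtain V where "V \<in> \<V>" "x \<in> V" using V(3) x(1) by blast
      then show False using V(1) x(2,3) by auto
    qed
    then show ?thesis by auto
  qed
  ultimately show ?thesis by metis
qed

section \<open>Outer content\<close>

text \<open>On a closed set this is the value of the Borel measure that extends the mean
  \<open>m\<close>.\<close>

definition outer :: "('a set \<Rightarrow> real) \<Rightarrow> 'a set \<Rightarrow> real" where
  "outer m C = Inf (m ` {U\<in>Cl. C \<subseteq> U})"

lemma outer_le:
  assumes m: "m \<in> means T" and U: "U \<in> Cl" "C \<subseteq> U"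
  shows "outer m C \<le> m U"
  unfolding outer_def
proof (rule cInf_lower)
  show "bdd_below (m ` {U\<in>Cl. C \<subseteq> U})"
    by (rule bdd_belowI[of _ 0]) (use means_nonneg[OF m] in auto)
qed (use U in auto)

lemma outer_approx:
  assumes "C \<subseteq> X" "e > 0"
  shows "\<exists>U\<in>Cl. C \<subseteq> U \<and> m U < outer m C + e"
proof -
  have "m ` {U\<in>Cl. C \<subseteq> U} \<noteq> {}" using assms(1) top by auto
  then have "\<exists>y\<in>m ` {U\<in>Cl. C \<subseteq> U}. y < outer m C + e"
    unfolding outer_def by (rule cInf_lessD) (use assms in simp)
  then show ?thesis by auto
qed

lemma outer_funpow:
  assumes m: "m \<in> means T" and T: "homeo T"
  shows "outer m ((T ^^ n) ` C) = outer m C"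
proof -
  have "m ` {U\<in>Cl. (T ^^ n) ` C \<subseteq> U} = m ` {U\<in>Cl. C \<subseteq> U}"
  proof (intro equalityI subsetI)
    fix y assume "y \<in> m ` {U\<in>Cl. (T ^^ n) ` C \<subseteq> U}"
    then obtain U where U: "U \<in> Cl" "(T ^^ n) ` C \<subseteq> U" "y = m U" by auto
    then have "y = m ((T ^^ n) -` U)" using means_vimage_funpow[OF m T] by simp
    then show "y \<in> m ` {U\<in>Cl. C \<subseteq> U}"
      using U homeo_vimage[OF homeo_funpow[OF T] U(1)] by auto
  next
    fix y assume "y \<in> m ` {U\<in>Cl. C \<subseteq> U}"
    then obtain U where U: "U \<in> Cl" "C \<subseteq> U" "y = m U" by auto
    then have "y = m ((T ^^ n) ` U)" using means_funpow[OF m T] by simp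
    then show "y \<in> m ` {U\<in>Cl. (T ^^ n) ` C \<subseteq> U}"
      using U homeo_image[OF homeo_funpow[OF T] U(1)] by auto
  qed
  then show ?thesis by (simp add: outer_def)
qed

text \<open>A clopen set separates one closed set from the union of the others and splits
  \<open>W\<close> accordingly; this is why the induction runs over all \<open>W\<close>.\<close>

lemma sum_outer_le:
  assumes m: "m \<in> means T" and "finite F" "\<And>i. i \<in> F \<Longrightarrow> closed_set (C i)"
    "disjoint_family_on C F" "W \<in> Cl" "(\<Union>i\<in>F. C i) \<subseteq> W"
  shows "(\<Sum>i\<in>F. outer m (C i)) \<le> m W"
  using assms(2-6)
proof (induction F arbitrary: W rule: finite_induct)
  case empty
  then show ?case using means_nonneg[OF m] by simp
next
  case (insert i F)
  have "C i \<inter> (\<Union>j\<in>F. C j) = {}"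
    using insert.prems(2) insert.hyps(2) by (fastforce simp: disjoint_family_on_def)
  then obtain U where U: "U \<in> Cl" "C i \<subseteq> U" "U \<inter> (\<Union>j\<in>F. C j) = {}"
    using separate_closed_set[of "C i" "\<Union>j\<in>F. C j"] closed_set_UN[of F C] insert.prems(1) insert.hyps(1)
    by (metis insertCI)
  have W: "W \<inter> U \<in> Cl" "W - U \<in> Cl" using insert.prems(3) U(1) by auto
  have "outer m (C i) \<le> m (W \<inter> U)"
    by (rule outer_le[OF m W(1)]) (use insert.prems(4) U(2) in auto)
  moreover have "(\<Sum>j\<in>F. outer m (C j)) \<le> m (W - U)"
    by (rule insert.IH)
      (use insert.prems U(3) W in \<open>auto simp: disjoint_family_on_def\<close>)
  moreover have "m W = m (W \<inter> U) + m (W - U)"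
    using means_Un[OF m W] by (simp add: Int_Diff_Un Int_Diff_disjoint)
  ultimately show ?case using insert.hyps by simp
qed

lemma sum_half_powers_le:
  assumes "finite (F :: 'c::countable set)"
  shows "(\<Sum>p\<in>F. (1/2::real) ^ Suc (to_nat p)) \<le> 1"
proof -
  have "(\<Sum>p\<in>F. (1/2::real) ^ Suc (to_nat p)) = (\<Sum>n\<in>to_nat ` F. (1/2) ^ Suc n)"
    by (subst sum.reindex) (auto simp: inj_on_def)
  also have "\<dots> \<le> (\<Sum>n. (1/2::real) ^ Suc n)"
    by (rule sum_le_suminf) (use assms power_half_series in \<open>auto simp: sums_iff\<close>)
  finally show ?thesis using power_half_series by (simp add: sums_iff)
qed

text \<open>\<open>A\<close> is a countable union of closed sets on which \<open>S\<close> is a fixed power of \<open>T\<close>; as the sum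
  of outer contents is subadditive by compactness and superadditive on disjoint closed sets, no
  extension of the mean to a measure is needed.\<close>

lemma orbit_mean_le:
  assumes T: "minimal T" and S: "homeo S"
    and orb: "\<And>x. x \<in> X \<Longrightarrow> \<exists>i j. (T ^^ i) (S x) = (T ^^ j) x"
    and m: "m \<in> means T" and A: "A \<in> Cl"
  shows "m A \<le> m (S ` A)"
proof (rule field_le_epsilon)
  fix e :: real assume e: "0 < e"
  note h = minimal_homeo[OF T]
  note hp = homeo_funpow[OF h]
  have AX: "A \<subseteq> X" using Cl_subset A by auto
  \<comment> \<open>Pairs with a zero entry encode the integers, as exponent \<open>j - i\<close>.
    With this normalisation aperiodicity makes the sets \<open>C p\<close> disjoint.\<close>
  define I :: "(nat \<times> nat) set" where "I = {(i, j). i = 0 \<or> j = 0}"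
  define C where "C p = {x\<in>A. (T ^^ fst p) (S x) = (T ^^ snd p) x}" for p
  have C_sub: "C p \<subseteq> X" for p using AX by (auto simp: C_def)
  have closed: "closed_set (C p)" for p
    unfolding closed_set_def
  proof (intro conjI ballI C_sub)
    fix x assume x: "x \<in> X - C p"
    show "\<exists>U\<in>Cl. x \<in> U \<and> U \<inter> C p = {}"
    proof (cases "x \<in> A")
      case False
      then show ?thesis using x by (intro bexI[OF _ compl_sets[OF A]]) (auto simp: C_def)
    next
      case True
      let ?f = "T ^^ fst p \<circ> S" and ?g = "T ^^ snd p"
      have f: "homeo ?f" using homeo_comp hp S by blast
      have ne: "?f x \<noteq> ?g x" using x True by (auto simp: C_def)
      have "?f x \<in> X" "?g x \<in> X" using homeo_mem[OF f, of x] homeo_mem[OF hp, of "snd p" x] x by simp_all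
      then obtain k where k: "?f x \<in> E k \<longleftrightarrow> ?g x \<notin> E k" using E_separates ne by blast
      let ?U = "{y\<in>X. y \<in> ?f -` E k \<longleftrightarrow> ?f x \<in> E k} \<inter> {y\<in>X. y \<in> ?g -` E k \<longleftrightarrow> ?g x \<in> E k}"
      have "?U \<in> Cl"
        by (intro Int Collect_iff_in homeo_vimage[OF f E_in] homeo_vimage[OF hp E_in])
      moreover have "x \<in> ?U" using x by auto
      moreover have "?U \<inter> C p = {}" using k by (auto simp: C_def)
      ultimately show ?thesis by (intro bexI[of _ ?U] conjI)
    qed
  qed
  have outer_eq: "outer m (S ` C p) = outer m (C p)" for p
  proof -
    have "(T ^^ fst p) ` (S ` C p) = (T ^^ snd p) ` C p"
      unfolding image_image by (rule image_cong) (auto simp: C_def)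
    then show ?thesis using outer_funpow[OF m h] by metis
  qed
  have A_cover: "\<exists>p\<in>I. x \<in> C p" if x: "x \<in> A" for x
  proof -
    obtain i j where ij: "(T ^^ i) (S x) = (T ^^ j) x" using orb x AX by blast
    show ?thesis
    proof (cases "i \<le> j")
      case True
      have "S x = (T ^^ (j - i)) x"
        using inv_funpow_funpow[OF h True, of x] inv_funpow_cancel[OF h, of i "S x"] ij by simp
      then show ?thesis using x by (intro bexI[of _ "(0, j - i)"]) (auto simp: C_def I_def)
    next
      case False
      then have "(T ^^ (i - j)) (S x) = x"
        using inv_funpow_funpow[OF h, of j i "S x"] inv_funpow_cancel[OF h, of j x] ij by simp
      then show ?thesis using x by (intro bexI[of _ "(i - j, 0)"]) (auto simp: C_def I_def)
    qed
  qed
  have disj: "p = q" if pq: "p \<in> I" "q \<in> I" and x: "x \<in> C p" "x \<in> C q" for p q x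
  proof -
    have xX: "x \<in> X" using x C_sub[of p] by blast
    have "(T ^^ (fst q + snd p)) x = (T ^^ fst q) ((T ^^ fst p) (S x))"
      using x by (simp add: C_def funpow_add)
    also have "\<dots> = (T ^^ (fst q + fst p)) (S x)" by (simp add: funpow_add)
    also have "\<dots> = (T ^^ (fst p + fst q)) (S x)" by (simp add: add.commute)
    also have "\<dots> = (T ^^ (fst p + snd q)) x" using x by (simp add: C_def funpow_add)
    finally have "fst q + snd p = fst p + snd q" using funpow_inject[OF T xX] by blast
    then show ?thesis using pq by (auto simp: I_def)
  qed
  \<comment> \<open>The errors are chosen so that over any finite set of pairs they sum to at most
    \<open>e\<close>.\<close>
  have "\<exists>U\<in>Cl. C p \<subseteq> U \<and> m U < outer m (C p) + e * (1/2) ^ Suc (to_nat p)" for p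
    by (rule outer_approx[OF C_sub]) (use e in simp)
  then obtain U where U: "\<And>p. U p \<in> Cl" "\<And>p. C p \<subseteq> U p"
    "\<And>p. m (U p) < outer m (C p) + e * (1/2) ^ Suc (to_nat p)"
    by metis
  \<comment> \<open>The extra index \<open>None\<close> covers \<open>X - A\<close>, so that
    compactness of \<open>X\<close> yields a finite cover of \<open>A\<close>.\<close>
  define V where "V o' = (case o' of None \<Rightarrow> X - A | Some p \<Rightarrow> U p)" for o'
  have "X \<subseteq> (\<Union>o'\<in>insert None (Some ` I). V o')"
    using A_cover U(2) by (fastforce simp: V_def)
  moreover have "V o' \<in> Cl" for o' using U(1) compl_sets[OF A] by (auto simp: V_def split: option.split)
  ultimately obtain J where J: "J \<subseteq> insert None (Some ` I)" "finite J" "X \<subseteq> (\<Union>o'\<in>J. V o')"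
    using cover_index[of "insert None (Some ` I)" V] by metis
  define F where "F = {p. Some p \<in> J}"
  have F: "finite F" "F \<subseteq> I"
    using J(1,2) finite_vimageI[of J Some] by (auto simp: F_def vimage_def)
  have "A \<subseteq> (\<Union>p\<in>F. U p)"
  proof
    fix x assume x: "x \<in> A"
    then obtain o' where o': "o' \<in> J" "x \<in> V o'" using J(3) AX by auto
    then obtain p where "o' = Some p" using x by (cases o') (auto simp: V_def)
    then have "p \<in> F" "x \<in> U p" using o' by (simp_all add: V_def F_def)
    then show "x \<in> (\<Union>p\<in>F. U p)" by blast
  qed
  then have "m A \<le> m (\<Union>p\<in>F. U p)"
    using means_mono[OF m finite_UN[OF F(1) U(1)] A] by simp
  also have "\<dots> \<le> (\<Sum>p\<in>F. m (U p))" by (rule means_UN_le[OF m F(1) U(1)])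
  also have "\<dots> \<le> (\<Sum>p\<in>F. outer m (C p) + e * (1/2) ^ Suc (to_nat p))"
    by (rule sum_mono) (use U(3) in \<open>simp add: less_imp_le\<close>)
  also have "\<dots> = (\<Sum>p\<in>F. outer m (S ` C p)) + e * (\<Sum>p\<in>F. (1/2) ^ Suc (to_nat p))"
    by (simp only: sum.distrib sum_distrib_left outer_eq)
  also have "\<dots> \<le> m (S ` A) + e * 1"
  proof (rule add_mono)
    show "(\<Sum>p\<in>F. outer m (S ` C p)) \<le> m (S ` A)"
    proof (rule sum_outer_le[OF m F(1)])
      show "disjoint_family_on (\<lambda>p. S ` C p) F"
        unfolding disjoint_family_on_def
      proof (intro ballI impI)
        fix p q assume pq: "p \<in> F" "q \<in> F" "p \<noteq> q"
        have "C p \<inter> C q = {}" using disj[of p q] pq F(2) by auto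
        then show "S ` C p \<inter> S ` C q = {}"
          using image_Int[OF homeo_inj[OF S], of "C p" "C q"] by simp
      qed
      show "(\<Union>p\<in>F. S ` C p) \<subseteq> S ` A" by (auto simp: C_def)
    qed (use closed_set_image[OF S closed] homeo_image[OF S A] in auto)
    show "e * (\<Sum>p\<in>F. (1/2) ^ Suc (to_nat p)) \<le> e * 1"
      by (rule mult_left_mono[OF sum_half_powers_le[OF F(1)]]) (use e in simp)
  qed
  finally show "m A \<le> m (S ` A) + e" by simp
qed

text \<open>The total mass being fixed, the inequality for \<open>X - A\<close> is the reverse
  inequality for \<open>A\<close>.\<close>

lemma orbit_mean:
  assumes T: "minimal T" and S: "homeo S"
    and orb: "\<And>x. x \<in> X \<Longrightarrow> \<exists>i j. (T ^^ i) (S x) = (T ^^ j) x"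
    and m: "m \<in> means T" and A: "A \<in> Cl"
  shows "m (S ` A) = m A"
proof -
  have le: "m B \<le> m (S ` B)" if "B \<in> Cl" for B
    using orbit_mean_le[OF T S orb m that] .
  have "S ` (X - A) = X - S ` A"
    using image_set_diff[OF homeo_inj[OF S]] homeo_X[OF S] by metis
  then have "m (X - A) \<le> m (X - S ` A)" using le[OF compl_sets[OF A]] by simp
  moreover have "m (X - A) = m X - m A" using means_Diff[OF m top A Cl_subset[OF A]] .
  moreover have "m (X - S ` A) = m X - m (S ` A)"
    using means_Diff[OF m top homeo_image[OF S A] Cl_subset[OF homeo_image[OF S A]]] .
  ultimately show ?thesis using le[OF A] by simp
qed

subsection \<open>Locally constant functions and towers\<close>

definition locally_constant :: "('a \<Rightarrow> 'c) \<Rightarrow> bool" where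
  "locally_constant f \<longleftrightarrow> (\<forall>v. {x\<in>X. f x = v} \<in> Cl)"

lemma lcD: "locally_constant f \<Longrightarrow> {x\<in>X. f x = v} \<in> Cl"
  by (simp add: locally_constant_def)

lemma locally_constant_finite_cover:
  assumes "\<And>x. x \<in> X \<Longrightarrow> \<exists>U\<in>Cl. x \<in> U \<and> (\<forall>y\<in>U. f y = f x)"
  shows "\<exists>J U. finite J \<and> J \<subseteq> X \<and> X = (\<Union>x\<in>J. U x) \<and> (\<forall>x\<in>J. U x \<in> Cl \<and> (\<forall>y\<in>U x. f y = f x))"
proof -
  obtain U where U: "\<And>x. x \<in> X \<Longrightarrow> U x \<in> Cl \<and> x \<in> U x \<and> (\<forall>y\<in>U x. f y = f x)"
    using assms by metis
  then have "X \<subseteq> (\<Union>x\<in>X. U x)" by blast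
  then obtain J where J: "J \<subseteq> X" "finite J" "X \<subseteq> (\<Union>x\<in>J. U x)"
    using cover_index[of X U] U by metis
  moreover have "(\<Union>x\<in>J. U x) \<subseteq> X"
    using U J(1) Cl_subset by (meson UN_least subsetD)
  ultimately show ?thesis using U by (intro exI[of _ J] exI[of _ U]) (simp add: subset_antisym subset_iff)
qed

lemma lcI:
  assumes "\<And>x. x \<in> X \<Longrightarrow> \<exists>U\<in>Cl. x \<in> U \<and> (\<forall>y\<in>U. f y = f x)"
  shows "locally_constant f"
  unfolding locally_constant_def
proof
  fix v
  obtain J U where J: "finite J" "X = (\<Union>x\<in>J. U x)" "\<And>x. x \<in> J \<Longrightarrow> U x \<in> Cl"
    "\<And>x y. x \<in> J \<Longrightarrow> y \<in> U x \<Longrightarrow> f y = f x"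
    using locally_constant_finite_cover[of f] assms by metis
  have "{x\<in>X. f x = v} = (\<Union>x\<in>{x\<in>J. f x = v}. U x)"
    using J(4) unfolding J(2) by auto
  moreover have "(\<Union>x\<in>{x\<in>J. f x = v}. U x) \<in> Cl"
    by (rule finite_UN) (use J(1,3) in simp_all)
  ultimately show "{x\<in>X. f x = v} \<in> Cl" by simp
qed

lemma locally_constant_nbhd: "locally_constant f \<Longrightarrow> x \<in> X \<Longrightarrow> \<exists>U\<in>Cl. x \<in> U \<and> (\<forall>y\<in>U. f y = f x)"
  by (rule bexI[OF _ lcD[of f "f x"]]) auto

lemma locally_constant_finite_range:
  assumes "locally_constant f" shows "finite (f ` X)"
proof -
  obtain J U where J: "finite J" "X = (\<Union>x\<in>J. U x)" "\<And>x y. x \<in> J \<Longrightarrow> y \<in> U x \<Longrightarrow> f y = f x"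
    using locally_constant_finite_cover[of f] locally_constant_nbhd[OF assms] by metis
  then have "f ` X \<subseteq> f ` J" by blast
  then show ?thesis using J(1) finite_surj by blast
qed

lemma locally_constant_comp2:
  assumes f: "locally_constant f" and g: "locally_constant g"
  shows "locally_constant (\<lambda>x. F (f x) (g x))"
proof (rule lcI)
  fix x assume x: "x \<in> X"
  let ?U = "{y\<in>X. f y = f x} \<inter> {y\<in>X. g y = g x}"
  show "\<exists>U\<in>Cl. x \<in> U \<and> (\<forall>y\<in>U. F (f y) (g y) = F (f x) (g x))"
    by (rule bexI[OF _ Int[OF lcD[OF f, of "f x"] lcD[OF g, of "g x"]]]) (use x in auto)
qed

text \<open>Near \<open>x\<close> the parameter \<open>f x\<close> is frozen and only one of the
  functions \<open>G v\<close> is seen. This serves for words whose length varies with the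
  point.\<close>

lemma locally_constant_dep:
  assumes f: "locally_constant f" and G: "\<And>v. locally_constant (G v)"
  shows "locally_constant (\<lambda>x. G (f x) x)"
proof (rule lcI)
  fix x assume x: "x \<in> X"
  show "\<exists>U\<in>Cl. x \<in> U \<and> (\<forall>y\<in>U. G (f y) y = G (f x) x)"
    by (rule bexI[OF _ Int[OF lcD[OF f, of "f x"] lcD[OF G, of "f x" "G (f x) x"]]]) (use x in auto)
qed

lemma locally_constant_homeo:
  assumes f: "locally_constant f" and h: "homeo h"
  shows "locally_constant (\<lambda>x. f (h x))"
  unfolding locally_constant_def
proof
  fix v
  have "{x\<in>X. f (h x) = v} = h -` {x\<in>X. f x = v}" using homeo_mem[OF h] by auto
  then show "{x\<in>X. f (h x) = v} \<in> Cl" using homeo_vimage[OF h lcD[OF f]] by simp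
qed

lemma locally_constant_const: "locally_constant (\<lambda>x. k)"
  unfolding locally_constant_def
proof
  show "{x\<in>X. k = v} \<in> Cl" for v by (cases "k = v") simp_all
qed

lemma locally_constant_map:
  assumes "\<And>j. locally_constant (G j)"
  shows "locally_constant (\<lambda>x. map (\<lambda>j. G j x) xs)"
  by (induction xs) (auto simp: locally_constant_const intro: locally_constant_comp2[OF assms, where F = "(#)"])

lemma locally_constant_mem: "A \<in> Cl \<Longrightarrow> locally_constant (\<lambda>x. x \<in> A)"
  unfolding locally_constant_def using Collect_iff_in by blast

lemma locally_constant_members:
  assumes "finite \<D>" "\<D> \<subseteq> Cl"
  shows "locally_constant (\<lambda>x. {D\<in>\<D>. x \<in> D})"
proof (rule lcI)
  fix x assume x: "x \<in> X"
  let ?U = "X \<inter> (\<Inter>D\<in>\<D>. {y\<in>X. y \<in> D \<longleftrightarrow> x \<in> D})"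
  have U: "?U \<in> Cl"
    by (rule INT_in[OF assms(1) Collect_iff_in]) (rule subsetD[OF assms(2)])
  have "{D\<in>\<D>. y \<in> D} = {D\<in>\<D>. x \<in> D}" if y: "y \<in> ?U" for y
  proof (rule Collect_cong, rule conj_cong[OF refl])
    show "y \<in> D \<longleftrightarrow> x \<in> D" if "D \<in> \<D>" for D using y that by simp
  qed
  then have const: "\<forall>y\<in>?U. {D\<in>\<D>. y \<in> D} = {D\<in>\<D>. x \<in> D}" by (rule ballI)
  have "x \<in> ?U" using x by simp
  then show "\<exists>U\<in>Cl. x \<in> U \<and> (\<forall>y\<in>U. {D\<in>\<D>. y \<in> D} = {D\<in>\<D>. x \<in> D})"
    by (intro bexI[OF _ U] conjI const)
qed

text \<open>Near \<open>x\<close> only the predicates up to the least index matter, and finitely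
  many of them are constant on a common neighbourhood.\<close>

lemma locally_constant_Least:
  fixes P :: "nat \<Rightarrow> 'a \<Rightarrow> bool"
  assumes P: "\<And>k. locally_constant (P k)" and ex: "\<And>x. x \<in> X \<Longrightarrow> \<exists>k. P k x"
  shows "locally_constant (\<lambda>x. LEAST k. P k x)"
proof (rule lcI)
  fix x assume x: "x \<in> X"
  define v where "v = (LEAST k. P k x)"
  have v: "P v x" "\<And>k. k < v \<Longrightarrow> \<not> P k x"
    unfolding v_def by (rule LeastI_ex[OF ex[OF x]], rule not_less_Least)
  have U: "X \<inter> (\<Inter>k\<in>{..v}. {y\<in>X. P k y = P k x}) \<in> Cl" (is "?U \<in> Cl")
    by (rule INT_in) (simp_all add: lcD[OF P])
  have const: "(LEAST k. P k y) = (LEAST k. P k x)" if y: "y \<in> ?U" for y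
    unfolding v_def[symmetric]
  proof (rule Least_equality)
    have *: "P k y = P k x" if "k \<le> v" for k using y that by simp
    show "P v y" using * v(1) by simp
    show "v \<le> k" if "P k y" for k using *[of k] v(2)[of k] that by (meson less_imp_le not_le)
  qed
  have "x \<in> ?U" using x by simp
  then show "\<exists>U\<in>Cl. x \<in> U \<and> (\<forall>y\<in>U. (LEAST k. P k y) = (LEAST k. P k x))"
    by (intro bexI[OF _ U] conjI ballI const)
qed

text \<open>A label is the height of a point in its tower over \<open>Y\<close> together with the name of the tower.\<close>

definition tower_label :: "('a \<Rightarrow> 'a) \<Rightarrow> 'a set \<Rightarrow> ('a \<Rightarrow> nat \<times> 'c) \<Rightarrow> bool" where
  "tower_label S Y L \<longleftrightarrow> locally_constant L \<and> (\<forall>x\<in>X. x \<in> Y \<longleftrightarrow> fst (L x) = 0) \<and>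
     (\<forall>x\<in>X. S x \<notin> Y \<longrightarrow> fst (L (S x)) = Suc (fst (L x))) \<and>
     (\<forall>x\<in>X. \<forall>y\<in>X. S x \<notin> Y \<longrightarrow> L x = L y \<longrightarrow> S y \<notin> Y \<and> L (S x) = L (S y)) \<and>
     (\<forall>x\<in>X. \<forall>y\<in>X. S x \<notin> Y \<longrightarrow> S y \<notin> Y \<longrightarrow> L (S x) = L (S y) \<longrightarrow> L x = L y)"

lemma tower_labelD:
  assumes "tower_label S Y L" "x \<in> X"
  shows "x \<in> Y \<longleftrightarrow> fst (L x) = 0"
    and "S x \<notin> Y \<Longrightarrow> fst (L (S x)) = Suc (fst (L x))"
    and "y \<in> X \<Longrightarrow> S x \<notin> Y \<Longrightarrow> L x = L y \<Longrightarrow> S y \<notin> Y"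
    and "y \<in> X \<Longrightarrow> S x \<notin> Y \<Longrightarrow> L x = L y \<Longrightarrow> L (S x) = L (S y)"
    and "y \<in> X \<Longrightarrow> S x \<notin> Y \<Longrightarrow> S y \<notin> Y \<Longrightarrow> L (S x) = L (S y) \<Longrightarrow> L x = L y"
  using assms unfolding tower_label_def by blast+

text \<open>The return-time towers over \<open>Y\<close> are refined by the colours read along a
  whole tower. Here \<open>r\<close> is the height above the last visit to \<open>Y\<close>,
  \<open>s\<close> the number of levels still above, and \<open>w\<close> the word of colours from
  base to top. Climbing changes only \<open>r\<close>; the length of \<open>w\<close> recovers
  \<open>s\<close>, so equal labels reach the top together, and the entry of \<open>w\<close> at
  \<open>r\<close> is the colour of the point.\<close>

lemma tower_label_exists:
  fixes c :: "'a \<Rightarrow> 'c"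
  assumes S: "minimal S" and Y: "Y \<in> Cl" "Y \<noteq> {}" and c: "locally_constant c"
  shows "\<exists>L :: 'a \<Rightarrow> nat \<times> 'c list. tower_label S Y L \<and> (\<forall>x\<in>X. \<forall>y\<in>X. L x = L y \<longrightarrow> c x = c y)"
proof -
  note h = minimal_homeo[OF S]
  note hi = homeo_inv[OF h]
  define r where "r x = (LEAST k. (inv S ^^ k) x \<in> Y)" for x
  define s where "s x = (LEAST k. (S ^^ Suc k) x \<in> Y)" for x
  define w where "w x = map (\<lambda>j. c ((S ^^ j) ((inv S ^^ r x) x))) [0..<Suc (r x + s x)]" for x
  define L where "L x = (r x, w x)" for x
  have r_ex: "\<exists>k. (inv S ^^ k) x \<in> Y" if x: "x \<in> X" for x
    using minimal_hit[OF minimal_inv[OF S] Y] x by blast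
  have s_ex: "\<exists>k. (S ^^ Suc k) x \<in> Y" if x: "x \<in> X" for x
    using minimal_hit[OF S Y] x by (metis gr0_implies_Suc)
  have locally_constant_r: "locally_constant r"
    unfolding r_def by (rule locally_constant_Least[OF locally_constant_homeo[OF locally_constant_mem[OF Y(1)] homeo_funpow[OF hi]] r_ex])
  have locally_constant_s: "locally_constant s"
    unfolding s_def by (rule locally_constant_Least[OF locally_constant_homeo[OF locally_constant_mem[OF Y(1)] homeo_funpow[OF h]] s_ex])
  have "locally_constant (\<lambda>x. (\<lambda>p x. map (\<lambda>j. c ((S ^^ j) ((inv S ^^ fst p) x))) [0..<Suc (fst p + snd p)]) (r x, s x) x)"
    by (rule locally_constant_dep[OF locally_constant_comp2[OF locally_constant_r locally_constant_s] locally_constant_map])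
      (rule locally_constant_homeo[OF locally_constant_homeo[OF c homeo_funpow[OF h]] homeo_funpow[OF hi]])
  then have locally_constant_w: "locally_constant w" by (simp add: w_def[abs_def])
  have locally_constant_L: "locally_constant L" unfolding L_def[abs_def] by (rule locally_constant_comp2[OF locally_constant_r locally_constant_w])
  have r0: "r x = 0 \<longleftrightarrow> x \<in> Y" if x: "x \<in> X" for x
    using LeastI_ex[OF r_ex[OF x]] Least_eq_0[of "\<lambda>k. (inv S ^^ k) x \<in> Y"] by (auto simp: r_def)
  have s0: "s x = 0 \<longleftrightarrow> S x \<in> Y" if x: "x \<in> X" for x
    using LeastI_ex[OF s_ex[OF x]] Least_eq_0[of "\<lambda>k. (S ^^ Suc k) x \<in> Y"] by (auto simp: s_def)
  have rS: "r (S x) = Suc (r x)" if x: "x \<in> X" "S x \<notin> Y" for x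
  proof -
    obtain n where n: "(inv S ^^ n) (S x) \<in> Y" using r_ex[of "S x"] homeo_mem[OF h] x by blast
    show ?thesis
      using Least_Suc[of "\<lambda>k. (inv S ^^ k) (S x) \<in> Y" n, OF n] x(2) unfolding r_def funpow_inv_app[OF h]
      by simp
  qed
  have sS: "s x = Suc (s (S x))" if x: "x \<in> X" "S x \<notin> Y" for x
  proof -
    obtain n where n: "(S ^^ Suc n) x \<in> Y" using s_ex x by blast
    have "(S ^^ Suc (Suc m)) x = (S ^^ Suc m) (S x)" for m by (simp add: funpow_swap1)
    then show ?thesis
      using Least_Suc[of "\<lambda>k. (S ^^ Suc k) x \<in> Y" n, OF n] x(2) unfolding s_def by simp
  qed
  have wS: "w (S x) = w x" if x: "x \<in> X" "S x \<notin> Y" for x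
    unfolding w_def rS[OF x] sS[OF x] funpow_inv_app[OF h] by simp
  have length_w: "length (w x) = Suc (r x + s x)" for x by (simp add: w_def)
  have c_eq: "c x = w x ! r x" for x
    unfolding w_def by (subst nth_map) (simp_all add: nth_append funpow_inv_cancel[OF h] del: upt_Suc)
  have s_eq: "s x = s y" if "L x = L y" for x y
    using that length_w[of x] length_w[of y] by (simp add: L_def)
  have "tower_label S Y L"
    unfolding tower_label_def
  proof (intro conjI ballI impI)
    show "locally_constant L" by (rule locally_constant_L)
    fix x assume x: "x \<in> X"
    show "(x \<in> Y) = (fst (L x) = 0)" using r0[OF x] by (simp add: L_def)
    assume Sx: "S x \<notin> Y"
    show "fst (L (S x)) = Suc (fst (L x))" using rS[OF x Sx] by (simp add: L_def)
    fix y assume y: "y \<in> X"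
    show "S y \<notin> Y" if "L x = L y" using s_eq[OF that] s0[OF x] s0[OF y] Sx by simp
    then show "L (S x) = L (S y)" if "L x = L y"
      using that rS wS x y Sx by (simp add: L_def)
    show "L x = L y" if "S y \<notin> Y" "L (S x) = L (S y)"
      using that rS wS x y Sx by (simp add: L_def)
  qed
  moreover have "\<forall>x\<in>X. \<forall>y\<in>X. L x = L y \<longrightarrow> c x = c y"
    unfolding c_eq by (simp add: L_def)
  ultimately show ?thesis by blast
qed

section \<open>Fibres of a label: the levels of the towers\<close>

definition fibre :: "('a \<Rightarrow> 'c) \<Rightarrow> 'a \<Rightarrow> 'a set" where
  "fibre L x = {y\<in>X. L y = L x}"

lemma fibre_in: "locally_constant L \<Longrightarrow> fibre L x \<in> Cl"
  by (simp add: fibre_def lcD)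

lemma fibre_self: "x \<in> X \<Longrightarrow> x \<in> fibre L x"
  by (simp add: fibre_def)

lemma iso_on_fibres:
  assumes L: "locally_constant L" and iso: "\<And>x. x \<in> X \<Longrightarrow> iso_on T (fibre L x) (fibre L x) f"
  shows "iso_on T X X f"
proof -
  have "iso_on T (\<Union>v\<in>L ` X. {y\<in>X. L y = v}) (\<Union>v\<in>L ` X. {y\<in>X. L y = v}) f"
  proof (rule iso_on_UN[OF locally_constant_finite_range[OF L]])
    fix v assume "v \<in> L ` X"
    then obtain x where "x \<in> X" "v = L x" by blast
    then show "iso_on T {y\<in>X. L y = v} {y\<in>X. L y = v} f" using iso[of x] by (simp add: fibre_def)
  qed (auto simp: disjoint_family_on_def)
  moreover have "(\<Union>v\<in>L ` X. {y\<in>X. L y = v}) = X" by auto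
  ultimately show ?thesis by simp
qed

lemma iso_on_homeo:
  assumes S: "homeo S" and pres: "\<And>m A. m \<in> means T \<Longrightarrow> A \<in> Cl \<Longrightarrow> m (S ` A) = m A" and A: "A \<in> Cl"
  shows "iso_on T A (S ` A) S"
  unfolding iso_on_def
  using homeo_image_iff[OF S] pres A inj_on_imp_bij_betw[OF inj_on_subset[OF homeo_inj[OF S] subset_UNIV]]
  by simp

text \<open>For surjectivity, the positive height of the target level keeps its points out of
  \<open>Y\<close>, and then their labels determine those of their predecessors.\<close>

lemma fibre_image:
  assumes S: "homeo S" and L: "tower_label S Y L" and x: "x \<in> X" "S x \<notin> Y"
  shows "S ` fibre L x = fibre L (S x)"
proof
  show "S ` fibre L x \<subseteq> fibre L (S x)"
  proof
    fix z assume "z \<in> S ` fibre L x"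
    then obtain y where y: "y \<in> X" "L x = L y" "z = S y" by (auto simp: fibre_def)
    have "L (S x) = L (S y)" using tower_labelD(4)[OF L x(1) y(1) x(2) y(2)] .
    then show "z \<in> fibre L (S x)" using y homeo_mem[OF S] by (simp add: fibre_def)
  qed
  show "fibre L (S x) \<subseteq> S ` fibre L x"
  proof
    fix z assume z: "z \<in> fibre L (S x)"
    let ?y = "inv S z"
    have y: "?y \<in> X" "S ?y = z"
      using z homeo_mem[OF homeo_inv[OF S]] app_inv[OF S] by (auto simp: fibre_def)
    have SxX: "S x \<in> X" using homeo_mem[OF S] x(1) by simp
    have "fst (L (S x)) \<noteq> 0" using tower_labelD(1)[OF L SxX] x(2) by simp
    then have "fst (L z) \<noteq> 0" using z by (simp add: fibre_def)
    then have "S ?y \<notin> Y" using tower_labelD(1)[OF L, of z] z y(2) by (simp add: fibre_def)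
    moreover have "L (S x) = L (S ?y)" using z y(2) by (simp add: fibre_def)
    ultimately have "L x = L ?y" using tower_labelD(5)[OF L x(1) y(1) x(2)] by simp
    then have "?y \<in> fibre L x" using y(1) by (simp add: fibre_def)
    then show "z \<in> S ` fibre L x" using y(2) by (metis image_eqI)
  qed
qed

lemma fibre_cong: "L x = L y \<Longrightarrow> fibre L x = fibre L y"
  by (simp add: fibre_def)

lemma iso_on_fibre_shift:
  assumes S: "homeo S" and pres: "\<And>m A. m \<in> means T \<Longrightarrow> A \<in> Cl \<Longrightarrow> m (S ` A) = m A"
    and L: "tower_label S Y L" and x: "x \<in> X" "S x \<notin> Y"
  shows "iso_on T (fibre L x) (fibre L (S x)) S"
  using iso_on_homeo[OF S pres fibre_in[of L x]] fibre_image[OF S L x] L by (simp add: tower_label_def)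

lemma iso_on_fibre_funpow:
  assumes S: "homeo S" and pres: "\<And>m A. m \<in> means T \<Longrightarrow> A \<in> Cl \<Longrightarrow> m (S ` A) = m A"
    and L: "tower_label S Y L" and x: "x \<in> X" and out: "\<And>k. k < n \<Longrightarrow> (S ^^ Suc k) x \<notin> Y"
  shows "iso_on T (fibre L x) (fibre L ((S ^^ n) x)) (S ^^ n) \<and> fst (L ((S ^^ n) x)) = n + fst (L x)"
  using out
proof (induction n)
  case 0
  then show ?case using iso_on_id[OF fibre_in[of L x]] L by (simp add: tower_label_def id_def)
next
  case (Suc n)
  have IH: "iso_on T (fibre L x) (fibre L ((S ^^ n) x)) (S ^^ n)" "fst (L ((S ^^ n) x)) = n + fst (L x)"
    using Suc by simp_all
  have z: "(S ^^ n) x \<in> X" using homeo_mem[OF homeo_funpow[OF S]] x by simp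
  have Sz: "S ((S ^^ n) x) \<notin> Y" using Suc.prems[of n] by simp
  have "iso_on T (fibre L x) (fibre L (S ((S ^^ n) x))) (\<lambda>y. S ((S ^^ n) y))"
    by (rule iso_on_comp[OF IH(1) iso_on_fibre_shift[OF S pres L z Sz]])
  moreover have "S ^^ Suc n = (\<lambda>y. S ((S ^^ n) y))" by auto
  moreover have "fst (L (S ((S ^^ n) x))) = Suc (fst (L ((S ^^ n) x)))"
    using tower_labelD(2)[OF L z Sz] .
  ultimately show ?case using IH(2) by simp
qed

section \<open>Maps defined tower by tower\<close>

text \<open>The map that is \<open>\<phi>\<close> on the base and intertwines \<open>S\<close> with
  \<open>R\<close> along each tower (\<open>tower_map_shift\<close>).\<close>

definition tower_map :: "('a \<Rightarrow> 'a) \<Rightarrow> ('a \<Rightarrow> 'a) \<Rightarrow> ('a \<Rightarrow> 'a) \<Rightarrow> ('a \<Rightarrow> nat \<times> 'c) \<Rightarrow> 'a \<Rightarrow> 'a" where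
  "tower_map S R \<phi> L x = (R ^^ fst (L x)) (\<phi> ((inv S ^^ fst (L x)) x))"

lemma tower_map_shift:
  assumes "homeo S" "tower_label S Y L" "x \<in> X" "S x \<notin> Y"
  shows "tower_map S R \<phi> L (S x) = R (tower_map S R \<phi> L x)"
proof -
  have "fst (L (S x)) = Suc (fst (L x))" using tower_labelD(2)[OF assms(2-4)] .
  then show ?thesis using funpow_inv_app[OF assms(1)] by (simp add: tower_map_def del: funpow.simps(2))
    (simp add: funpow_swap1 inv_app[OF assms(1)])
qed

text \<open>Induction on the height: on a level the map is \<open>R\<close> after the map of the
  level below after the inverse of \<open>S\<close>.\<close>

lemma tower_map_iso:
  assumes S: "homeo S" and pres: "\<And>m A. m \<in> means T \<Longrightarrow> A \<in> Cl \<Longrightarrow> m (S ` A) = m A"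
    and L: "tower_label S Y L"
    and R: "\<And>x. x \<in> X \<Longrightarrow> S x \<notin> Y \<Longrightarrow> iso_on T (fibre L x) (fibre L (S x)) R"
    and \<phi>: "\<And>x. x \<in> X \<Longrightarrow> x \<in> Y \<Longrightarrow> iso_on T (fibre L x) (fibre L x) \<phi>"
    and x: "x \<in> X"
  shows "iso_on T (fibre L x) (fibre L x) (tower_map S R \<phi> L)"
  using x
proof (induction "fst (L x)" arbitrary: x)
  case 0
  have "tower_map S R \<phi> L y = \<phi> y" if "y \<in> fibre L x" for y
    using that 0(1)[symmetric] by (simp add: fibre_def tower_map_def)
  moreover have "x \<in> Y" using tower_labelD(1)[OF L 0(2)] 0(1) by simp
  ultimately show ?case
    using \<phi>[OF 0(2)] iso_on_cong[of "fibre L x" "tower_map S R \<phi> L" \<phi>] by simp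
next
  case (Suc n)
  define z where "z = inv S x"
  have z: "z \<in> X" "S z = x"
    using Suc.prems homeo_mem[OF homeo_inv[OF S]] app_inv[OF S] by (auto simp: z_def)
  have Sz: "S z \<notin> Y" using tower_labelD(1)[OF L Suc.prems] Suc.hyps(2) z(2) by simp
  have "n = fst (L z)" using tower_labelD(2)[OF L z(1) Sz] Suc.hyps(2) z(2) by simp
  then have IH: "iso_on T (fibre L z) (fibre L z) (tower_map S R \<phi> L)" by (rule Suc.hyps(1)[OF _ z(1)])
  note shift = iso_on_fibre_shift[OF S pres L z(1) Sz]
  have "iso_on T (fibre L (S z)) (fibre L (S z)) (\<lambda>y. R (tower_map S R \<phi> L (inv_into (fibre L z) S y)))"
    by (rule iso_on_comp[OF iso_on_comp[OF iso_on_inv[OF shift] IH] R[OF z(1) Sz]])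
  moreover have "R (tower_map S R \<phi> L (inv_into (fibre L z) S y)) = tower_map S R \<phi> L y"
    if y: "y \<in> fibre L (S z)" for y
  proof -
    obtain v where v: "v \<in> fibre L z" "y = S v" using y fibre_image[OF S L z(1) Sz] by blast
    have "inv_into (fibre L z) S y = v"
      using v inv_into_f_f[OF iso_onD(4)[OF shift]] by simp
    moreover have "v \<in> X" using v(1) by (simp add: fibre_def)
    moreover have "S v \<notin> Y" using tower_labelD(3)[OF L z(1) _ Sz, of v] v(1) by (simp add: fibre_def)
    ultimately show ?thesis using tower_map_shift[OF S L] v(2) by simp
  qed
  ultimately have "iso_on T (fibre L (S z)) (fibre L (S z)) (tower_map S R \<phi> L)"
    by (subst (asm) iso_on_cong)
  then show ?case by (simp add: z(2))
qed

lemma homeo_extend_bij: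
  assumes bij: "bij_betw f X X" and vimage: "\<And>A. A \<in> Cl \<Longrightarrow> {x\<in>X. f x \<in> A} \<in> Cl"
    and image: "\<And>A. A \<in> Cl \<Longrightarrow> f ` A \<in> Cl"
  shows "homeo (\<lambda>x. if x \<in> X then f x else x)"
proof -
  let ?g = "\<lambda>x. if x \<in> X then f x else x"
  have im: "f ` X = X" and inj: "inj_on f X" using bij by (simp_all add: bij_betw_def)
  have mem: "?g x \<in> X \<longleftrightarrow> x \<in> X" for x using im by auto
  have "bij_betw ?g X X" using bij by (subst bij_betw_cong[of X ?g f]) auto
  moreover have "bij_betw ?g (-X) (-X)" by (subst bij_betw_cong[of "-X" ?g id]) auto
  ultimately have "bij ?g" using bij_betw_combine[of ?g X X "-X" "-X"] by (simp add: Compl_partition)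
  moreover have "?g ` U \<in> Cl \<longleftrightarrow> U \<in> Cl" for U
  proof (cases "U \<subseteq> X")
    case True
    then have "?g ` U = f ` U" by (intro image_cong) auto
    moreover have "U \<in> Cl" if "f ` U \<in> Cl"
    proof -
      have "{x\<in>X. f x \<in> f ` U} = U" using inj True by (auto simp: inj_on_def)
      then show ?thesis using vimage[OF that] by simp
    qed
    ultimately show ?thesis using image by auto
  next
    case False
    then have "\<not> ?g ` U \<subseteq> X" using mem by blast
    then show ?thesis using False Cl_subset by blast
  qed
  ultimately show ?thesis by (simp add: homeo_def)
qed

lemma homeo_extend:
  assumes f: "iso_on T X X f"
  shows "homeo (\<lambda>x. if x \<in> X then f x else x)"
proof (rule homeo_extend_bij[OF iso_onD(3)[OF f]])
  fix A assume A: "A \<in> Cl"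
  show "f ` A \<in> Cl" using iso_onD(6)[OF f Cl_subset[OF A]] A by simp
  have "f ` {x\<in>X. f x \<in> A} \<in> Cl \<longleftrightarrow> {x\<in>X. f x \<in> A} \<in> Cl" by (rule iso_onD(6)[OF f]) blast
  moreover have "f ` {x\<in>X. f x \<in> A} = f ` X \<inter> A" by auto
  moreover have "f ` X \<inter> A = A" unfolding iso_onD(5)[OF f] by (rule Int_absorb1[OF Cl_subset[OF A]])
  ultimately show "{x\<in>X. f x \<in> A} \<in> Cl" using A by (simp only:)
qed

lemma iso_on_X_inv:
  assumes h: "homeo h" and iso: "iso_on T X X h"
  shows "iso_on T X X (inv h)"
proof -
  have "inv_into X h y = inv h y" if y: "y \<in> X" for y
  proof -
    have "inv h y \<in> X" "h (inv h y) = y" using homeo_mem[OF homeo_inv[OF h]] app_inv[OF h] y by auto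
    then show ?thesis using inv_into_f_f[OF iso_onD(4)[OF iso], of "inv h y"] by simp
  qed
  then show ?thesis using iso_on_inv[OF iso] iso_on_cong by metis
qed

section \<open>Approximate speedups and their refinement\<close>

definition partial_speedup :: "('a \<Rightarrow> 'a) \<Rightarrow> ('a \<Rightarrow> 'a) \<Rightarrow> 'a set \<Rightarrow> ('a \<Rightarrow> 'a) \<Rightarrow> bool" where
  "partial_speedup T S Y h \<longleftrightarrow> homeo h \<and> iso_on T X X h \<and>
     (\<forall>x\<in>X. S x \<notin> Y \<longrightarrow> (\<exists>p>0. h (S x) = (T ^^ p) (h x)))"

text \<open>\<open>R\<close> equals \<open>S\<close> where \<open>h\<close> already yields positive
  powers. On levels leading into \<open>Y - Y'\<close> it is a forward isomorphism between the
  \<open>h\<close>-images of consecutive levels, pulled back by \<open>h\<close>; it exists because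
  \<open>h\<close> and \<open>S\<close> preserve means. So \<open>h (R x)\<close> is a positive
  power of \<open>T\<close> at \<open>h x\<close> whenever \<open>S x \<notin> Y'\<close>. A tower
  map \<open>g\<close> satisfies \<open>g (S x) = R (g x)\<close> there, which makes
  \<open>h \<circ> g\<close> the refined approximation, and it preserves every level, hence every
  set in \<open>\<D>\<close>.\<close>

lemma speedup_step:
  assumes T: "minimal T" and S: "minimal S"
    and pres: "\<And>m A. m \<in> means T \<Longrightarrow> A \<in> Cl \<Longrightarrow> m (S ` A) = m A"
    and ps: "partial_speedup T S Y h" and Y: "Y \<in> Cl"
    and Y': "Y' \<in> Cl" "Y' \<subseteq> Y" "y \<in> Y'"
    and D: "finite \<D>" "\<D> \<subseteq> Cl"
  shows "\<exists>g. homeo g \<and> partial_speedup T S Y' (h \<circ> g) \<and> (\<forall>D\<in>\<D>. g ` D = D) \<and>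
    g y = y \<and> g (inv S y) = inv S y \<and> (\<forall>x\<in>X. S x \<notin> Y \<longrightarrow> g (S x) = S (g x))"
proof -
  note hS = minimal_homeo[OF S]
  note hSi = homeo_inv[OF hS]
  have h: "homeo h" "iso_on T X X h"
    and h_fwd: "\<And>x. x \<in> X \<Longrightarrow> S x \<notin> Y \<Longrightarrow> \<exists>p>0. h (S x) = (T ^^ p) (h x)"
    using ps by (auto simp: partial_speedup_def)
  have yX: "y \<in> X" using Y' Cl_subset by blast
  define u where "u = inv S y"
  have u: "u \<in> X" "S u = y"
    using yX homeo_mem[OF hSi] app_inv[OF hS] by (simp_all add: u_def)
  \<comment> \<open>\<open>u\<close> is the top of its tower because \<open>S u = y\<close> is in
    \<open>Y'\<close>. The point \<open>b\<close> below is the base point under \<open>u\<close>; it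
    differs from \<open>y\<close> by aperiodicity, as it precedes \<open>y\<close> by
    \<open>Suc n\<close> steps.\<close>
  define n where "n = (LEAST k. (inv S ^^ k) u \<in> Y')"
  have ex: "\<exists>k. (inv S ^^ k) u \<in> Y'"
    using minimal_hit[OF minimal_inv[OF S] Y'(1)] Y'(3) u(1) by blast
  have n: "(inv S ^^ n) u \<in> Y'" "\<And>k. k < n \<Longrightarrow> (inv S ^^ k) u \<notin> Y'"
    unfolding n_def by (rule LeastI_ex[OF ex], rule not_less_Least)
  define b where "b = (inv S ^^ n) u"
  have b: "b \<in> X" "b \<in> Y'" "(S ^^ n) b = u"
    using n(1) u(1) homeo_mem[OF homeo_funpow[OF hSi]] funpow_inv_cancel[OF hS] by (simp_all add: b_def)
  have "(inv S ^^ Suc n) y = b" by (simp add: b_def u_def funpow_swap1)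
  then have "b \<noteq> y" using aperiodic[OF minimal_inv[OF S] yX, of "Suc n"] by auto
  then obtain W where W: "W \<in> Cl" "y \<in> W" "b \<notin> W" using separate_point[OF yX b(1)] by metis
  \<comment> \<open>The levels must refine \<open>Y\<close>, to have one case of \<open>R\<close> on
    each level; \<open>W\<close>, to put \<open>y\<close> and \<open>b\<close> on different levels;
    and \<open>\<D>\<close>, to let \<open>g\<close> preserve its members.\<close>
  define \<D>' where "\<D>' = insert Y (insert W \<D>)"
  define c where "c x = {D\<in>\<D>'. x \<in> D}" for x
  have "locally_constant c" unfolding c_def[abs_def] by (rule locally_constant_members) (use D Y W in \<open>auto simp: \<D>'_def\<close>)
  then obtain L :: "'a \<Rightarrow> nat \<times> 'a set set list" where L: "tower_label S Y' L"
    and Lc: "\<forall>x\<in>X. \<forall>y\<in>X. L x = L y \<longrightarrow> c x = c y"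
    using tower_label_exists[OF S Y'(1)] Y'(3) by blast
  have L_lc: "locally_constant L" using L by (simp add: tower_label_def)
  have same: "x \<in> D \<longleftrightarrow> x' \<in> D" if "x \<in> X" "x' \<in> X" "L x = L x'" "D \<in> \<D>'" for x x' D
  proof -
    have "c x = c x'" using Lc that(1-3) by blast
    then show ?thesis using that(4) by (auto simp: c_def)
  qed
  \<comment> \<open>The choice depends only on the level as a set, so that all its points use the
    same isomorphism.\<close>
  define G where "G F = (SOME f. fwd_iso T (h ` F) (h ` S ` F) f)" for F
  have G: "fwd_iso T (h ` fibre L x) (h ` S ` fibre L x) (G (fibre L x))" if x: "x \<in> X" for x
  proof -
    have F: "fibre L x \<in> Cl" "S ` fibre L x \<in> Cl"
      using fibre_in[OF L_lc] homeo_image[OF hS] by simp_all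
    have "\<exists>f. fwd_iso T (h ` fibre L x) (h ` S ` fibre L x) f"
    proof (rule fwd_iso_exists[OF T])
      fix m assume m: "m \<in> means T"
      show "m (h ` fibre L x) = m (h ` S ` fibre L x)"
        using iso_onD(7)[OF h(2) m F(1) Cl_subset[OF F(1)]] iso_onD(7)[OF h(2) m F(2) Cl_subset[OF F(2)]]
          pres[OF m F(1)] by simp
    qed (use fibre_self[OF x, of L] homeo_image[OF h(1)] F in auto)
    then show ?thesis unfolding G_def by (rule someI_ex)
  qed
  define R where "R x = (if S x \<notin> Y then S x else inv h (G (fibre L x) (h x)))" for x
  have R_iso: "iso_on T (fibre L x) (fibre L (S x)) R" if x: "x \<in> X" "S x \<notin> Y'" for x
  proof -
    have SY: "S x' \<in> Y \<longleftrightarrow> S x \<in> Y" if "x' \<in> fibre L x" for x'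
    proof (rule same)
      show "L (S x') = L (S x)"
        using tower_labelD(4)[OF L x(1) _ x(2), of x'] that by (simp add: fibre_def)
    qed (use that x homeo_mem[OF hS] in \<open>auto simp: fibre_def \<D>'_def\<close>)
    have Sfib: "S ` fibre L x = fibre L (S x)" by (rule fibre_image[OF hS L x])
    show ?thesis
    proof (cases "S x \<in> Y")
      case False
      then have "R x' = S x'" if "x' \<in> fibre L x" for x' using SY[OF that] by (simp add: R_def)
      then show ?thesis
        using iso_on_fibre_shift[OF hS pres L x] by (subst iso_on_cong)
    next
      case True
      have F: "fibre L x \<in> Cl" "fibre L (S x) \<in> Cl" using fibre_in[OF L_lc] by auto
      have i1: "iso_on T (fibre L x) (h ` fibre L x) h"
        by (rule iso_on_restrict[OF h(2) F(1) Cl_subset[OF F(1)]])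
      have i2: "iso_on T (h ` fibre L x) (h ` fibre L (S x)) (G (fibre L x))"
        using G[OF x(1)] Sfib by (simp add: fwd_iso_def)
      have hF: "h ` fibre L (S x) \<in> Cl" by (rule homeo_image[OF h(1) F(2)])
      have "inv h ` h ` fibre L (S x) = fibre L (S x)" using inv_app[OF h(1)] by (simp add: image_image)
      then have i3: "iso_on T (h ` fibre L (S x)) (fibre L (S x)) (inv h)"
        using iso_on_restrict[OF iso_on_X_inv[OF h] hF Cl_subset[OF hF]] by simp
      have "R x' = inv h (G (fibre L x) (h x'))" if "x' \<in> fibre L x" for x'
        using SY[OF that] True that fibre_cong[of L x' x] by (simp add: R_def fibre_def)
      then show ?thesis
        using iso_on_comp[OF iso_on_comp[OF i1 i2] i3] by (subst iso_on_cong)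
    qed
  qed
  have R_fwd: "\<exists>p>0. h (R x) = (T ^^ p) (h x)" if x: "x \<in> X" "S x \<notin> Y'" for x
  proof (cases "S x \<in> Y")
    case False then show ?thesis using h_fwd[OF x(1)] by (simp add: R_def)
  next
    case True
    then have "h (R x) = G (fibre L x) (h x)" by (simp add: R_def app_inv[OF h(1)])
    moreover have "h x \<in> h ` fibre L x" using fibre_self[OF x(1)] by blast
    ultimately show ?thesis using G[OF x(1)] unfolding fwd_iso_def by metis
  qed
  have out: "(S ^^ Suc k) b \<notin> Y'" if k: "k < n" for k
  proof -
    have "(S ^^ (n - Suc k)) ((S ^^ Suc k) b) = (S ^^ (n - Suc k + Suc k)) b"
      by (simp only: funpow_add comp_apply)
    also have "\<dots> = u" using k b(3) by simp
    finally have "(S ^^ Suc k) b = (inv S ^^ (n - Suc k)) u"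
      using inv_funpow_cancel[OF hS, of "n - Suc k" "(S ^^ Suc k) b"] by simp
    then show ?thesis using n(2)[of "n - Suc k"] k by simp
  qed
  have shift: "iso_on T (fibre L b) (fibre L u) (S ^^ n)" and Lu: "fst (L u) = n"
    using iso_on_fibre_funpow[where T = T and n = n, OF hS pres L b(1) out] b(3) tower_labelD(1)[OF L b(1)] b(2) by simp_all
  define g1 where "g1 = tower_map S R (\<lambda>x. x) L"
  have g1: "iso_on T (fibre L u) (fibre L u) g1"
    unfolding g1_def
    by (rule tower_map_iso[OF hS pres L R_iso iso_on_id[OF fibre_in[OF L_lc]] u(1)])
  text \<open>The towers are anchored at the base, except the one containing \<open>S\<^sup>-\<^sup>1 y\<close>, which is anchored
    at its top; \<open>y\<close> lies in the base of another tower because \<open>W\<close> separates it from \<open>b\<close>.\<close>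
  define \<phi> where "\<phi> x = (if x \<in> fibre L b then inv_into (fibre L b) (S ^^ n) (inv_into (fibre L u) g1 ((S ^^ n) x)) else x)" for x
  have \<phi>_b: "iso_on T (fibre L b) (fibre L b) \<phi>"
    using iso_on_comp[OF iso_on_comp[OF shift iso_on_inv[OF g1]] iso_on_inv[OF shift]]
    by (subst iso_on_cong) (auto simp: \<phi>_def)
  have \<phi>_iso: "iso_on T (fibre L x) (fibre L x) \<phi>" if "x \<in> X" "x \<in> Y'" for x
  proof (cases "L x = L b")
    case True then show ?thesis using \<phi>_b fibre_cong[of L x b] by simp
  next
    case False
    then have "\<phi> x' = x'" if "x' \<in> fibre L x" for x' using that by (simp add: \<phi>_def fibre_def)
    then show ?thesis using iso_on_id[OF fibre_in[OF L_lc]] by (subst iso_on_cong)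
  qed
  define g2 where "g2 = tower_map S R \<phi> L"
  have g2: "iso_on T (fibre L x) (fibre L x) g2" if "x \<in> X" for x
    unfolding g2_def by (rule tower_map_iso[OF hS pres L R_iso \<phi>_iso that])
  have g2_X: "iso_on T X X g2" by (rule iso_on_fibres[OF L_lc g2])
  have g2_y: "g2 y = y"
  proof -
    have "fst (L y) = 0" using tower_labelD(1)[OF L yX] Y'(3) by simp
    moreover have "y \<notin> fibre L b" using same[OF yX b(1), of W] W by (auto simp: fibre_def \<D>'_def)
    ultimately show ?thesis by (simp add: g2_def tower_map_def \<phi>_def)
  qed
  \<comment> \<open>On the level of \<open>u\<close>, \<open>g1\<close> is \<open>R ^^ n\<close>
    after the descent to the base. As \<open>\<phi>\<close> on the base is the inverse of
    \<open>g1\<close> conjugated by \<open>S ^^ n\<close>, the map \<open>g2\<close> on this level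
    is \<open>g1\<close> after its own inverse.\<close>
  have g2_u: "g2 u = u"
  proof -
    let ?t = "inv_into (fibre L u) g1 u"
    have t: "?t \<in> fibre L u" "g1 ?t = u"
      using iso_onD(5)[OF g1] fibre_self[OF u(1), of L] by (metis inv_into_into, metis f_inv_into_f)
    have "\<phi> b = inv_into (fibre L b) (S ^^ n) ?t" using fibre_self[OF b(1), of L] b(3) by (simp add: \<phi>_def)
    then have "(S ^^ n) (\<phi> b) = ?t" using t(1) iso_onD(5)[OF shift] by (metis f_inv_into_f)
    then have "\<phi> b = (inv S ^^ n) ?t" using inv_funpow_cancel[OF hS] by metis
    moreover have "fst (L ?t) = n" using t(1) Lu by (simp add: fibre_def)
    ultimately have "g1 ?t = (R ^^ n) (\<phi> b)" by (simp add: g1_def tower_map_def)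
    moreover have "g2 u = (R ^^ n) (\<phi> b)" by (simp add: g2_def tower_map_def Lu b_def)
    ultimately show ?thesis using t(2) by simp
  qed
  define g where "g x = (if x \<in> X then g2 x else x)" for x
  have g: "homeo g" unfolding g_def by (rule homeo_extend[OF g2_X])
  have g_X: "iso_on T X X g" using g2_X by (subst iso_on_cong[of X g g2]) (simp_all add: g_def)
  have g_L: "L (g x) = L x" if "x \<in> X" for x
  proof -
    have "g2 x \<in> fibre L x" using iso_onD(5)[OF g2[OF that]] fibre_self[OF that, of L] by blast
    then show ?thesis using that by (simp add: g_def fibre_def)
  qed
  have g_mem: "g x \<in> X \<longleftrightarrow> x \<in> X" for x using homeo_mem[OF g] .
  have g_D: "g ` D = D" if "D \<in> \<D>" for D
  proof -
    have DX: "D \<subseteq> X" using that D(2) Cl_subset by blast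
    have iff: "g x \<in> D \<longleftrightarrow> x \<in> D" if "x \<in> X" for x
      by (rule same) (use that g_mem g_L \<open>D \<in> \<D>\<close> in \<open>auto simp: \<D>'_def\<close>)
    show ?thesis
    proof
      show "g ` D \<subseteq> D" using iff DX by blast
      show "D \<subseteq> g ` D"
      proof
        fix x assume x: "x \<in> D"
        have gx: "g (inv g x) = x" by (rule app_inv[OF g])
        then have "inv g x \<in> X" using g_mem[of "inv g x"] subsetD[OF DX x] by simp
        then have "inv g x \<in> D" using iff[of "inv g x"] gx x by simp
        then show "x \<in> g ` D" using gx by (intro image_eqI[of x g "inv g x"]) simp_all
      qed
    qed
  qed
  have g_R: "g (S x) = R (g x)" if x: "x \<in> X" "S x \<notin> Y'" for x
    using tower_map_shift[OF hS L x, of R \<phi>] x homeo_mem[OF hS] by (simp add: g_def g2_def)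
  have g_Y': "S (g x) \<notin> Y'" and g_LS: "L (S (g x)) = L (S x)" if x: "x \<in> X" "S x \<notin> Y'" for x
    using tower_labelD(3,4)[OF L x(1) _ x(2), of "g x"] g_mem g_L x(1) by simp_all
  have g_S: "g (S x) = S (g x)" if x: "x \<in> X" "S x \<notin> Y" for x
  proof -
    have out': "S x \<notin> Y'" using x(2) Y'(2) by blast
    have "S (g x) \<in> Y \<longleftrightarrow> S x \<in> Y"
      by (rule same) (use x g_mem g_LS[OF x(1) out'] homeo_mem[OF hS] in \<open>auto simp: \<D>'_def\<close>)
    then show ?thesis using g_R[OF x(1) out'] x(2) by (simp add: R_def)
  qed
  have "\<exists>p>0. (h \<circ> g) (S x) = (T ^^ p) ((h \<circ> g) x)" if x: "x \<in> X" "S x \<notin> Y'" for x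
    using R_fwd[of "g x"] g_Y'[OF x] g_mem x g_R[OF x] by simp
  moreover have "iso_on T X X (h \<circ> g)" using iso_on_comp[OF g_X h(2)] by (simp add: comp_def)
  ultimately have "partial_speedup T S Y' (h \<circ> g)"
    using homeo_comp[OF h(1) g] by (simp add: partial_speedup_def)
  moreover have "g y = y" "g (inv S y) = inv S y"
    using g2_y g2_u yX u(1) by (simp_all add: g_def u_def)
  ultimately show ?thesis using g g_D g_S by blast
qed

section \<open>Passage to the limit\<close>

text \<open>If no point had all the prescribed coordinates, the clopen sets of points with a wrong
  \<open>i\<close>-th coordinate would cover \<open>X\<close>, and finitely many of them would
  suffice.\<close>

lemma coordinate_limit:
  assumes "\<And>n. \<exists>z\<in>X. \<forall>i<n. z \<in> E i \<longleftrightarrow> P i"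
  shows "\<exists>z\<in>X. \<forall>i. z \<in> E i \<longleftrightarrow> P i"
proof (rule ccontr)
  assume none: "\<not> ?thesis"
  let ?U = "\<lambda>i. {z\<in>X. z \<in> E i \<longleftrightarrow> \<not> P i}"
  have "X \<subseteq> (\<Union>i. ?U i)" using none by blast
  then obtain n where n: "X \<subseteq> (\<Union>i\<in>{..n}. ?U i)"
    using cover_nat[of ?U, OF Collect_iff_in[OF E_in]] by blast
  obtain z where z: "z \<in> X" "\<forall>i<Suc n. z \<in> E i \<longleftrightarrow> P i" using assms by blast
  then obtain i where "i \<le> n" "z \<in> E i \<longleftrightarrow> \<not> P i" using n by auto
  then show False using z(2) by auto
qed

lemma speedup_limit:
  assumes T: "minimal T" and S: "minimal S"
    and pres: "\<And>m A. m \<in> means T \<Longrightarrow> A \<in> Cl \<Longrightarrow> m (S ` A) = m A"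
    and y: "y \<in> X" and h0: "homeo h0" "iso_on T X X h0"
    and q: "q > 0" "h0 y = (T ^^ q) (h0 (inv S y))"
  shows "\<exists>h. homeo h \<and> (\<forall>x\<in>X. \<exists>p>0. h (S x) = (T ^^ p) (h x))"
proof -
  note hS = minimal_homeo[OF S]
  define u where "u = inv S y"
  have u: "u \<in> X" "S u = y"
    using y homeo_mem[OF homeo_inv[OF hS]] app_inv[OF hS] by (simp_all add: u_def)
  define P where "P n s \<longleftrightarrow> (case s of (h, Y, \<D>) \<Rightarrow>
      partial_speedup T S Y h \<and> Y \<in> Cl \<and> y \<in> Y \<and> finite \<D> \<and> \<D> \<subseteq> Cl \<and> S -` Y \<in> \<D> \<and>
      h y = h0 y \<and> h u = h0 u)" for n :: nat and s
  define Q where "Q n s t \<longleftrightarrow> (case s of (h, Y, \<D>) \<Rightarrow> case t of (h', Y', \<D>') \<Rightarrow>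
      Y' \<subseteq> Y \<inter> cyl n y \<and> \<D> \<subseteq> \<D>' \<and> E n \<in> \<D>' \<and> h' -` E n \<in> \<D>' \<and>
      (\<exists>g. homeo g \<and> h' = h \<circ> g \<and> (\<forall>D\<in>\<D>. g ` D = D) \<and> (\<forall>x\<in>X. S x \<notin> Y \<longrightarrow> g (S x) = S (g x))))"
    for n s t
  \<comment> \<open>Over \<open>Y = X\<close> the speedup condition is vacuous, since
    \<open>S\<close> maps \<open>X\<close> into \<open>X\<close>.\<close>
  have "P 0 (h0, X, {S -` X})"
    using h0 y homeo_mem[OF hS] homeo_vimage[OF hS top] by (simp add: P_def partial_speedup_def)
  moreover have "\<exists>t. P (Suc n) t \<and> Q n s t" if s: "P n s" for n s
  proof -
    obtain h Y \<D> where s_eq: "s = (h, Y, \<D>)" by (cases s)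
    have ps: "partial_speedup T S Y h" and Y: "Y \<in> Cl" "y \<in> Y" and D: "finite \<D>" "\<D> \<subseteq> Cl"
      and hy: "h y = h0 y" "h u = h0 u"
      using s by (simp_all add: P_def s_eq)
    define Y' where "Y' = Y \<inter> cyl n y"
    have Y': "Y' \<in> Cl" "Y' \<subseteq> Y" "y \<in> Y'"
      using Int[OF Y(1) cyl_in] Y(2) cyl_self[OF y] by (auto simp: Y'_def)
    obtain g where g: "homeo g" "partial_speedup T S Y' (h \<circ> g)" "\<forall>D\<in>\<D>. g ` D = D"
      "g y = y" "g (inv S y) = inv S y" "\<forall>x\<in>X. S x \<notin> Y \<longrightarrow> g (S x) = S (g x)"
      using speedup_step[OF T S pres ps Y(1) Y' D] by blast
    have hg: "homeo (h \<circ> g)" using g(2) by (simp add: partial_speedup_def)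
    let ?\<D>' = "insert (E n) (insert ((h \<circ> g) -` E n) (insert (S -` Y') \<D>))"
    have "?\<D>' \<subseteq> Cl" using D(2) E_in homeo_vimage[OF hg E_in, of n] homeo_vimage[OF hS Y'(1)] by simp
    then have "P (Suc n) (h \<circ> g, Y', ?\<D>')"
      using g(2,4,5) Y' D(1) hy by (simp add: P_def u_def)
    moreover have "Q n s (h \<circ> g, Y', ?\<D>')"
      unfolding Q_def s_eq using g(1,3,6) by (auto simp: Y'_def)
    ultimately show ?thesis by blast
  qed
  ultimately obtain s where s: "\<And>n. P n (s n)" "\<And>n. Q n (s n) (s (Suc n))"
    using dependent_nat_choice[of P Q] by metis
  define H Y \<D> where "H n = fst (s n)" and "Y n = fst (snd (s n))" and "\<D> n = snd (snd (s n))" for n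
  have s_eq: "s n = (H n, Y n, \<D> n)" for n by (simp add: H_def Y_def \<D>_def)
  have ps: "partial_speedup T S (Y n) (H n)" and D: "\<D> n \<subseteq> Cl" and SY: "S -` Y n \<in> \<D> n"
    and Hy: "H n y = h0 y" "H n u = h0 u" for n
    using s(1)[of n] by (simp_all add: P_def s_eq)
  have Y_Suc: "Y (Suc n) \<subseteq> Y n" "Y (Suc n) \<subseteq> cyl n y" and D_Suc: "\<D> n \<subseteq> \<D> (Suc n)"
    and E_D: "E n \<in> \<D> (Suc n)" "H (Suc n) -` E n \<in> \<D> (Suc n)"
    and ex_g: "\<exists>g. homeo g \<and> H (Suc n) = H n \<circ> g \<and> (\<forall>D\<in>\<D> n. g ` D = D) \<and>
      (\<forall>x\<in>X. S x \<notin> Y n \<longrightarrow> g (S x) = S (g x))" for n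
    using s(2)[of n] by (simp_all add: Q_def s_eq)
  obtain g where g: "\<And>n. homeo (g n)" "\<And>n. H (Suc n) = H n \<circ> g n" "\<And>n D. D \<in> \<D> n \<Longrightarrow> g n ` D = D"
      "\<And>n x. x \<in> X \<Longrightarrow> S x \<notin> Y n \<Longrightarrow> g n (S x) = S (g n x)"
    using ex_g by metis
  have hH: "homeo (H n)" for n using ps by (simp add: partial_speedup_def)
  have H_mem: "H n x \<in> X \<longleftrightarrow> x \<in> X" for n x by (rule homeo_mem[OF hH])
  have H_inj: "H n x = H n x' \<longleftrightarrow> x = x'" for n x x' using homeo_inj[OF hH] by (simp add: inj_eq)
  have D_mono: "\<D> n \<subseteq> \<D> k" if "n \<le> k" for n k
    using lift_Suc_mono_le[of \<D>] D_Suc that by blast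
  have Y_mono: "Y k \<subseteq> Y n" if "n \<le> k" for n k
    using lift_Suc_antimono_le[of Y] Y_Suc(1) that by blast
  have H_D: "H k ` D = H n ` D" if D: "D \<in> \<D> n" and k: "n \<le> k" for D n k
    using k
  proof (induction k rule: dec_induct)
    case (step k)
    have "H (Suc k) ` D = H k ` (g k ` D)" by (simp add: g(2) image_comp)
    also have "g k ` D = D" using g(3) D_mono[OF step(1)] D by blast
    finally show ?case using step by simp
  qed simp
  \<comment> \<open>Already committed, \<open>F i\<close> will be the exact preimage of
    \<open>E i\<close> under the limit.\<close>
  define F where "F i = H (Suc i) -` E i" for i
  have F: "F i \<in> Cl" for i unfolding F_def by (rule homeo_vimage[OF hH E_in])
  have H_E: "H k x \<in> E i \<longleftrightarrow> x \<in> F i" if "i < k" for k i x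
  proof -
    have "H k ` F i = H (Suc i) ` F i" using H_D[of "F i" "Suc i" k] E_D(2) that by (simp add: F_def)
    also have "\<dots> = E i" unfolding F_def by (rule surj_image_vimage_eq[OF homeo_surj[OF hH]])
    finally have "H k x \<in> E i \<longleftrightarrow> H k x \<in> H k ` F i" by simp
    then show ?thesis using inj_image_mem_iff[OF homeo_inj[OF hH]] by simp
  qed
  have "\<exists>z\<in>X. \<forall>i. z \<in> E i \<longleftrightarrow> x \<in> F i" if x: "x \<in> X" for x
  proof (rule coordinate_limit)
    show "\<exists>z\<in>X. \<forall>i<n. z \<in> E i \<longleftrightarrow> x \<in> F i" for n
      using H_mem[of n x] x H_E by blast
  qed
  then obtain h where h: "\<And>x. x \<in> X \<Longrightarrow> h x \<in> X" "\<And>x i. x \<in> X \<Longrightarrow> h x \<in> E i \<longleftrightarrow> x \<in> F i"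
    by metis
  have cyl_lim: "H k x \<in> cyl n (h x)" if "x \<in> X" "n \<le> k" for x n k
    using that H_mem h(2) H_E by (simp add: cyl_def)
  have lim: "\<exists>N. \<forall>k\<ge>N. H k x \<in> A \<longleftrightarrow> h x \<in> A" if A: "A \<in> Cl" and x: "x \<in> X" for A x
  proof (cases "h x \<in> A")
    case True
    then obtain n where "cyl n (h x) \<subseteq> A" using cyl_base[OF A] by blast
    then show ?thesis using cyl_lim[OF x] True by blast
  next
    case False
    then have "h x \<in> X - A" using h(1) x by blast
    then obtain n where "cyl n (h x) \<subseteq> X - A" using cyl_base[OF compl_sets[OF A]] by blast
    then show ?thesis using cyl_lim[OF x] False by blast
  qed
  have h_D: "h x \<in> H n ` D \<longleftrightarrow> x \<in> D" if x: "x \<in> X" and DD: "D \<in> \<D> n" for x D n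
  proof -
    have "H n ` D \<in> Cl" by (rule homeo_image[OF hH subsetD[OF D DD]])
    then obtain N where N: "\<And>k. k \<ge> N \<Longrightarrow> H k x \<in> H n ` D \<longleftrightarrow> h x \<in> H n ` D" using lim x by metis
    have "H (max N n) x \<in> H (max N n) ` D \<longleftrightarrow> h x \<in> H n ` D"
      using N[of "max N n"] H_D[OF DD, of "max N n"] by simp
    then show ?thesis using inj_image_mem_iff[OF homeo_inj[OF hH]] by blast
  qed
  have h_E: "h x \<in> H (Suc i) ` E i \<longleftrightarrow> x \<in> E i" if "x \<in> X" for x i
    by (rule h_D[OF that E_D(1)])
  have eqI: "z = z'" if "z \<in> X" "z' \<in> X" "\<And>A. A \<in> Cl \<Longrightarrow> z \<in> A \<longleftrightarrow> z' \<in> A" for z z'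
    using E_separates[OF that(1,2)] that(3)[OF E_in] by blast
  have inj: "inj_on h X"
  proof (rule inj_onI)
    fix x x' assume x: "x \<in> X" "x' \<in> X" and eq: "h x = h x'"
    then have "x \<in> E i \<longleftrightarrow> x' \<in> E i" for i using h_E[of x i] h_E[of x' i] by simp
    then show "x = x'" using E_separates[OF x] by blast
  qed
  have surj: "\<exists>x\<in>X. h x = z" if z: "z \<in> X" for z
  proof -
    have pre: "inv (H k) z \<in> X" "H k (inv (H k) z) = z" for k
      using z homeo_mem[OF homeo_inv[OF hH]] app_inv[OF hH] by simp_all
    \<comment> \<open>The preimages of \<open>z\<close> under the stages stabilise coordinatewise as
      well; their limit \<open>x\<close> is the preimage of \<open>z\<close> under
      \<open>h\<close>.\<close>
    have pre_E: "inv (H k) z \<in> E i \<longleftrightarrow> z \<in> H (Suc i) ` E i" if "i < k" for k i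
      using H_D[OF E_D(1)[of i], of k] that pre(2)[of k]
        inj_image_mem_iff[OF homeo_inj[OF hH], of k "inv (H k) z" "E i"] by simp
    have "\<exists>x\<in>X. \<forall>i. x \<in> E i \<longleftrightarrow> z \<in> H (Suc i) ` E i"
    proof (rule coordinate_limit)
      show "\<exists>x\<in>X. \<forall>i<n. x \<in> E i \<longleftrightarrow> z \<in> H (Suc i) ` E i" for n
        by (rule bexI[OF _ pre(1)[of n]]) (simp add: pre_E)
    qed
    then obtain x where x: "x \<in> X" "\<And>i. x \<in> E i \<longleftrightarrow> z \<in> H (Suc i) ` E i" by blast
    have near: "inv (H k) z \<in> cyl n x" if "n \<le> k" for n k
      using pre(1)[of k] pre_E[of _ k] x(2) that by (simp add: cyl_def)
    have z_F: "z \<in> E j \<longleftrightarrow> inv (H k) z \<in> F j" if "j < k" for j k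
      using H_E[OF that, of "inv (H k) z"] pre(2)[of k] by simp
    have "h x \<in> E j \<longleftrightarrow> z \<in> E j" for j
    proof (cases "x \<in> F j")
      case True
      then obtain n where "cyl n x \<subseteq> F j" using cyl_base[OF F] by blast
      then have "inv (H (max n (Suc j))) z \<in> F j" using near[of n "max n (Suc j)"] by auto
      then show ?thesis using True h(2)[OF x(1)] z_F[of j "max n (Suc j)"] by simp
    next
      case False
      then have "x \<in> X - F j" using x(1) by simp
      then obtain n where "cyl n x \<subseteq> X - F j" using cyl_base[OF compl_sets[OF F]] by blast
      then have "inv (H (max n (Suc j))) z \<notin> F j" using near[of n "max n (Suc j)"] by auto
      then show ?thesis using False h(2)[OF x(1)] z_F[of j "max n (Suc j)"] by simp
    qed
    then have "h x = z" using E_separates[OF h(1)[OF x(1)] z] by blast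
    then show ?thesis using x(1) by blast
  qed
  have bij: "bij_betw h X X"
    unfolding bij_betw_def using inj surj h(1) by (auto simp: image_iff)
  have vimage: "{x\<in>X. h x \<in> A} \<in> Cl" if A: "A \<in> Cl" for A
  proof -
    have "locally_constant (\<lambda>x. h x \<in> A)"
    proof (rule lcI)
      fix x assume x: "x \<in> X"
      obtain n where n: "\<And>w. w \<in> cyl n (h x) \<Longrightarrow> w \<in> A \<longleftrightarrow> h x \<in> A"
        using locally_constant_nbhd[OF locally_constant_mem[OF A] h(1)[OF x]] cyl_base by (metis subsetD)
      let ?V = "X \<inter> (\<Inter>i\<in>{..<n}. {x'\<in>X. x' \<in> F i \<longleftrightarrow> x \<in> F i})"
      have V: "?V \<in> Cl" by (rule INT_in[OF _ Collect_iff_in[OF F]]) simp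
      have "x' \<in> ?V \<Longrightarrow> h x' \<in> cyl n (h x)" for x'
        using h x by (simp add: cyl_def)
      moreover have "x \<in> ?V" using x by simp
      ultimately show "\<exists>U\<in>Cl. x \<in> U \<and> (\<forall>x'\<in>U. (h x' \<in> A) = (h x \<in> A))"
        by (intro bexI[OF _ V] conjI ballI n)
    qed
    then show ?thesis using lcD[of "\<lambda>x. h x \<in> A" True] by simp
  qed
  have image: "h ` A \<in> Cl" if A: "A \<in> Cl" for A
  proof -
    have AX: "A \<subseteq> X" by (rule Cl_subset[OF A])
    have mem: "h x \<in> h ` A \<longleftrightarrow> x \<in> A" if "x \<in> X" for x
      using inj_on_image_mem_iff[OF inj that AX] .
    have "locally_constant (\<lambda>z. z \<in> h ` A)"
    proof (rule lcI)
      fix z assume "z \<in> X"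
      then obtain x where x: "x \<in> X" "h x = z" using surj by blast
      obtain n where n: "\<And>w. w \<in> cyl n x \<Longrightarrow> w \<in> A \<longleftrightarrow> x \<in> A"
        using locally_constant_nbhd[OF locally_constant_mem[OF A] x(1)] cyl_base by (metis subsetD)
      let ?V = "X \<inter> (\<Inter>i\<in>{..<n}. {z'\<in>X. z' \<in> H (Suc i) ` E i \<longleftrightarrow> z \<in> H (Suc i) ` E i})"
      have V: "?V \<in> Cl" by (rule INT_in[OF _ Collect_iff_in[OF homeo_image[OF hH E_in]]]) simp
      have const: "(z' \<in> h ` A) = (z \<in> h ` A)" if z': "z' \<in> ?V" for z'
      proof -
        obtain x' where x': "x' \<in> X" "h x' = z'" using surj[of z'] z' by blast
        have "x' \<in> E i \<longleftrightarrow> x \<in> E i" if "i < n" for i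
          using z' that h_E[OF x'(1), of i] h_E[OF x(1), of i] x(2) x'(2) by simp
        then have "x' \<in> cyl n x" using x'(1) by (simp add: cyl_def)
        then show ?thesis using n mem[OF x(1)] mem[OF x'(1)] x(2) x'(2) by blast
      qed
      have "z \<in> ?V" using \<open>z \<in> X\<close> by simp
      then show "\<exists>U\<in>Cl. z \<in> U \<and> (\<forall>z'\<in>U. (z' \<in> h ` A) = (z \<in> h ` A))"
        by (intro bexI[OF _ V] conjI ballI const)
    qed
    moreover have "{z\<in>X. (z \<in> h ` A) = True} = h ` A" using h(1) AX by auto
    ultimately show ?thesis using lcD[of "\<lambda>z. z \<in> h ` A" True] by simp
  qed
  have away: "\<exists>p>0. h (S x) = (T ^^ p) (h x)" if x: "x \<in> X" "x \<noteq> u" for x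
  proof -
    have SxX: "S x \<in> X" using homeo_mem[OF hS] x(1) by simp
    have "S x \<noteq> y" using x(2) u(2) inv_app[OF hS] u_def by metis
    then obtain i where "S x \<in> E i \<longleftrightarrow> y \<notin> E i" using E_separates[OF SxX y] by blast
    then have "S x \<notin> cyl (Suc i) y" by (auto simp: cyl_def)
    then obtain n where n: "S x \<notin> Y n" using Y_Suc(2) by blast
    define \<rho> where "\<rho> z = H n (S (inv (H n) z))" for z
    have h\<rho>: "homeo \<rho>"
      using homeo_comp[OF homeo_comp[OF hH hS] homeo_inv[OF hH], of n n] by (simp add: \<rho>_def[abs_def] comp_def)
    have H_\<rho>: "H k (S x') = \<rho> (H k x')" if k: "n \<le> k" and x': "x' \<in> X" "S x' \<notin> Y n" for k x'
      using k x'
    proof (induction k arbitrary: x' rule: dec_induct)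
      case base
      then show ?case by (simp add: \<rho>_def inv_app[OF hH])
    next
      case (step k)
      have "S x' \<notin> Y k" using step.prems Y_mono[OF step.hyps(1)] by blast
      then have g_S: "g k (S x') = S (g k x')" using g(4) step.prems by blast
      have gk: "g k x' \<in> X" using homeo_mem[OF g(1)] step.prems by simp
      have "g k ` (S -` Y n) = S -` Y n" using g(3) D_mono[OF step.hyps(1)] SY by blast
      then have "g k x' \<in> S -` Y n \<longleftrightarrow> x' \<in> S -` Y n"
        using inj_image_mem_iff[OF homeo_inj[OF g(1)], of k x' "S -` Y n"] by simp
      then have "S (g k x') \<notin> Y n" using step.prems by simp
      then have "H k (S (g k x')) = \<rho> (H k (g k x'))" using step.IH gk by blast
      then show ?case by (simp add: g(2) g_S)
    qed
    have "h (S x) = \<rho> (h x)"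
    proof (rule eqI)
      show "h (S x) \<in> X" "\<rho> (h x) \<in> X" using h(1) SxX x(1) homeo_mem[OF h\<rho>] by simp_all
      fix A assume A: "A \<in> Cl"
      obtain N1 where N1: "\<And>k. k \<ge> N1 \<Longrightarrow> H k (S x) \<in> A \<longleftrightarrow> h (S x) \<in> A"
        using lim[OF A SxX] by blast
      obtain N2 where N2: "\<And>k. k \<ge> N2 \<Longrightarrow> H k x \<in> \<rho> -` A \<longleftrightarrow> h x \<in> \<rho> -` A"
        using lim[OF homeo_vimage[OF h\<rho> A] x(1)] by blast
      let ?k = "max n (max N1 N2)"
      show "h (S x) \<in> A \<longleftrightarrow> \<rho> (h x) \<in> A"
        using N1[of ?k] N2[of ?k] H_\<rho>[of ?k x] x(1) n by simp
    qed
    moreover have "\<exists>p>0. \<rho> (h x) = (T ^^ p) (h x)"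
    proof -
      let ?v = "inv (H n) (h x)"
      have v: "?v \<in> X" "H n ?v = h x"
        using h(1)[OF x(1)] homeo_mem[OF homeo_inv[OF hH]] app_inv[OF hH] by simp_all
      have "h x \<notin> H n ` (S -` Y n)" using h_D[OF x(1) SY] n by simp
      then have "S ?v \<notin> Y n" using v(2) by (metis image_eqI vimageI)
      then show ?thesis using ps[of n] v unfolding partial_speedup_def \<rho>_def by metis
    qed
    ultimately show ?thesis by simp
  qed
  have h_const: "h x = h0 x" if x: "x \<in> X" and const: "\<And>n. H n x = h0 x" for x
  proof (rule eqI)
    show "h x \<in> X" "h0 x \<in> X" using h(1)[OF x] homeo_mem[OF h0(1)] x by simp_all
    fix A assume "A \<in> Cl"
    then show "h x \<in> A \<longleftrightarrow> h0 x \<in> A" using lim[of A x] x const by auto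
  qed
  \<comment> \<open>No stage controls the step from \<open>u\<close> to \<open>y\<close>, but
    neither point is ever moved, so the exponent \<open>q\<close> of \<open>h0\<close>
    persists.\<close>
  have "h (S u) = (T ^^ q) (h u)"
    using h_const[OF y Hy(1)] h_const[OF u(1) Hy(2)] q(2) u by (simp add: u_def)
  then have all: "\<exists>p>0. h (S x) = (T ^^ p) (h x)" if "x \<in> X" for x
    using away[OF that] q(1) by (cases "x = u") auto
  have "homeo (\<lambda>x. if x \<in> X then h x else x)" by (rule homeo_extend_bij[OF bij vimage image])
  moreover have "\<exists>p>0. (if S x \<in> X then h (S x) else S x) = (T ^^ p) (if x \<in> X then h x else x)"
    if "x \<in> X" for x
    using all[OF that] that homeo_mem[OF hS] by simp
  ultimately show ?thesis by (intro exI[of _ "\<lambda>x. if x \<in> X then h x else x"]) simp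
qed

text \<open>Exchanging small neighbourhoods of \<open>y\<close> and \<open>S\<^sup>-\<^sup>1 y\<close> corrects a negative exponent at the one
  point where the limit is not controlled by the approximations.\<close>

lemma swap_homeo:
  assumes T: "homeo T" and x: "x \<in> X" "(T ^^ n) x \<noteq> x"
  shows "\<exists>f. homeo f \<and> iso_on T X X f \<and> f x = (T ^^ n) x \<and> f ((T ^^ n) x) = x"
proof -
  note hn = homeo_funpow[OF T, of n]
  let ?t = "T ^^ n"
  obtain V where V: "V \<in> Cl" "x \<in> V" "?t x \<notin> V"
    using separate_point[of x "?t x"] x homeo_mem[OF hn] by metis
  \<comment> \<open>Removing the preimage makes \<open>U\<close> disjoint from its translate, so the
    two can be exchanged.\<close>
  define U where "U = V - ?t -` V"
  have U: "U \<in> Cl" "x \<in> U" using V homeo_vimage[OF hn V(1)] by (auto simp: U_def)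
  have tU: "?t ` U \<in> Cl" by (rule homeo_image[OF hn U(1)])
  have disj: "U \<inter> ?t ` U = {}" by (auto simp: U_def)
  define f where "f z = (if z \<in> U then ?t z else if z \<in> ?t ` U then inv_into U ?t z else z)" for z
  define C where "C = X - U - ?t ` U"
  have C: "C \<in> Cl" unfolding C_def by (rule Diff[OF compl_sets[OF U(1)] tU])
  have iU: "iso_on T U (?t ` U) f"
    using iso_on_funpow[OF T U(1), of n] by (subst iso_on_cong[of U f ?t]) (auto simp: f_def)
  have iV: "iso_on T (?t ` U) U f"
    using iso_on_inv[OF iso_on_funpow[OF T U(1), of n]] disj
    by (subst iso_on_cong[of "?t ` U" f "inv_into U ?t"]) (auto simp: f_def)
  have iC: "iso_on T C C f"
    using iso_on_id[OF C] by (subst iso_on_cong[of C f "\<lambda>x. x"]) (auto simp: f_def C_def)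
  have "iso_on T ((U \<union> ?t ` U) \<union> C) ((?t ` U \<union> U) \<union> C) f"
    by (rule iso_on_Un[OF iso_on_Un[OF iU iV] iC]) (use disj in \<open>auto simp: C_def\<close>)
  moreover have "(U \<union> ?t ` U) \<union> C = X" "(?t ` U \<union> U) \<union> C = X"
    using Cl_subset[OF U(1)] Cl_subset[OF tU] by (auto simp: C_def)
  ultimately have iX: "iso_on T X X f" by simp
  have inv_t: "inv_into U ?t (?t x) = x"
    using U(2) inj_on_subset[OF homeo_inj[OF hn]] by (simp add: inv_into_f_f)
  define F where "F z = (if z \<in> X then f z else z)" for z
  have "homeo F" unfolding F_def by (rule homeo_extend[OF iX])
  moreover have "iso_on T X X F" using iX by (subst iso_on_cong[of X F f]) (auto simp: F_def)
  moreover have "F x = ?t x" "F (?t x) = x"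
    using U(2) x(1) homeo_mem[OF hn] disj inv_t by (auto simp: F_def f_def)
  ultimately show ?thesis by blast
qed

text \<open>The exceptional step runs from an arbitrary \<open>x\<close> to \<open>S x\<close>. If
  \<open>S x\<close> is a positive power of \<open>T\<close> at \<open>x\<close>, the identity can
  serve as \<open>h0\<close>. Otherwise \<open>x\<close> is a positive power of \<open>T\<close> at
  \<open>S x\<close>, and exchanging the two points reverses the direction.\<close>

theorem speedup_exists:
  assumes T: "minimal T" and S: "minimal S"
    and orb: "\<And>x. x \<in> X \<Longrightarrow> \<exists>i j. (T ^^ i) (S x) = (T ^^ j) x"
  shows "\<exists>h. homeo h \<and> (\<forall>x\<in>X. \<exists>p>0. h (S x) = (T ^^ p) (h x))"
proof -
  note hT = minimal_homeo[OF T] and hS = minimal_homeo[OF S]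
  have pres: "m (S ` A) = m A" if "m \<in> means T" "A \<in> Cl" for m A
    by (rule orbit_mean[OF T hS orb that])
  have "X \<noteq> {}" using infinite_X by auto
  then obtain x where x: "x \<in> X" by blast
  obtain i j where ij: "(T ^^ i) (S x) = (T ^^ j) x" using orb[OF x] by blast
  have SxX: "S x \<in> X" using homeo_mem[OF hS] x by simp
  have ne: "S x \<noteq> x" using aperiodic[OF S x, of 1] by simp
  have "\<exists>h0 q. homeo h0 \<and> iso_on T X X h0 \<and> q > 0 \<and> h0 (S x) = (T ^^ q) (h0 x)"
  proof (cases "i \<le> j")
    case True
    have eq: "S x = (T ^^ (j - i)) x"
      using inv_funpow_funpow[OF hT True, of x] inv_funpow_cancel[OF hT, of i "S x"] ij by simp
    then have "j - i > 0" using ne by (metis funpow_0 gr0I)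
    then show ?thesis using homeo_id iso_on_id[OF top] eq
      by (intro exI[of _ "\<lambda>x. x"] exI[of _ "j - i"]) (simp add: id_def)
  next
    case False
    then have eq: "(T ^^ (i - j)) (S x) = x"
      using inv_funpow_funpow[OF hT, of j i "S x"] inv_funpow_cancel[OF hT, of j x] ij by simp
    then obtain f where "homeo f" "iso_on T X X f" "f (S x) = x" "f x = S x"
      using swap_homeo[OF hT SxX, of "i - j"] ne by metis
    then show ?thesis using False eq by (intro exI[of _ f] exI[of _ "i - j"]) simp
  qed
  then obtain h0 q where h0: "homeo h0" "iso_on T X X h0" "q > 0" "h0 (S x) = (T ^^ q) (h0 x)"
    by blast
  show ?thesis
    by (rule speedup_limit[OF T S pres SxX h0(1-3)]) (simp_all add: inv_app[OF hS] h0(4))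
qed

end

subsection \<open>Minimal Cantor systems\<close>

definition clopens :: "'a topology \<Rightarrow> 'a set set" where
  "clopens X = {U. openin X U \<and> closedin X U}"

definition fix_outside :: "'a topology \<Rightarrow> ('a \<Rightarrow> 'a) \<Rightarrow> 'a \<Rightarrow> 'a" where
  "fix_outside X T x = (if x \<in> topspace X then T x else x)"

lemma clopen_base:
  assumes "X dim_le 0" "openin X W" "x \<in> W"
  shows "\<exists>U\<in>clopens X. x \<in> U \<and> U \<subseteq> W"
proof -
  have "neighbourhood_base_of (\<lambda>U. closedin X U \<and> openin X U) X"
    using assms(1) dimension_le_0_neighbourhood_base_of_clopen by blast
  then have "\<forall>W x. openin X W \<and> x \<in> W \<longrightarrow> (\<exists>U. (closedin X U \<and> openin X U) \<and> x \<in> U \<and> U \<subseteq> W)"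
    by (subst (asm) open_neighbourhood_base_of) auto
  then show ?thesis using assms(2,3) unfolding clopens_def by blast
qed

text \<open>For each \<open>n\<close> compactness gives a finite clopen cover by sets inside balls
  of radius \<open>1 / Suc n\<close>. All these covers together are countable, and a set of diameter
  below the distance of two points separates them.\<close>

lemma separating_clopens:
  assumes "topspace X \<noteq> {}" "compact_space X" "metrizable_space X" "X dim_le 0"
  shows "\<exists>E :: nat \<Rightarrow> 'a set. range E \<subseteq> clopens X \<and>
    (\<forall>x\<in>topspace X. \<forall>y\<in>topspace X. x \<noteq> y \<longrightarrow> (\<exists>i. x \<in> E i \<and> y \<notin> E i))"
proof -
  obtain M d where M: "Metric_space M d" and X: "X = Metric_space.mtopology M d"
    using assms(3) unfolding metrizable_space_def by blast
  interpret Metric_space M d by (rule M)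
  have tX: "topspace X = M" using X by simp
  have "\<exists>\<V>. finite \<V> \<and> \<V> \<subseteq> clopens X \<and> M \<subseteq> \<Union>\<V> \<and> (\<forall>V\<in>\<V>. \<exists>z. V \<subseteq> mball z (1 / Suc n))" for n
  proof -
    have "\<exists>U\<in>clopens X. x \<in> U \<and> U \<subseteq> mball x (1 / Suc n)" if "x \<in> M" for x
      by (rule clopen_base[OF assms(4)]) (use that X in auto)
    then obtain U where U: "\<And>x. x \<in> M \<Longrightarrow> U x \<in> clopens X \<and> x \<in> U x \<and> U x \<subseteq> mball x (1 / Suc n)"
      by metis
    have "\<forall>V\<in>U ` M. openin X V" "topspace X \<subseteq> \<Union>(U ` M)"
      using U tX by (auto simp: clopens_def)
    then obtain \<V> where \<V>: "finite \<V>" "\<V> \<subseteq> U ` M" "topspace X \<subseteq> \<Union>\<V>"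
      using assms(2) unfolding compact_space_alt by meson
    have clp: "\<V> \<subseteq> clopens X" using \<V>(2) U by auto
    have cov: "M \<subseteq> \<Union>\<V>" using \<V>(3) tX by simp
    have small: "\<exists>z. V \<subseteq> mball z (1 / Suc n)" if V: "V \<in> \<V>" for V
    proof -
      obtain x where x: "x \<in> M" "V = U x" using \<V>(2) V by auto
      have "V \<subseteq> mball x (1 / Suc n)" unfolding x(2) using U[OF x(1)] by (elim conjE)
      then show ?thesis by (intro exI[of _ x])
    qed
    show ?thesis by (intro exI[of _ \<V>] conjI ballI \<V>(1) clp cov small)
  qed
  then obtain \<V> where V: "\<And>n. finite (\<V> n)" "\<And>n. \<V> n \<subseteq> clopens X" "\<And>n. M \<subseteq> \<Union>(\<V> n)"
    "\<And>n V. V \<in> \<V> n \<Longrightarrow> \<exists>z. V \<subseteq> mball z (1 / Suc n)"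
    by metis
  let ?W = "\<Union>n. \<V> n"
  have W: "countable ?W" "?W \<noteq> {}" 
  proof -
    show "countable ?W" by (rule countable_UN) (simp_all add: countable_finite V(1))
    obtain x where "x \<in> M" using assms(1) tX by blast
    then have "x \<in> \<Union>(\<V> 0)" using V(3) by blast
    then show "?W \<noteq> {}" by blast
  qed
  define E where "E = from_nat_into ?W"
  have rE: "range E = ?W" unfolding E_def by (rule range_from_nat_into[OF W(2,1)])
  have "\<exists>i. x \<in> E i \<and> y \<notin> E i" if xy: "x \<in> M" "y \<in> M" "x \<noteq> y" for x y
  proof -
    have "d x y / 2 > 0" using xy by simp
    then obtain n where n: "inverse (real (Suc n)) < d x y / 2" using reals_Archimedean by blast
    obtain V where V': "V \<in> \<V> n" "x \<in> V" using V(3) xy(1) by blast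
    obtain z where z: "V \<subseteq> mball z (1 / Suc n)" using V(4)[OF V'(1)] by blast
    have "y \<notin> V"
    proof
      assume "y \<in> V"
      then have "z \<in> M" "d z x < 1 / Suc n" "d z y < 1 / Suc n" using z V'(2) by auto
      moreover have "d x y \<le> d z x + d z y" using triangle[of x z y] commute[of x z] xy \<open>z \<in> M\<close> by simp
      ultimately show False using n by (simp add: inverse_eq_divide)
    qed
    moreover have "V \<in> range E" using V'(1) rE by blast
    ultimately show ?thesis using V'(2) by blast
  qed
  moreover have "range E \<subseteq> clopens X" using rE V(2) by blast
  ultimately show ?thesis using tX by blast
qed

lemma cantor_space_algebra:
  assumes "cantor_space X"
  shows "\<exists>E. cantor_algebra (topspace X) (clopens X) E"
proof -
  have X: "topspace X \<noteq> {}" "compact_space X" "metrizable_space X"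
    "X derived_set_of topspace X = topspace X" "X dim_le 0"
    using assms by (simp_all add: cantor_space_def)
  obtain E :: "nat \<Rightarrow> 'a set" where E: "range E \<subseteq> clopens X"
    "\<forall>x\<in>topspace X. \<forall>y\<in>topspace X. x \<noteq> y \<longrightarrow> (\<exists>i. x \<in> E i \<and> y \<notin> E i)"
    using separating_clopens[OF X(1,2,3,5)] by blast
  have "t1_space X" by (rule metrizable_imp_t1_space[OF X(3)])
  \<comment> \<open>A finite T1 space has no limit points, whereas a perfect nonempty space consists
    of them.\<close>
  then have "infinite (topspace X)"
    using t1_space_derived_set_of_finite[of X] X(1,4) by auto
  moreover have "algebra (topspace X) (clopens X)"
    unfolding algebra_iff_Int clopens_def
  proof (intro conjI ballI subsetI)
    show "x \<in> Pow (topspace X)" if "x \<in> {U. openin X U \<and> closedin X U}" for x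
      using that closedin_subset[of X x] by simp
  qed (simp_all add: openin_Int closedin_Int openin_diff closedin_diff)
  moreover have "\<exists>\<V>\<subseteq>\<U>. finite \<V> \<and> topspace X \<subseteq> \<Union>\<V>"
    if U: "\<U> \<subseteq> clopens X" "topspace X \<subseteq> \<Union>\<U>" for \<U>
  proof -
    have "\<forall>U\<in>\<U>. openin X U" using U(1) by (auto simp: clopens_def)
    then obtain \<V> where "finite \<V>" "\<V> \<subseteq> \<U>" "topspace X \<subseteq> \<Union>\<V>"
      using X(2) U(2) unfolding compact_space_alt by meson
    then show ?thesis by (intro exI[of _ \<V>]) simp
  qed
  moreover have "E i \<in> clopens X" for i using E(1) by (simp add: image_subset_iff)
  moreover have "\<exists>i. x \<in> E i \<longleftrightarrow> y \<notin> E i" if "x \<in> topspace X" "y \<in> topspace X" "x \<noteq> y" for x y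
    using E(2) that by metis
  ultimately have "cantor_algebra (topspace X) (clopens X) E"
    by (intro cantor_algebra.intro cantor_algebra_axioms.intro)
  then show ?thesis by (intro exI[of _ E])
qed

section \<open>From topological systems to the clopen algebra and back\<close>

lemma homeomorphic_map_inverse:
  assumes "homeomorphic_map X Y f"
  shows "\<exists>g. homeomorphic_map Y X g \<and> (\<forall>x\<in>topspace X. g (f x) = x) \<and> (\<forall>y\<in>topspace Y. f (g y) = y)"
proof -
  obtain g where "homeomorphic_maps X Y f g"
    using assms unfolding homeomorphic_map_maps by (elim exE)
  then show ?thesis unfolding homeomorphic_maps_map by (intro exI[of _ g]) simp
qed

lemma homeomorphic_map_into: "homeomorphic_map X Y f \<Longrightarrow> x \<in> topspace X \<Longrightarrow> f x \<in> topspace Y"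
  using homeomorphic_imp_surjective_map by blast

lemma funpow_into: "T \<in> A \<rightarrow> A \<Longrightarrow> x \<in> A \<Longrightarrow> (T ^^ n) x \<in> A"
  by (induction n) auto

lemma fix_outside_funpow:
  assumes "T \<in> topspace X \<rightarrow> topspace X" "x \<in> topspace X"
  shows "(fix_outside X T ^^ n) x = (T ^^ n) x"
proof (induction n)
  case (Suc n)
  then show ?case using funpow_into[OF assms, of n] by (simp add: fix_outside_def)
qed simp

lemma inv_fix_outside:
  assumes "bij_betw T (topspace X) (topspace X)" "bij (fix_outside X T)" "x \<in> topspace X"
  shows "inv (fix_outside X T) x = inv_into (topspace X) T x" "inv_into (topspace X) T x \<in> topspace X"
proof -
  let ?z = "inv_into (topspace X) T x"
  have z: "?z \<in> topspace X" "T ?z = x"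
    using assms(1,3) by (auto simp: bij_betw_def inv_into_into f_inv_into_f)
  then have "fix_outside X T ?z = x" by (simp add: fix_outside_def)
  then show "inv (fix_outside X T) x = ?z" using assms(2) by (metis bij_is_inj inv_f_f)
  show "?z \<in> topspace X" by (rule z)
qed

lemma inv_fix_outside_funpow:
  assumes "bij_betw T (topspace X) (topspace X)" "bij (fix_outside X T)" "x \<in> topspace X"
  shows "(inv (fix_outside X T) ^^ n) x = (inv_into (topspace X) T ^^ n) x \<and>
    (inv_into (topspace X) T ^^ n) x \<in> topspace X"
proof (induction n)
  case (Suc n)
  then show ?case using inv_fix_outside[OF assms(1,2)] by simp
qed (use assms in simp)

lemma orbit_of_cases:
  assumes "bij_betw T (topspace X) (topspace X)" "bij (fix_outside X T)" "x \<in> topspace X"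
    and "z \<in> orbit_of X T x"
  shows "\<exists>n. z = (fix_outside X T ^^ n) x \<or> z = (inv (fix_outside X T) ^^ n) x"
proof -
  have "T \<in> topspace X \<rightarrow> topspace X" using assms(1) bij_betwE by blast
  note fwd = fix_outside_funpow[OF this assms(3)]
  note bwd = inv_fix_outside_funpow[OF assms(1-3)]
  show ?thesis using assms(4) fwd bwd unfolding orbit_of_def int_iterate_def
    by (auto split: if_splits)
qed

lemma fix_outside_homeo:
  assumes alg: "cantor_algebra (topspace X) (clopens X) E" and T: "homeomorphic_map X X T"
  shows "cantor_algebra.homeo (clopens X) (fix_outside X T)"
proof -
  interpret cantor_algebra "topspace X" "clopens X" E by (rule alg)
  have bij: "bij_betw T (topspace X) (topspace X)"
    using T by (simp add: bij_betw_def homeomorphic_imp_injective_map homeomorphic_imp_surjective_map)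
  have cont: "continuous_map X X T" by (rule homeomorphic_imp_continuous_map[OF T])
  have "homeo (\<lambda>x. if x \<in> topspace X then T x else x)"
  proof (rule homeo_extend_bij[OF bij])
    fix A assume A: "A \<in> clopens X"
    show "{x \<in> topspace X. T x \<in> A} \<in> clopens X"
      using A openin_continuous_map_preimage[OF cont, of A] closedin_continuous_map_preimage[OF cont, of A]
      by (simp add: clopens_def)
    show "T ` A \<in> clopens X"
      using A homeomorphic_map_openness_eq[OF T, of A] homeomorphic_map_closedness_eq[OF T, of A]
      by (simp add: clopens_def)
  qed
  then show ?thesis by (simp add: fix_outside_def[abs_def])
qed

text \<open>Clopen sets form a base, so a bijection that preserves them in both directions is open
  together with its inverse.\<close>

lemma homeo_homeomorphic_map:
  assumes alg: "cantor_algebra (topspace X) (clopens X) E" and dim: "X dim_le 0"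
    and h: "cantor_algebra.homeo (clopens X) h"
  shows "homeomorphic_map X X h"
proof -
  interpret cantor_algebra "topspace X" "clopens X" E by (rule alg)
  have image_open: "openin X (h ` U)" if h: "homeo h" and U: "openin X U" for h U
  proof (subst openin_subopen, intro ballI)
    fix z assume "z \<in> h ` U"
    then obtain x where x: "x \<in> U" "z = h x" by blast
    obtain V where V: "V \<in> clopens X" "x \<in> V" "V \<subseteq> U" using clopen_base[OF dim U x(1)] by blast
    have "openin X (h ` V)" using homeo_image[OF h V(1)] by (simp add: clopens_def)
    then show "\<exists>W. openin X W \<and> z \<in> W \<and> W \<subseteq> h ` U" using V x by blast
  qed
  have "{x \<in> topspace X. h x \<in> U} = inv h ` U" if "openin X U" for U
    using inv_app[OF h] app_inv[OF h] homeo_mem[OF homeo_inv[OF h]] openin_subset[OF that]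
    by (auto simp: image_iff) metis+
  then have "continuous_map X X h"
    unfolding continuous_map_def using image_open[OF homeo_inv[OF h]] homeo_mem[OF h] by auto
  moreover have "open_map X X h" unfolding open_map_def using image_open[OF h] by blast
  ultimately show ?thesis
    using homeo_X[OF h] inj_on_subset[OF homeo_inj[OF h]]
    by (intro bijective_open_imp_homeomorphic_map) auto
qed

lemma fix_outside_minimal:
  assumes alg: "cantor_algebra (topspace X) (clopens X) E" and T: "minimal_cantor_system X T"
  shows "cantor_algebra.minimal (topspace X) (clopens X) (fix_outside X T)"
proof -
  interpret cantor_algebra "topspace X" "clopens X" E by (rule alg)
  have hT: "homeomorphic_map X X T" using T by (simp add: minimal_cantor_system_def)
  have h: "homeo (fix_outside X T)" by (rule fix_outside_homeo[OF alg hT])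
  have bij: "bij_betw T (topspace X) (topspace X)"
    using hT by (simp add: bij_betw_def homeomorphic_imp_injective_map homeomorphic_imp_surjective_map)
  have "\<exists>n. (fix_outside X T ^^ n) x \<in> A \<or> (inv (fix_outside X T) ^^ n) x \<in> A"
    if A: "A \<in> clopens X" "A \<noteq> {}" and x: "x \<in> topspace X" for A x
  proof -
    obtain a where a: "a \<in> A" using A(2) by blast
    then have "a \<in> X closure_of orbit_of X T x"
      using T x Cl_subset[OF A(1)] unfolding minimal_cantor_system_def by blast
    then obtain z where "z \<in> orbit_of X T x" "z \<in> A"
      using a A(1) unfolding in_closure_of clopens_def by blast
    then show ?thesis using orbit_of_cases[OF bij homeo_bij[OF h] x] by metis
  qed
  then show ?thesis unfolding minimal_def using h by blast
qed

lemma same_orbits_speedup: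
  assumes T: "minimal_cantor_system X T" and S: "minimal_cantor_system X S"
    and orb: "\<And>x. x \<in> topspace X \<Longrightarrow> orbit_of X S x = orbit_of X T x"
  shows "speedup_of X S X T"
proof -
  have X: "cantor_space X" and hT: "homeomorphic_map X X T" and hS: "homeomorphic_map X X S"
    using T S by (simp_all add: minimal_cantor_system_def)
  obtain E where alg: "cantor_algebra (topspace X) (clopens X) E" using cantor_space_algebra[OF X] by blast
  interpret cantor_algebra "topspace X" "clopens X" E by (rule alg)
  have bij: "bij_betw T (topspace X) (topspace X)"
    using hT by (simp add: bij_betw_def homeomorphic_imp_injective_map homeomorphic_imp_surjective_map)
  let ?T = "fix_outside X T" and ?S = "fix_outside X S"
  have hT': "homeo ?T" by (rule fix_outside_homeo[OF alg hT])
  have "\<exists>i j. (?T ^^ i) (?S x) = (?T ^^ j) x" if x: "x \<in> topspace X" for x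
  proof -
    have "S x \<in> orbit_of X S x"
      unfolding orbit_of_def by (intro CollectI exI[of _ 1]) (simp add: int_iterate_def)
    then have "S x \<in> orbit_of X T x" using orb[OF x] by simp
    then obtain n where "S x = (?T ^^ n) x \<or> S x = (inv ?T ^^ n) x"
      using orbit_of_cases[OF bij homeo_bij[OF hT'] x] by blast
    \<comment> \<open>A negative exponent becomes a forward power applied to \<open>S x\<close>,
      which keeps all exponents natural numbers.\<close>
    then have "(?T ^^ 0) (S x) = (?T ^^ n) x \<or> (?T ^^ n) (S x) = (?T ^^ 0) x"
      using funpow_inv_cancel[OF hT'] by auto
    moreover have "?S x = S x" using x by (simp add: fix_outside_def)
    ultimately show ?thesis by metis
  qed
  then obtain h where h: "homeo h" "\<forall>x\<in>topspace X. \<exists>p>0. h (?S x) = (?T ^^ p) (h x)"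
    using speedup_exists[OF fix_outside_minimal[OF alg T] fix_outside_minimal[OF alg S]] by blast
  have T_into: "T \<in> topspace X \<rightarrow> topspace X" using bij bij_betwE by blast
  have "\<exists>p>0. h (S (inv h z)) = (T ^^ p) z" if z: "z \<in> topspace X" for z
  proof -
    have back_z: "inv h z \<in> topspace X" "h (inv h z) = z"
      using z homeo_mem[OF homeo_inv[OF h(1)]] app_inv[OF h(1)] by simp_all
    obtain p where "p > 0" "h (?S (inv h z)) = (?T ^^ p) (h (inv h z))" using h(2) back_z(1) by blast
    moreover have "?S (inv h z) = S (inv h z)" using back_z(1) by (simp add: fix_outside_def)
    ultimately show ?thesis using back_z(2) fix_outside_funpow[OF T_into z, of p] by (intro exI[of _ p]) simp
  qed
  then obtain p where p: "\<And>z. z \<in> topspace X \<Longrightarrow> p z > 0 \<and> h (S (inv h z)) = (T ^^ p z) z" by metis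
  have "homeomorphic_map X X h"
    by (rule homeo_homeomorphic_map[OF alg _ h(1)]) (use X in \<open>simp add: cantor_space_def\<close>)
  moreover have "h (S x) = (T ^^ p (h x)) (h x)" if "x \<in> topspace X" for x
    using p[of "h x"] homeo_mem[OF h(1)] inv_app[OF h(1)] that by simp
  ultimately show ?thesis
    unfolding speedup_of_def topologically_conjugate_def using p by blast
qed

section \<open>Conjugacy and speedups\<close>

lemma topologically_conjugate_sym:
  assumes "topologically_conjugate Y S X T" and S: "S \<in> topspace Y \<rightarrow> topspace Y"
  shows "topologically_conjugate X T Y S"
proof -
  obtain h where h: "homeomorphic_map Y X h" "\<forall>y\<in>topspace Y. h (S y) = T (h y)"
    using assms(1) unfolding topologically_conjugate_def by blast
  obtain g where g: "homeomorphic_map X Y g" "\<forall>y\<in>topspace Y. g (h y) = y" "\<forall>x\<in>topspace X. h (g x) = x"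
    using homeomorphic_map_inverse[OF h(1)] by blast
  have "g (T x) = S (g x)" if x: "x \<in> topspace X" for x
  proof -
    have gx: "g x \<in> topspace Y" by (rule homeomorphic_map_into[OF g(1) x])
    have "T x = h (S (g x))" using h(2) gx g(3) x by simp
    then show ?thesis using g(2) S gx by auto
  qed
  then show ?thesis using g(1) unfolding topologically_conjugate_def by blast
qed

lemma topologically_conjugate_trans:
  assumes "topologically_conjugate Z R Y S" "topologically_conjugate Y S X T"
  shows "topologically_conjugate Z R X T"
proof -
  obtain h k where h: "homeomorphic_map Z Y h" "\<forall>z\<in>topspace Z. h (R z) = S (h z)"
    and k: "homeomorphic_map Y X k" "\<forall>y\<in>topspace Y. k (S y) = T (k y)"
    using assms unfolding topologically_conjugate_def by blast
  have "\<forall>z\<in>topspace Z. (k \<circ> h) (R z) = T ((k \<circ> h) z)"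
    using h k homeomorphic_map_into[OF h(1)] by simp
  then show ?thesis
    using homeomorphic_map_compose[OF h(1) k(1)] unfolding topologically_conjugate_def by blast
qed

lemma speedup_of_conjugate:
  assumes "speedup_of Z R X T" "topologically_conjugate X T Y S" and T: "T \<in> topspace X \<rightarrow> topspace X"
  shows "speedup_of Z R Y S"
proof -
  obtain p where p: "\<forall>x\<in>topspace X. 0 < p x" "topologically_conjugate Z R X (\<lambda>x. (T ^^ p x) x)"
    using assms(1) unfolding speedup_of_def by blast
  obtain h where h: "homeomorphic_map X Y h" "\<forall>x\<in>topspace X. h (T x) = S (h x)"
    using assms(2) unfolding topologically_conjugate_def by blast
  obtain g where g: "homeomorphic_map Y X g" "\<forall>x\<in>topspace X. g (h x) = x" "\<forall>y\<in>topspace Y. h (g y) = y"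
    using homeomorphic_map_inverse[OF h(1)] by blast
  have pow: "h ((T ^^ n) x) = (S ^^ n) (h x)" if x: "x \<in> topspace X" for n x
    by (induction n) (use h(2) funpow_into[OF T x] in auto)
  have "topologically_conjugate X (\<lambda>x. (T ^^ p x) x) Y (\<lambda>y. (S ^^ p (g y)) y)"
    unfolding topologically_conjugate_def using h(1) pow g(2) by (intro exI[of _ h]) simp
  then have "topologically_conjugate Z R Y (\<lambda>y. (S ^^ p (g y)) y)"
    by (rule topologically_conjugate_trans[OF p(2)])
  moreover have "\<forall>y\<in>topspace Y. 0 < p (g y)" using p(1) homeomorphic_map_into[OF g(1)] by blast
  ultimately show ?thesis unfolding speedup_of_def by (intro exI[of _ "\<lambda>y. p (g y)"]) simp
qed

lemma conjugate_speedup_of: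
  "topologically_conjugate Z R Y S \<Longrightarrow> speedup_of Y S X T \<Longrightarrow> speedup_of Z R X T"
  unfolding speedup_of_def using topologically_conjugate_trans by blast

lemma conjugate_homeomorphic_map:
  assumes "topologically_conjugate Y S X T" "homeomorphic_map Y Y S"
  shows "homeomorphic_map X X T"
proof -
  obtain h where h: "homeomorphic_map Y X h" "\<forall>y\<in>topspace Y. h (S y) = T (h y)"
    using assms(1) unfolding topologically_conjugate_def by blast
  obtain g where g: "homeomorphic_map X Y g" "\<forall>y\<in>topspace Y. g (h y) = y" "\<forall>x\<in>topspace X. h (g x) = x"
    using homeomorphic_map_inverse[OF h(1)] by blast
  have "homeomorphic_map X X (h \<circ> (S \<circ> g))"
    by (intro homeomorphic_map_compose[OF _ h(1)] homeomorphic_map_compose[OF g(1) assms(2)])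
  moreover have "(h \<circ> (S \<circ> g)) x = T x" if "x \<in> topspace X" for x
    using h(2) g(3) homeomorphic_map_into[OF g(1)] that by simp
  ultimately show ?thesis using homeomorphic_map_eq by blast
qed

theorem corollary7p1:
  fixes X1 :: "'a topology" and T1 :: "'a \<Rightarrow> 'a"
    and X2 :: "'b topology" and T2 :: "'b \<Rightarrow> 'b"
  assumes "minimal_cantor_system X1 T1"
    and "minimal_cantor_system X2 T2"
    and "orbit_equivalent X1 T1 X2 T2"
  shows "speedup_equivalent X1 T1 X2 T2"
proof -
  obtain T where T: "T \<in> topspace X1 \<rightarrow> topspace X1" "topologically_conjugate X2 T2 X1 T"
    "\<And>x. x \<in> topspace X1 \<Longrightarrow> orbit_of X1 T x = orbit_of X1 T1 x"
    using assms(3) unfolding orbit_equivalent_def by blast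
  have h2: "homeomorphic_map X2 X2 T2" using assms(2) by (simp add: minimal_cantor_system_def)
  \<comment> \<open>\<open>T\<close> is a homeomorphism by conjugacy with \<open>T2\<close>, and its
    orbits are dense because they are those of \<open>T1\<close>.\<close>
  have T_min: "minimal_cantor_system X1 T"
    using assms(1) T(3) conjugate_homeomorphic_map[OF T(2) h2] by (simp add: minimal_cantor_system_def)
  have "T2 \<in> topspace X2 \<rightarrow> topspace X2" using homeomorphic_map_into[OF h2] by blast
  then have "topologically_conjugate X1 T X2 T2" by (rule topologically_conjugate_sym[OF T(2)])
  \<comment> \<open>The same lemma with the roles of \<open>T\<close> and \<open>T1\<close>
    exchanged; the conjugacy then carries the speedup over to \<open>T2\<close>.\<close>
  moreover have "speedup_of X1 T1 X1 T"
    by (rule same_orbits_speedup[OF T_min assms(1)]) (simp add: T(3))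
  ultimately have "speedup_of X1 T1 X2 T2" using speedup_of_conjugate T(1) by blast
  moreover have "speedup_of X2 T2 X1 T1"
    by (rule conjugate_speedup_of[OF T(2) same_orbits_speedup[OF assms(1) T_min T(3)]])
  ultimately show ?thesis by (simp add: speedup_equivalent_def)
qed

end
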